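(* Assume conditions (C1), (C2), (C3) stated in the context hold. Then for any constant $\delta>\sqrt2$ used in the threshold level, as $(n,p)\to\infty$, $$\frac{\hat A_p}{A_p}=1+O_{\mathbb P}\Big(\Big(\sqrt{\tfrac{\log p}{n}}\Big)^{\min(1,2-\tau)}\Big)\quad\text{and}\quad \frac{\|\hat{\boldsymbol\Sigma}_{thr}\|_{\mathrm F}^2}{\|\boldsymbol\Sigma\|_{\mathrm F}^2}=1+O_{\mathbb P}\Big(\Big(\sqrt{\tfrac{\log p}{n}}\Big)^{\min(1,2-\tau)}\Big).$$
   Context: Setting: $p=p_n$, and all parameters may depend on $n,p$. The $p\times n$ data matrix $\mathbf X=(\boldsymbol X_1,\ldots,\boldsymbol X_n)$ with columns $\boldsymbol X_i=(X_{i1},\ldots,X_{ip})'$ is matrix-variate normal, $\mathbf X\sim N(\boldsymbol\mu\mathbf 1',\boldsymbol\Sigma\otimes\boldsymbol\Psi)$, meaning $\mathrm{vec}(\mathbf X')\sim N(\mathrm{vec}(\mathbf 1\boldsymbol\mu'),\boldsymbol\Sigma\otimes\boldsymbol\Psi)$; equivalently the $X_{ik}$ are jointly Gaussian with $\mathbb E X_{ik}=\mu_k$ and $\mathrm{Cov}(X_{ik},X_{jl})=\psi_{ij}\sigma_{kl}$. Here $\boldsymbol\Sigma=(\sigma_{kl})_{p\times p}$ and $\boldsymbol\Psi=(\psi_{ij})_{n\times n}$ are covariance matrices with $\psi_{ii}=1$ for all $i$. Constants do not depend on $n,p$. $\|\cdot\|_{\mathrm F}$ is the Frobenius norm, $a\wedge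 b=\min(a,b)$. Conditions: (C1) $c^{-1}\le\lambda_{\min}(\boldsymbol\Sigma)\le\lambda_{\max}(\boldsymbol\Sigma)\le c$ and $c^{-1}\le\lambda_{\min}(\boldsymbol\Psi)\le\lambda_{\max}(\boldsymbol\Psi)\le c$ for some constant $c>0$. (C2) For some $0<\tau<2$ and a constant $C$, $\sum_{k=1}^n|\psi_{ik}|^\tau\le C$ for all $1\le i\le n$ and $\sum_{k=1}^p|\sigma_{jk}|^\tau\le C$ for all $1\le j\le p$. (C3) $p>cn$ for some constant $c>0$, and $p=\exp(o(n^\gamma))$ with $\gamma=(1-\epsilon)\wedge(\frac2\tau-1)$ for some $\epsilon>0$ (with $\tau$ from (C2)). Estimators: $\bar X_k=\frac1n\sum_{i=1}^nX_{ik}$; $\hat\psi_{ij}=\frac1p\sum_{k=1}^p(X_{ik}-\bar X_k)(X_{jk}-\bar X_k)$ for $1\le i,j\le n$; $\hat\sigma_{ij}=\frac1{n-1}\sum_{k=1}^n(X_{ki}-\bar X_i)(X_{kj}-\bar X_j)$ and $\hat\rho_{ij}=\hat\sigma_{ij}/\sqrt{\hat\sigma_{ii}\hat\sigma_{jj}}$ for $1\le i,j\le p$; $\hat{\boldsymbol\Sigma}=(\hat\sigma_{ij})_{p\times p}$; $\hat{\boldsymbol\Psi}=\big(\frac{p}{\mathrm{tr}(\hat{\boldsymbol\Sigma})}\hat\psi_{ij}\big)_{n\times n}$; $\hat B_n=\frac1n\big(\|\hat{\boldsymbol\Psi}\|_{\mathrm F}^2-\frac1p(\mathrm{tr}(\hat{\boldsymbol\Psi}))^2\big)$.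 The thresholded estimator $\hat{\boldsymbol\Sigma}_{thr}=(\hat\sigma_{ij,thr})_{p\times p}$ has $\hat\sigma_{ii,thr}=\hat\sigma_{ii}$ and, for $i\ne j$, $\hat\sigma_{ij,thr}=\hat\sigma_{ij}\,I\big\{\frac{|\hat\rho_{ij}|}{1-\hat\rho_{ij}^2}\ge\delta\sqrt{\frac{\hat B_n\log p}{n}}\big\}$. Finally $$A_p=\frac{p\|\boldsymbol\Sigma\|_{\mathrm F}^2}{(\mathrm{tr}(\boldsymbol\Sigma))^2},\qquad \hat A_p=\frac{p\|\hat{\boldsymbol\Sigma}_{thr}\|_{\mathrm F}^2}{(\mathrm{tr}(\hat{\boldsymbol\Sigma}_{thr}))^2}.$$ *)

theory Defs
  imports
    "HOL-Probability.Probability"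
    "HOL-Library.Landau_Symbols"
    "Jordan_Normal_Form.Spectral_Radius"
begin

text \<open>
  Dimensions vary with the sample size, so vectors and matrices are those of Jordan_Normal_Form,
  indexed from 0.  The names and infix symbols of the dimension-as-type vectors are hidden.
\<close>

hide_type (open) Finite_Cartesian_Product.vec
hide_const (open) Finite_Cartesian_Product.vec Finite_Cartesian_Product.mat
no_notation Finite_Cartesian_Product.vec_nth (infixl \<open>$\<close> 90)
no_notation inner (infix \<open>\<bullet>\<close> 70)

section \<open>Matrices\<close>

definition mat_trace :: "real mat \<Rightarrow> real" where
  "mat_trace A = (\<Sum>i<dim_row A. A $$ (i, i))"

definition frobenius_norm :: "real mat \<Rightarrow> real" where
  "frobenius_norm A = sqrt (\<Sum>i<dim_row A. \<Sum>j<dim_col A. (A $$ (i, j))\<^sup>2)"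

definition lambda_min :: "real mat \<Rightarrow> real" where
  "lambda_min A = Min (spectrum A)"

definition lambda_max :: "real mat \<Rightarrow> real" where
  "lambda_max A = Max (spectrum A)"

definition covariance_mat :: "nat \<Rightarrow> real mat \<Rightarrow> bool" where
  "covariance_mat d A \<longleftrightarrow> A \<in> carrier_mat d d \<and> transpose_mat A = A \<and>
     (\<forall>v \<in> carrier_vec d. v \<bullet> (A *\<^sub>v v) \<ge> 0)"

text \<open>Columns are stacked on top of each other.\<close>

definition vectorize :: "real mat \<Rightarrow> real vec" where
  "vectorize A = vec (dim_row A * dim_col A) (\<lambda>r. A $$ (r mod dim_row A, r div dim_row A))"

definition kronecker :: "real mat \<Rightarrow> real mat \<Rightarrow> real mat" where
  "kronecker A B = mat (dim_row A * dim_row B) (dim_col A * dim_col B)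
     (\<lambda>(r, s). A $$ (r div dim_row B, s div dim_col B) * B $$ (r mod dim_row B, s mod dim_col B))"

section \<open>Gaussian distributions\<close>

text \<open>
  The second parameter is the variance, which may vanish; this case is needed because the zero
  linear combination occurs in the definition of a multivariate normal vector.
\<close>

definition normal_measure :: "real \<Rightarrow> real \<Rightarrow> real measure" where
  "normal_measure m v =
     (if v = 0 then return borel m
      else density lborel (\<lambda>x. ennreal (normal_density m (sqrt v) x)))"

text \<open>A random vector is multivariate normal if all its linear combinations are normal.\<close>

definition multivariate_normal :: "'a measure \<Rightarrow> ('a \<Rightarrow> real vec) \<Rightarrow> real vec \<Rightarrow> real mat \<Rightarrow> bool" where
  "multivariate_normal M Y m V \<longleftrightarrow>
     (\<forall>\<omega> \<in> space M. Y \<omega> \<in> carrier_vec (dim_vec m)) \<and>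
     V \<in> carrier_mat (dim_vec m) (dim_vec m) \<and>
     (\<forall>a \<in> carrier_vec (dim_vec m).
        (\<lambda>\<omega>. a \<bullet> Y \<omega>) \<in> borel_measurable M \<and>
        distr M borel (\<lambda>\<omega>. a \<bullet> Y \<omega>) = normal_measure (a \<bullet> m) (a \<bullet> (V *\<^sub>v a)))"

definition matrix_normal ::
  "'a measure \<Rightarrow> ('a \<Rightarrow> real mat) \<Rightarrow> real mat \<Rightarrow> real mat \<Rightarrow> real mat \<Rightarrow> bool" where
  "matrix_normal M X \<mu> \<Sigma> \<Psi> \<longleftrightarrow>
     (\<forall>\<omega> \<in> space M. X \<omega> \<in> carrier_mat (dim_row \<mu>) (dim_col \<mu>)) \<and>
     multivariate_normal M (\<lambda>\<omega>. vectorize (transpose_mat (X \<omega>)))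
       (vectorize (transpose_mat \<mu>)) (kronecker \<Sigma> \<Psi>)"

section \<open>Estimators\<close>

text \<open>
  All estimators are functions of the realised data matrix \<open>x\<close>, which has \<open>p = dim_row x\<close> rows
  (variables) and \<open>n = dim_col x\<close> columns (observations): the value \<open>X\<^sub>i\<^sub>k\<close> of variable \<open>k\<close> in
  observation \<open>i\<close> is \<open>x $$ (k, i)\<close>.
\<close>

definition sample_mean :: "real mat \<Rightarrow> nat \<Rightarrow> real" where
  "sample_mean x k = (\<Sum>i<dim_col x. x $$ (k, i)) / real (dim_col x)"

definition psi_hat :: "real mat \<Rightarrow> nat \<Rightarrow> nat \<Rightarrow> real" where
  "psi_hat x i j =
     (\<Sum>k<dim_row x. (x $$ (k, i) - sample_mean x k) * (x $$ (k, j) - sample_mean x k))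
       / real (dim_row x)"

definition sigma_hat :: "real mat \<Rightarrow> nat \<Rightarrow> nat \<Rightarrow> real" where
  "sigma_hat x i j =
     (\<Sum>k<dim_col x. (x $$ (i, k) - sample_mean x i) * (x $$ (j, k) - sample_mean x j))
       / (real (dim_col x) - 1)"

definition rho_hat :: "real mat \<Rightarrow> nat \<Rightarrow> nat \<Rightarrow> real" where
  "rho_hat x i j = sigma_hat x i j / sqrt (sigma_hat x i i * sigma_hat x j j)"

definition Sigma_hat :: "real mat \<Rightarrow> real mat" where
  "Sigma_hat x = mat (dim_row x) (dim_row x) (\<lambda>(i, j). sigma_hat x i j)"

definition Psi_hat :: "real mat \<Rightarrow> real mat" where
  "Psi_hat x = mat (dim_col x) (dim_col x)
     (\<lambda>(i, j). real (dim_row x) / mat_trace (Sigma_hat x) * psi_hat x i j)"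

definition B_hat :: "real mat \<Rightarrow> real" where
  "B_hat x = ((frobenius_norm (Psi_hat x))\<^sup>2 - (mat_trace (Psi_hat x))\<^sup>2 / real (dim_row x))
     / real (dim_col x)"

text \<open>
  \<open>B_hat\<close> is nonnegative, because \<open>Psi_hat\<close> is positive semidefinite of rank at most \<open>p\<close>.  The
  quotient by \<open>1 - \<rho>\<^sup>2\<close> is 0 in HOL when \<open>\<rho>\<^sup>2 = 1\<close>; for a nondegenerate Gaussian sample with
  \<open>n \<ge> 3\<close> this has probability zero.
\<close>

definition Sigma_thr :: "real \<Rightarrow> real mat \<Rightarrow> real mat" where
  "Sigma_thr \<delta> x = mat (dim_row x) (dim_row x) (\<lambda>(i, j).
     if i = j then sigma_hat x i i
     else if \<bar>rho_hat x i j\<bar> / (1 - (rho_hat x i j)\<^sup>2)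
               \<ge> \<delta> * sqrt (B_hat x * ln (real (dim_row x)) / real (dim_col x))
     then sigma_hat x i j else 0)"

text \<open>
  \<open>A\<^sub>p\<close> is \<open>A_ratio\<close> of the population covariance, its estimator is \<open>A_ratio\<close> of the thresholded one.
\<close>

definition A_ratio :: "real mat \<Rightarrow> real" where
  "A_ratio S = real (dim_row S) * (frobenius_norm S)\<^sup>2 / (mat_trace S)\<^sup>2"

section \<open>Stochastic order\<close>

text \<open>
  \<open>Y n = O\<^sub>P(r n)\<close>, where the probability space may depend on \<open>n\<close>.  The bound is put on the
  probability of the good event, as a set outside the sigma algebra has measure 0 in HOL.
\<close>

definition bigO_prob :: "(nat \<Rightarrow> 'a measure) \<Rightarrow> (nat \<Rightarrow> 'a \<Rightarrow> real) \<Rightarrow> (nat \<Rightarrow> real) \<Rightarrow> bool" where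
  "bigO_prob M Y r \<longleftrightarrow>
     (\<forall>\<epsilon>>0. \<exists>K. \<forall>\<^sub>F n in sequentially.
        measure (M n) {\<omega> \<in> space (M n). \<bar>Y n \<omega>\<bar> \<le> K * r n} \<ge> 1 - \<epsilon>)"

end

theory Submission
  imports Defs
begin

text \<open>
  The centred data have covariance \<open>\<Sigma> \<otimes> P\<Psi>P\<close> with \<open>P = I - 11'/n\<close>; rotating the observations into
  an eigenbasis of \<open>P\<Psi>P\<close>, with eigenvalues \<open>l\<^sub>a\<close>, turns every sample covariance into a sum
  \<open>\<Sum>\<^sub>a G\<^sub>i\<^sub>a G\<^sub>j\<^sub>a\<close> of independent products.  Polarization and the moment generating function of a
  squared normal bound the exponential moments of such a sum with the sharp variance
  \<open>(1 + \<rho>\<^sup>2) F\<close>, \<open>F = \<Sum>\<^sub>a l\<^sub>a\<^sup>2\<close>.  A Chernoff bound then shows that all sample covariances deviate by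
  \<open>O(sqrt (ln p / n))\<close>, and that a pair with small correlation exceeds a threshold with constant
  \<open>d > sqrt 2\<close> with probability at most \<open>2 / p\<close>, so that only \<open>O(p)\<close> of the \<open>p\<^sup>2\<close> pairs do so.

  The factor \<open>B\<close> of the threshold need not be consistent: it only has to be bounded and asymptotically
  at least \<open>F / n\<close>.  For the lower bound rotate the variables into an eigenbasis of \<open>\<Sigma>\<close>.  The
  off-diagonal part of the Gram matrix is then a sum over pairs of independent rows; it concentrates
  by Chebyshev's inequality, because disjoint pairs are uncorrelated, while the Cauchy-Schwarz
  inequality absorbs the bias correction into the diagonal part.

  On these events the estimation error is bounded entry by entry: large entries cost
  \<open>sqrt (ln p / n) * \<bar>\<sigma>\<^sub>i\<^sub>j\<bar>\<close>, killed entries \<open>\<sigma>\<^sub>i\<^sub>j\<^sup>2\<close>, and each of the \<open>O(p)\<close> falsely kept ones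
  \<open>O(ln p / n)\<close>; the first two are summed with the sparsity condition on \<open>\<Sigma>\<close>.
\<close>

section \<open>Spectral decomposition of real symmetric matrices\<close>

text \<open>The normal law is given only through one-dimensional linear combinations, so
  independence has to be derived from characteristic functions. The value \<open>sqrt 2\<close>
  comes from the Chernoff exponent: for a negligible correlation the variance is about
  \<open>F\<close>, so exceeding \<open>d * sqrt (F * ln p)\<close> has probability about
  \<open>p\<close> to the power \<open>- d^2 / 2\<close>. The squared Frobenius norm of
  \<open>\<Sigma>\<close> is at least of order \<open>p\<close>, hence \<open>p\<close> false alarms
  of size \<open>ln p / n\<close> are affordable. The gap between \<open>sqrt 2\<close> and
  \<open>\<delta>\<close> is spent on all inexact steps: \<open>a\<close> bounds the correlations
  that count as small, \<open>\<kappa>\<close> the relative loss in the variance,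
  \<open>\<eta>\<close> the loss in the lower bound for \<open>B_hat\<close>. Leading constants of
  exponential moments and of that lower bound must therefore be exact; elsewhere they may be crude.
  The exponent \<open>min 1 (2 - \<tau>)\<close> reflects two sources of error: diagonal entries,
  never thresholded, cost \<open>lam\<close> each, while killed entries cost \<open>lam\<close> to
  the power \<open>2 - \<tau>\<close>.\<close>

lemma orthogonal_unit_vector_exists:
  fixes u :: "nat \<Rightarrow> nat \<Rightarrow> real"
  assumes "k < d"
  shows "\<exists>x. (\<forall>i\<ge>d. x i = 0) \<and> (\<Sum>i<d. (x i)\<^sup>2) = 1 \<and> (\<forall>m<k. (\<Sum>i<d. u m i * x i) = 0)"
proof -
  define A where "A = mat d d (\<lambda>(i, j). if i < k then u i j else 0)"
  have A: "A \<in> carrier_mat d d" by (simp add: A_def)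
  \<comment> \<open>Fewer than \<open>d\<close> conditions, padded with zero rows to a square
    matrix, give a matrix whose transpose kills a unit vector. It is singular and so has a nonzero
    kernel vector.\<close>
  have "row A k = 0\<^sub>v d"
    using assms by (auto simp: A_def row_def)
  hence "transpose_mat A *\<^sub>v unit_vec d k = 0\<^sub>v d"
    using assms A by (intro eq_vecI) (auto simp: A_def row_def scalar_prod_def unit_vec_def if_distrib cong: if_cong)
  hence "det (transpose_mat A) = 0"
    using assms A by (subst det_0_iff_vec_prod_zero_field[of _ d]) (auto intro!: exI[of _ "unit_vec d k"])
  hence "det A = 0" using det_transpose[OF A] by simp
  then obtain v where v: "v \<in> carrier_vec d" "v \<noteq> 0\<^sub>v d" "A *\<^sub>v v = 0\<^sub>v d"
    using det_0_iff_vec_prod_zero_field[OF A] by auto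
  define r where "r = sqrt (\<Sum>i<d. (v $ i)\<^sup>2)"
  have "(\<Sum>i<d. (v $ i)\<^sup>2) \<noteq> 0"
  proof
    assume "(\<Sum>i<d. (v $ i)\<^sup>2) = 0"
    hence "\<forall>i<d. v $ i = 0" by (subst (asm) sum_nonneg_eq_0_iff) auto
    hence "v = 0\<^sub>v d" using v(1) by (intro eq_vecI) auto
    with v(2) show False by simp
  qed
  hence r2: "(\<Sum>i<d. (v $ i)\<^sup>2) = r\<^sup>2" "r > 0"
    by (auto simp: r_def sum_nonneg less_le)
  define x where "x i = (if i < d then v $ i / r else 0)" for i
  have "(\<Sum>i<d. (x i)\<^sup>2) = 1"
  proof -
    have "(\<Sum>i<d. (x i)\<^sup>2) = (\<Sum>i<d. (v $ i)\<^sup>2) / r\<^sup>2"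
      by (simp add: x_def power_divide sum_divide_distrib)
    thus ?thesis using r2 by simp
  qed
  moreover have "(\<Sum>i<d. u m i * x i) = 0" if "m < k" for m
  proof -
    have "0 = (A *\<^sub>v v) $ m" using v(3) that assms by simp
    also have "\<dots> = (\<Sum>i<d. u m i * v $ i)"
      using that assms v(1) A by (auto simp: A_def row_def scalar_prod_def atLeast0LessThan)
    finally have "(\<Sum>i<d. u m i * v $ i) = 0" by simp
    moreover have "(\<Sum>i<d. u m i * x i) = (\<Sum>i<d. u m i * v $ i) / r"
      by (simp add: x_def sum_divide_distrib)
    ultimately show ?thesis by simp
  qed
  ultimately show ?thesis by (intro exI[of _ x]) (auto simp: x_def)
qed

text \<open>The sphere lives in the space of all sequences, so compactness comes from Tychonoff's
  theorem: coordinates from \<open>d\<close> on are pinned to 0, and the unit norm puts the others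
  into \<open>[-1, 1]\<close>.\<close>

lemma quadratic_form_attains_min:
  fixes u A :: "nat \<Rightarrow> nat \<Rightarrow> real"
  assumes "k < d"
  defines "S \<equiv> {x. (\<forall>i\<ge>d. x i = 0) \<and> (\<Sum>i<d. (x i)\<^sup>2) = 1 \<and> (\<forall>m<k. (\<Sum>i<d. u m i * x i) = 0)}"
  shows "\<exists>x\<in>S. \<forall>y\<in>S. (\<Sum>i<d. \<Sum>j<d. A i j * x i * x j) \<le> (\<Sum>i<d. \<Sum>j<d. A i j * y i * y j)"
proof (rule continuous_attains_inf)
  show "S \<noteq> {}" using orthogonal_unit_vector_exists[OF assms(1), of u] by (auto simp: S_def)
  have "compact (PiE UNIV (\<lambda>_::nat. {-1..1::real}))"
    unfolding compactin_euclidean_iff[symmetric] euclidean_product_topology[symmetric]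
    by (subst compactin_PiE) auto
  moreover have "closed S"
  proof -
    have "S = (\<Inter>i\<in>{d..}. {x. x i = 0}) \<inter> {x. (\<Sum>i<d. (x i)\<^sup>2) = 1} \<inter> (\<Inter>m\<in>{..<k}. {x. (\<Sum>i<d. u m i * x i) = 0})"
      by (auto simp: S_def)
    also have "closed \<dots>"
      by (intro closed_Int closed_INT ballI closed_Collect_eq continuous_intros) auto
    finally show ?thesis .
  qed
  moreover have "S \<subseteq> PiE UNIV (\<lambda>_::nat. {-1..1::real})"
  proof
    fix x assume x: "x \<in> S"
    have "x i \<in> {-1..1}" for i
    proof (cases "i < d")
      case True
      hence "(x i)\<^sup>2 \<le> (\<Sum>i<d. (x i)\<^sup>2)" by (intro member_le_sum) auto
      thus ?thesis using x by (auto simp: S_def abs_square_le_1 abs_le_iff)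
    qed (use x in \<open>auto simp: S_def\<close>)
    thus "x \<in> PiE UNIV (\<lambda>_::nat. {-1..1::real})" by auto
  qed
  ultimately show "compact S"
    by (metis compact_Int_closed inf.absorb_iff2)
  show "continuous_on S (\<lambda>x. \<Sum>i<d. \<Sum>j<d. A i j * x i * x j)"
    by (intro continuous_intros continuous_on_subset[OF continuous_on_product_coordinates]) auto
qed

text \<open>First-order optimality without derivatives: for small \<open>s\<close> the linear term
  dominates, and \<open>s = - b / (\<bar>c\<bar> + 1)\<close> makes the expression negative unless
  \<open>b = 0\<close>.\<close>

lemma linear_coefficient_zero:
  fixes b c :: real
  assumes "\<And>s. 0 \<le> 2 * s * b + s\<^sup>2 * c"
  shows "b = 0"
proof (rule ccontr)
  assume b: "b \<noteq> 0"
  define m where "m = \<bar>c\<bar> + 1"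
  have m: "m > 0" "c < m" by (auto simp: m_def)
  have "2 * (-b / m) * b + (-b / m)\<^sup>2 * c = (b\<^sup>2 / m) * (c / m - 2)"
    using m by (simp add: field_simps power2_eq_square)
  moreover have "b\<^sup>2 / m > 0" using b m by simp
  moreover have "c / m < 1" using m by (simp add: field_simps)
  ultimately have "2 * (-b / m) * b + (-b / m)\<^sup>2 * c < 0"
    by (metis diff_less_0_iff_less less_trans mult_pos_neg one_less_numeral_iff semiring_norm(76))
  with assms[of "-b / m"] show False by simp
qed

text \<open>Minimising the quadratic form over the unit vectors orthogonal to the eigenvectors
  already found yields the next one, with the minimum as eigenvalue. Homogeneity extends minimality
  to all vectors of that complement, which is what a perturbation of the minimiser requires.\<close>

lemma next_eigenvector:
  fixes u A :: "nat \<Rightarrow> nat \<Rightarrow> real"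
  assumes sym: "\<And>i j. i < d \<Longrightarrow> j < d \<Longrightarrow> A i j = A j i"
    and k: "k < d"
    and eig: "\<And>m i. m < k \<Longrightarrow> i < d \<Longrightarrow> (\<Sum>j<d. A i j * u m j) = l m * u m i"
  shows "\<exists>x q. (\<Sum>i<d. (x i)\<^sup>2) = 1 \<and> (\<forall>m<k. (\<Sum>i<d. u m i * x i) = 0) \<and>
    (\<forall>i<d. (\<Sum>j<d. A i j * x j) = q * x i) \<and>
    (\<forall>y. (\<forall>m<k. (\<Sum>i<d. u m i * y i) = 0) \<longrightarrow>
       q * (\<Sum>i<d. (y i)\<^sup>2) \<le> (\<Sum>i<d. \<Sum>j<d. A i j * y i * y j))"
proof -
  define Q where "Q y = (\<Sum>i<d. \<Sum>j<d. A i j * y i * y j)" for y :: "nat \<Rightarrow> real"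
  obtain x where x: "\<forall>i\<ge>d. x i = 0" "(\<Sum>i<d. (x i)\<^sup>2) = 1" "\<forall>m<k. (\<Sum>i<d. u m i * x i) = 0"
    and xmin: "\<And>y. \<forall>i\<ge>d. y i = 0 \<Longrightarrow> (\<Sum>i<d. (y i)\<^sup>2) = 1 \<Longrightarrow> \<forall>m<k. (\<Sum>i<d. u m i * y i) = 0 \<Longrightarrow> Q x \<le> Q y"
    using quadratic_form_attains_min[OF k, of u A] by (auto simp: Q_def)
  define q where "q = Q x"
  have ge: "q * (\<Sum>i<d. (y i)\<^sup>2) \<le> Q y" if orth: "\<forall>m<k. (\<Sum>i<d. u m i * y i) = 0" for y
  proof (cases "(\<Sum>i<d. (y i)\<^sup>2) = 0")
    case True
    hence "\<forall>i<d. y i = 0" by (subst (asm) sum_nonneg_eq_0_iff) auto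
    hence "Q y = 0" by (simp add: Q_def)
    with True show ?thesis by simp
  next
    case False
    define r where "r = sqrt (\<Sum>i<d. (y i)\<^sup>2)"
    have r: "(\<Sum>i<d. (y i)\<^sup>2) = r\<^sup>2" "r > 0" using False by (auto simp: r_def sum_nonneg less_le)
    define z where "z i = (if i < d then y i / r else 0)" for i
    have "(\<Sum>i<d. (z i)\<^sup>2) = (\<Sum>i<d. (y i)\<^sup>2) / r\<^sup>2"
      by (simp add: z_def power_divide sum_divide_distrib)
    moreover have "(\<Sum>i<d. u m i * z i) = (\<Sum>i<d. u m i * y i) / r" for m
      by (simp add: z_def sum_divide_distrib)
    ultimately have "q \<le> Q z" unfolding q_def using r orth by (intro xmin) (auto simp: z_def)
    also have "Q z = Q y / r\<^sup>2"
      by (simp add: Q_def z_def sum_divide_distrib power2_eq_square)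
    finally show ?thesis using r by (simp add: field_simps)
  qed
  \<comment> \<open>The residual lies in the orthogonal complement, because a symmetric matrix with
    invariant span of the \<open>u m\<close> also preserves its complement. It is an admissible
    direction, and the first-order change of the form along it is twice its squared norm
    \<open>b\<close>, which must vanish.\<close>
  define w where "w i = (\<Sum>j<d. A i j * x j) - q * x i" for i
  have w_orth: "\<forall>m<k. (\<Sum>i<d. u m i * w i) = 0"
  proof safe
    fix m assume m: "m < k"
    have "(\<Sum>i<d. u m i * w i) = (\<Sum>i<d. \<Sum>j<d. u m i * A i j * x j) - q * (\<Sum>i<d. u m i * x i)"
      by (simp add: w_def algebra_simps sum_subtractf sum_distrib_left)
    also have "(\<Sum>i<d. \<Sum>j<d. u m i * A i j * x j) = (\<Sum>j<d. x j * (\<Sum>i<d. A j i * u m i))"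
      by (subst sum.swap) (auto simp: sum_distrib_left sym intro!: sum.cong)
    also have "\<dots> = (\<Sum>j<d. x j * (l m * u m j))"
      using eig[OF m] by simp
    also have "\<dots> = l m * (\<Sum>j<d. u m j * x j)"
      by (simp add: sum_distrib_left mult_ac)
    finally show "(\<Sum>i<d. u m i * w i) = 0" using x(3) m by simp
  qed
  define b where "b = (\<Sum>i<d. (w i)\<^sup>2)"
  have "b = 0"
  proof (rule linear_coefficient_zero)
    fix s
    define c where "c = Q w - q * (\<Sum>i<d. (w i)\<^sup>2)"
    let ?y = "\<lambda>i. x i + s * w i"
    have "\<forall>m<k. (\<Sum>i<d. u m i * ?y i) = 0"
      using x(3) w_orth by (simp add: algebra_simps sum.distrib flip: sum_distrib_left)
    from ge[OF this] have "0 \<le> Q ?y - q * (\<Sum>i<d. (?y i)\<^sup>2)" by simp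
    also have "Q ?y = Q x + s * (\<Sum>i<d. \<Sum>j<d. A i j * x i * w j) + s * (\<Sum>i<d. \<Sum>j<d. A i j * w i * x j) + s\<^sup>2 * Q w"
      by (simp add: Q_def algebra_simps sum.distrib sum_distrib_left power2_eq_square)
    also have "(\<Sum>i<d. \<Sum>j<d. A i j * x i * w j) = (\<Sum>i<d. \<Sum>j<d. A i j * w i * x j)"
      by (subst sum.swap) (auto simp: sym mult_ac intro!: sum.cong)
    also have "(\<Sum>i<d. (?y i)\<^sup>2) = (\<Sum>i<d. (x i)\<^sup>2) + 2 * s * (\<Sum>i<d. w i * x i) + s\<^sup>2 * (\<Sum>i<d. (w i)\<^sup>2)"
      by (simp add: algebra_simps sum.distrib sum_distrib_left power2_eq_square)
    also have "Q x + s * (\<Sum>i<d. \<Sum>j<d. A i j * w i * x j) + s * (\<Sum>i<d. \<Sum>j<d. A i j * w i * x j) + s\<^sup>2 * Q w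
      - q * ((\<Sum>i<d. (x i)\<^sup>2) + 2 * s * (\<Sum>i<d. w i * x i) + s\<^sup>2 * (\<Sum>i<d. (w i)\<^sup>2))
      = 2 * s * ((\<Sum>i<d. \<Sum>j<d. A i j * w i * x j) - q * (\<Sum>i<d. w i * x i)) + s\<^sup>2 * c"
      using x(2) by (simp add: q_def c_def algebra_simps)
    also have "(\<Sum>i<d. \<Sum>j<d. A i j * w i * x j) - q * (\<Sum>i<d. w i * x i) = b"
    proof -
      have "(\<Sum>i<d. \<Sum>j<d. A i j * w i * x j) = (\<Sum>i<d. w i * (\<Sum>j<d. A i j * x j))"
        by (simp add: sum_distrib_left mult_ac)
      moreover have "q * (\<Sum>i<d. w i * x i) = (\<Sum>i<d. w i * (q * x i))"
        by (simp add: sum_distrib_left mult_ac)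
      moreover have "b = (\<Sum>i<d. w i * ((\<Sum>j<d. A i j * x j) - q * x i))"
        by (simp add: b_def power2_eq_square w_def[symmetric])
      ultimately show ?thesis by (simp add: right_diff_distrib sum_subtractf)
    qed
    finally show "0 \<le> 2 * s * b + s\<^sup>2 * (Q w - q * (\<Sum>i<d. (w i)\<^sup>2))" by (simp add: c_def)
  qed
  hence "\<forall>i<d. w i = 0" unfolding b_def by (subst (asm) sum_nonneg_eq_0_iff) auto
  hence "\<forall>i<d. (\<Sum>j<d. A i j * x j) = q * x i" by (auto simp: w_def)
  thus ?thesis using x ge by (intro exI[of _ x] exI[of _ q]) (auto simp: Q_def)
qed

definition spectral_decomp :: "nat \<Rightarrow> (nat \<Rightarrow> nat \<Rightarrow> real) \<Rightarrow> (nat \<Rightarrow> nat \<Rightarrow> real) \<Rightarrow> (nat \<Rightarrow> real) \<Rightarrow> bool" where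
  "spectral_decomp d A u l \<longleftrightarrow>
     (\<forall>k<d. \<forall>m<d. (\<Sum>i<d. u k i * u m i) = of_bool (k = m)) \<and>
     (\<forall>k<d. \<forall>i<d. (\<Sum>j<d. A i j * u k j) = l k * u k i)"

theorem spectral_decomp_exists:
  assumes sym: "\<And>i j. i < d \<Longrightarrow> j < d \<Longrightarrow> A i j = A j i"
  shows "\<exists>u l. spectral_decomp d A u l"
proof -
  have "k \<le> d \<Longrightarrow> \<exists>u l. (\<forall>a<k. \<forall>m<k. (\<Sum>i<d. u a i * u m i) = of_bool (a = m)) \<and>
     (\<forall>a<k. \<forall>i<d. (\<Sum>j<d. A i j * u a j) = l a * u a i)" for k
  proof (induction k)
    case (Suc k)
    then obtain u l where IH: "\<forall>a<k. \<forall>m<k. (\<Sum>i<d. u a i * u m i) = of_bool (a = m)"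
      "\<forall>a<k. \<forall>i<d. (\<Sum>j<d. A i j * u a j) = l a * u a i" by auto
    obtain x q where x: "(\<Sum>i<d. (x i)\<^sup>2) = 1" "\<forall>m<k. (\<Sum>i<d. u m i * x i) = 0"
      "\<forall>i<d. (\<Sum>j<d. A i j * x j) = q * x i"
      using next_eigenvector[of d A k u l, OF sym] IH Suc.prems by auto
    show ?case
      using IH x
      by (intro exI[of _ "u(k := x)"] exI[of _ "l(k := q)"])
         (auto simp: less_Suc_eq power2_eq_square mult.commute)
  qed simp
  from this[of d] show ?thesis by (auto simp: spectral_decomp_def)
qed

context
  fixes d A u l
  assumes sd: "spectral_decomp d A u l"
begin

lemma spectral_decomp_orthonormal: "k < d \<Longrightarrow> m < d \<Longrightarrow> (\<Sum>i<d. u k i * u m i) = of_bool (k = m)"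
  using sd by (auto simp: spectral_decomp_def)

lemma spectral_decomp_eigen: "k < d \<Longrightarrow> i < d \<Longrightarrow> (\<Sum>j<d. A i j * u k j) = l k * u k i"
  using sd by (auto simp: spectral_decomp_def)

text \<open>A one-sided inverse of a square matrix is two-sided, so orthonormal rows force
  orthonormal columns.\<close>

lemma spectral_decomp_complete:
  assumes "i < d" "j < d"
  shows "(\<Sum>k<d. u k i * u k j) = of_bool (i = j)"
proof -
  define U where "U = mat d d (\<lambda>(k, i). u k i)"
  have U: "U \<in> carrier_mat d d" by (simp add: U_def)
  have "U * transpose_mat U = 1\<^sub>m d"
    by (rule eq_matI) (auto simp: U_def scalar_prod_def atLeast0LessThan spectral_decomp_orthonormal)
  hence "transpose_mat U * U = 1\<^sub>m d"
    by (intro mat_mult_left_right_inverse[OF U]) (use U in auto)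
  hence "(transpose_mat U * U) $$ (i, j) = of_bool (i = j)" using assms by simp
  thus ?thesis using assms by (simp add: U_def scalar_prod_def atLeast0LessThan)
qed

text \<open>Inner products do not depend on the orthonormal basis; this is what permits passing to
  eigenbases inside Gram matrices, on the side of the observations as well as of the
  variables.\<close>

lemma spectral_decomp_parseval:
  "(\<Sum>k<d. (\<Sum>i<d. u k i * x i) * (\<Sum>i<d. u k i * y i)) = (\<Sum>i<d. x i * y i)"
proof -
  have "(\<Sum>k<d. (\<Sum>i<d. u k i * x i) * (\<Sum>i<d. u k i * y i))
      = (\<Sum>k<d. \<Sum>i<d. \<Sum>j<d. x i * y j * (u k i * u k j))"
    by (simp add: sum_product mult_ac)
  also have "\<dots> = (\<Sum>i<d. \<Sum>k<d. \<Sum>j<d. x i * y j * (u k i * u k j))" by (rule sum.swap)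
  also have "\<dots> = (\<Sum>i<d. \<Sum>j<d. \<Sum>k<d. x i * y j * (u k i * u k j))"
    by (intro sum.cong[OF refl] sum.swap)
  also have "\<dots> = (\<Sum>i<d. \<Sum>j<d. x i * y j * of_bool (i = j))"
    by (intro sum.cong refl) (simp add: spectral_decomp_complete flip: sum_distrib_left)
  also have "\<dots> = (\<Sum>i<d. x i * y i)" by (simp add: of_bool_def if_distrib cong: if_cong)
  finally show ?thesis .
qed

lemma spectral_decomp_matrix:
  assumes "i < d" "j < d"
  shows "A i j = (\<Sum>k<d. l k * u k i * u k j)"
proof -
  have "(\<Sum>k<d. l k * u k i * u k j) = (\<Sum>k<d. (\<Sum>m<d. A i m * u k m) * u k j)"
    using assms by (simp add: spectral_decomp_eigen)
  also have "\<dots> = (\<Sum>k<d. \<Sum>m<d. A i m * (u k m * u k j))"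
    by (simp only: sum_distrib_right mult.assoc)
  also have "\<dots> = (\<Sum>m<d. A i m * (\<Sum>k<d. u k m * u k j))"
    by (subst sum.swap) (simp add: sum_distrib_left)
  also have "\<dots> = (\<Sum>m<d. A i m * of_bool (m = j))"
    using assms by (simp add: spectral_decomp_complete)
  also have "\<dots> = A i j" using assms by (simp add: of_bool_def if_distrib cong: if_cong)
  finally show ?thesis by simp
qed

lemma spectral_decomp_bilinear:
  "(\<Sum>i<d. \<Sum>j<d. A i j * x i * y j) = (\<Sum>k<d. l k * (\<Sum>i<d. u k i * x i) * (\<Sum>j<d. u k j * y j))"
proof -
  have "(\<Sum>i<d. \<Sum>j<d. A i j * x i * y j) = (\<Sum>i<d. \<Sum>j<d. \<Sum>k<d. l k * u k i * u k j * x i * y j)"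
    by (intro sum.cong refl) (simp add: spectral_decomp_matrix sum_distrib_right)
  also have "\<dots> = (\<Sum>i<d. \<Sum>k<d. \<Sum>j<d. l k * u k i * u k j * x i * y j)"
    by (intro sum.cong[OF refl] sum.swap)
  also have "\<dots> = (\<Sum>k<d. \<Sum>i<d. \<Sum>j<d. l k * u k i * u k j * x i * y j)" by (rule sum.swap)
  also have "\<dots> = (\<Sum>k<d. l k * (\<Sum>i<d. u k i * x i) * (\<Sum>j<d. u k j * y j))"
    by (simp add: sum_distrib_left sum_distrib_right mult_ac)
  finally show ?thesis .
qed

lemma spectral_decomp_trace: "(\<Sum>i<d. A i i) = (\<Sum>k<d. l k)"
proof -
  have "(\<Sum>i<d. A i i) = (\<Sum>i<d. \<Sum>k<d. l k * u k i * u k i)"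
    by (simp add: spectral_decomp_matrix)
  also have "\<dots> = (\<Sum>k<d. l k * (\<Sum>i<d. u k i * u k i))"
    by (subst sum.swap) (simp add: sum_distrib_left mult_ac)
  also have "\<dots> = (\<Sum>k<d. l k)" by (simp add: spectral_decomp_orthonormal)
  finally show ?thesis .
qed

lemma spectral_decomp_eigenvalue:
  assumes "k < d"
  shows "l k = (\<Sum>i<d. \<Sum>j<d. A i j * u k i * u k j)"
proof -
  have "(\<Sum>i<d. \<Sum>j<d. A i j * u k i * u k j) = (\<Sum>i<d. u k i * (\<Sum>j<d. A i j * u k j))"
    by (simp add: sum_distrib_left mult_ac)
  also have "\<dots> = (\<Sum>i<d. l k * (u k i * u k i))"
    by (intro sum.cong refl) (simp add: assms spectral_decomp_eigen)
  also have "\<dots> = l k" using assms by (simp add: spectral_decomp_orthonormal flip: sum_distrib_left)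
  finally show ?thesis by simp
qed

lemma spectral_decomp_form_bounds:
  assumes "\<And>k. k < d \<Longrightarrow> a \<le> l k" "\<And>k. k < d \<Longrightarrow> l k \<le> b"
  shows "a * (\<Sum>i<d. (x i)\<^sup>2) \<le> (\<Sum>i<d. \<Sum>j<d. A i j * x i * x j)"
    and "(\<Sum>i<d. \<Sum>j<d. A i j * x i * x j) \<le> b * (\<Sum>i<d. (x i)\<^sup>2)"
proof -
  have P: "(\<Sum>i<d. (x i)\<^sup>2) = (\<Sum>k<d. (\<Sum>i<d. u k i * x i)\<^sup>2)"
    using spectral_decomp_parseval[of x x] by (simp add: power2_eq_square)
  show "a * (\<Sum>i<d. (x i)\<^sup>2) \<le> (\<Sum>i<d. \<Sum>j<d. A i j * x i * x j)"
    unfolding P spectral_decomp_bilinear sum_distrib_left[of a] sum_distrib_left[of b]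
    using assms by (intro sum_mono) (simp only: power2_eq_square mult.assoc, auto intro!: mult_right_mono)
  show "(\<Sum>i<d. \<Sum>j<d. A i j * x i * x j) \<le> b * (\<Sum>i<d. (x i)\<^sup>2)"
    unfolding P spectral_decomp_bilinear sum_distrib_left[of a] sum_distrib_left[of b]
    using assms by (intro sum_mono) (simp only: power2_eq_square mult.assoc, auto intro!: mult_right_mono)
qed

end

text \<open>The eigenvalue conditions speak of \<open>Min\<close> and \<open>Max\<close> of the
  spectrum. A vector of norm 1 is nonzero, so each \<open>l k\<close> is a genuine member of that
  finite set.\<close>

lemma spectral_decomp_lambda_bounds:
  assumes S: "S \<in> carrier_mat d d" and sd: "spectral_decomp d (\<lambda>i j. S $$ (i, j)) u l" and k: "k < d"
  shows "lambda_min S \<le> l k" "l k \<le> lambda_max S"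
proof -
  let ?v = "vec d (u k)"
  have "?v \<noteq> 0\<^sub>v d"
  proof
    assume "?v = 0\<^sub>v d"
    hence "\<forall>i<d. u k i = 0" by (metis index_vec index_zero_vec(1))
    hence "(\<Sum>i<d. u k i * u k i) = 0" by simp
    with spectral_decomp_orthonormal[OF sd k k] show False by simp
  qed
  moreover have "S *\<^sub>v ?v = l k \<cdot>\<^sub>v ?v"
    using S spectral_decomp_eigen[OF sd k] by (intro eq_vecI) (auto simp: scalar_prod_def atLeast0LessThan)
  ultimately have "l k \<in> spectrum S"
    using S by (auto simp: spectrum_def eigenvalue_def eigenvector_def intro!: exI[of _ ?v])
  thus "lambda_min S \<le> l k" "l k \<le> lambda_max S"
    using card_finite_spectrum(1)[OF S] by (auto simp: lambda_min_def lambda_max_def)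
qed

section \<open>Jointly normal families\<close>

text \<open>Scaling a standard normal variable covers variance 0 as well, so characters and moments
  transfer without treating the degenerate case separately.\<close>

lemma normal_measure_eq_distr:
  assumes "v \<ge> 0"
  shows "normal_measure 0 v = distr std_normal_distribution borel (\<lambda>x. sqrt v * x)"
proof (cases "v = 0")
  case True
  interpret prob_space std_normal_distribution by (rule prob_space_normal_density) simp
  have "distr std_normal_distribution borel (\<lambda>x. 0::real) = return borel 0"
    by (rule distr_const) auto
  with True show ?thesis by (simp add: normal_measure_def)
next
  case False
  hence v: "sqrt v > 0" using assms by simp
  interpret prob_space std_normal_distribution by (rule prob_space_normal_density) simp
  have "distributed std_normal_distribution lborel (\<lambda>x. x) std_normal_density"
    by (auto simp: distributed_def emeasure_distr intro!: measure_eqI)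
  from normal_density_affine[OF this, of "sqrt v" 0] v
  have "distributed std_normal_distribution lborel (\<lambda>x. sqrt v * x) (normal_density 0 (sqrt v))" by simp
  hence "distr std_normal_distribution lborel (\<lambda>x. sqrt v * x) = density lborel (normal_density 0 (sqrt v))"
    by (simp add: distributed_def)
  moreover have "distr std_normal_distribution lborel (\<lambda>x. sqrt v * x) = distr std_normal_distribution borel (\<lambda>x. sqrt v * x)"
    by (rule distr_cong) auto
  ultimately show ?thesis using False by (simp add: normal_measure_def)
qed

lemma real_distribution_normal_measure: "v \<ge> 0 \<Longrightarrow> real_distribution (normal_measure 0 v)"
  unfolding normal_measure_eq_distr
  by (intro prob_space.real_distribution_distr prob_space_normal_density) auto

lemma char_normal_measure:
  assumes "v \<ge> 0"
  shows "char (normal_measure 0 v) t = of_real (exp (- (t\<^sup>2 * v) / 2))"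
proof -
  have "char (normal_measure 0 v) t = char std_normal_distribution (sqrt v * t)"
    unfolding normal_measure_eq_distr[OF assms] char_def
    by (subst integral_distr) (auto simp: mult_ac)
  thus ?thesis using assms by (simp add: char_std_normal_distribution power_mult_distrib mult_ac)
qed

text \<open>Tilting: \<open>g / \<kappa>\<close> is the density of a probability measure under which
  \<open>Z\<close> has the characteristic function of \<open>N\<close>, so Levy's theorem identifies
  its law. Taking \<open>t = 0\<close> shows that \<open>\<kappa>\<close> is the integral of
  \<open>g\<close>; if it is 0, then \<open>g\<close> vanishes almost everywhere and so do both
  sides.\<close>

lemma (in prob_space) weighted_char_uniqueness:
  fixes g Z :: "'a \<Rightarrow> real"
  assumes [measurable]: "g \<in> borel_measurable M" "Z \<in> borel_measurable M" "B \<in> sets borel"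
    and g: "\<And>\<omega>. 0 \<le> g \<omega>" "\<And>\<omega>. g \<omega> \<le> C"
    and N: "real_distribution N"
    and ch: "\<And>t. (CLINT \<omega>|M. of_real (g \<omega>) * iexp (t * Z \<omega>)) = of_real \<kappa> * char N t"
  shows "(\<integral>\<omega>. g \<omega> * indicator B (Z \<omega>) \<partial>M) = \<kappa> * measure N B"
proof -
  interpret N: real_distribution N by fact
  have int_g[simp]: "integrable M g"
    by (rule integrable_const_bound[where B=C]) (use g in auto)
  have "complex_of_real (\<integral>\<omega>. g \<omega> \<partial>M) = (CLINT \<omega>|M. of_real (g \<omega>) * iexp (0 * Z \<omega>))" by simp
  also have "\<dots> = of_real \<kappa>" by (subst ch) (simp add: N.char_zero)
  finally have \<kappa>: "(\<integral>\<omega>. g \<omega> \<partial>M) = \<kappa>" by (metis of_real_eq_iff)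
  show ?thesis
  proof (cases "\<kappa> = 0")
    case True
    hence "AE \<omega> in M. g \<omega> = 0" using \<kappa> g integral_nonneg_eq_0_iff_AE[OF int_g] by auto
    hence "(\<integral>\<omega>. g \<omega> * indicator B (Z \<omega>) \<partial>M) = (\<integral>\<omega>. 0 \<partial>M)"
      by (intro integral_cong_AE) auto
    with True show ?thesis by simp
  next
    case False
    have "\<kappa> \<ge> 0" using \<kappa> g by (metis integral_nonneg_AE AE_I2)
    with False have kpos: "\<kappa> > 0" by simp
    define D where "D = density M (\<lambda>\<omega>. ennreal (g \<omega> / \<kappa>))"
    have D_int: "(\<integral>\<omega>. f \<omega> \<partial>D) = (\<integral>\<omega>. (g \<omega> / \<kappa>) *\<^sub>R f \<omega> \<partial>M)"
      if "f \<in> borel_measurable M" for f :: "'a \<Rightarrow> 'b :: {banach, second_countable_topology}"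
      unfolding D_def using that g kpos by (intro integral_density) auto
    have pD: "prob_space D"
    proof
      have "emeasure D (space D) = (\<integral>\<^sup>+\<omega>. ennreal (g \<omega> / \<kappa>) \<partial>M)"
        by (simp add: D_def emeasure_density cong: nn_integral_cong)
      also have "\<dots> = ennreal (\<integral>\<omega>. g \<omega> / \<kappa> \<partial>M)"
        using g kpos by (intro nn_integral_eq_integral) auto
      also have "\<dots> = 1" using \<kappa> kpos by simp
      finally show "emeasure D (space D) = 1" .
    qed
    have [measurable]: "Z \<in> borel_measurable D" by (simp add: D_def)
    have "char (distr D borel Z) = char N"
    proof
      fix t
      have "char (distr D borel Z) t = (CLINT \<omega>|D. iexp (t * Z \<omega>))"
        by (simp add: char_def integral_distr)
      also have "\<dots> = (CLINT \<omega>|M. (1 / \<kappa>) *\<^sub>R (of_real (g \<omega>) * iexp (t * Z \<omega>)))"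
        by (subst D_int) (auto simp: scaleR_conv_of_real intro!: Bochner_Integration.integral_cong)
      also have "\<dots> = (1 / \<kappa>) *\<^sub>R (of_real \<kappa> * char N t)"
        by (simp only: integral_scaleR_right ch)
      also have "\<dots> = char N t" using kpos by (simp add: scaleR_conv_of_real)
      finally show "char (distr D borel Z) t = char N t" .
    qed
    hence "distr D borel Z = N"
      using pD N by (intro Levy_uniqueness) (auto intro!: prob_space.real_distribution_distr)
    hence "measure N B = measure D (Z -` B \<inter> space M)"
      by (subst \<open>distr D borel Z = N\<close>[symmetric]) (subst measure_distr, auto simp: D_def)
    also have "\<dots> = (\<integral>\<omega>. indicator (Z -` B \<inter> space M) \<omega> \<partial>D)"
      by (simp add: D_def)
    also have "\<dots> = (\<integral>\<omega>. (g \<omega> / \<kappa>) *\<^sub>R indicator (Z -` B \<inter> space M) \<omega> \<partial>M)"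
      by (rule D_int) measurable
    also have "\<dots> = (\<integral>\<omega>. (g \<omega> * indicator B (Z \<omega>)) / \<kappa> \<partial>M)"
      by (intro Bochner_Integration.integral_cong) (auto simp: indicator_def)
    finally show ?thesis using kpos by simp
  qed
qed

text \<open>Independent centred normals with variances \<open>v\<close>, encoded by the laws of
  their linear combinations because this is the form in which the law of the data is given;
  independence becomes a theorem.\<close>

definition gauss_family :: "'a measure \<Rightarrow> 'i set \<Rightarrow> ('i \<Rightarrow> 'a \<Rightarrow> real) \<Rightarrow> ('i \<Rightarrow> real) \<Rightarrow> bool" where
  "gauss_family M I Z v \<longleftrightarrow> finite I \<and> (\<forall>i\<in>I. Z i \<in> borel_measurable M) \<and> (\<forall>i\<in>I. 0 \<le> v i) \<and>
     (\<forall>a. distr M borel (\<lambda>\<omega>. \<Sum>i\<in>I. a i * Z i \<omega>) = normal_measure 0 (\<Sum>i\<in>I. (a i)\<^sup>2 * v i))"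

text \<open>
  Coordinates are converted one at a time from characters to indicators.  The characters of the
  remaining coordinates are complex, so Levy's uniqueness theorem is applied to the nonnegative
  weights \<open>1 + cos (s - \<phi>)\<close> instead.
\<close>

lemma (in prob_space) gauss_family_joint:
  assumes gf: "gauss_family M I Z v" and J: "finite J" "J \<subseteq> I"
    and B: "\<And>j. j \<in> J \<Longrightarrow> B j \<in> sets borel"
  shows "(CLINT \<omega>|M. of_real (\<Prod>j\<in>J. indicator (B j) (Z j \<omega>)) * iexp (\<Sum>m\<in>I - J. t m * Z m \<omega>))
    = of_real ((\<Prod>j\<in>J. measure (normal_measure 0 (v j)) (B j)) * exp (- (\<Sum>m\<in>I - J. (t m)\<^sup>2 * v m) / 2))"
  using J B
proof (induction arbitrary: t rule: finite_induct)
  case empty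
  have fin: "finite I" and Z[measurable]: "\<And>i. i \<in> I \<Longrightarrow> Z i \<in> borel_measurable M"
    and v: "\<And>i. i \<in> I \<Longrightarrow> 0 \<le> v i" using gf by (auto simp: gauss_family_def)
  have "(CLINT \<omega>|M. iexp (\<Sum>m\<in>I. t m * Z m \<omega>)) = char (distr M borel (\<lambda>\<omega>. \<Sum>i\<in>I. t i * Z i \<omega>)) 1"
    by (simp add: char_def integral_distr)
  also have "distr M borel (\<lambda>\<omega>. \<Sum>i\<in>I. t i * Z i \<omega>) = normal_measure 0 (\<Sum>i\<in>I. (t i)\<^sup>2 * v i)"
    using gf by (auto simp: gauss_family_def)
  also have "char \<dots> 1 = of_real (exp (- (\<Sum>i\<in>I. (t i)\<^sup>2 * v i) / 2))"
    by (subst char_normal_measure) (auto intro!: sum_nonneg mult_nonneg_nonneg v)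
  finally show ?case by simp
next
  case (insert j J)
  have fin: "finite I" and Z[measurable]: "\<And>i. i \<in> I \<Longrightarrow> Z i \<in> borel_measurable M"
    and v: "\<And>i. i \<in> I \<Longrightarrow> 0 \<le> v i" using gf by (auto simp: gauss_family_def)
  have [measurable]: "\<And>i. i \<in> J \<Longrightarrow> B i \<in> sets borel" "B j \<in> sets borel"
    "\<And>i. i \<in> J \<Longrightarrow> Z i \<in> borel_measurable M" "Z j \<in> borel_measurable M"
    using insert.prems insert.hyps by auto
  define I' where "I' = I - insert j J"
  have IJ: "I - J = insert j I'" "j \<notin> I'" "finite I'" using insert.prems insert.hyps fin by (auto simp: I'_def)
  have [measurable]: "\<And>i. i \<in> I' \<Longrightarrow> Z i \<in> borel_measurable M" by (auto simp: I'_def)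
  define P where "P \<omega> = (\<Prod>j\<in>J. indicator (B j) (Z j \<omega>) :: real)" for \<omega>
  have P[simp]: "0 \<le> P \<omega>" "P \<omega> \<le> 1" for \<omega>
    by (auto simp: P_def intro!: prod_nonneg prod_le_1 split: split_indicator)
  have [measurable]: "P \<in> borel_measurable M" unfolding P_def by measurable
  define s where "s \<omega> = (\<Sum>m\<in>I'. t m * Z m \<omega>)" for \<omega>
  have [measurable]: "s \<in> borel_measurable M" unfolding s_def by measurable
  define \<pi> where "\<pi> = (\<Prod>j\<in>J. measure (normal_measure 0 (v j)) (B j))"
  define V where "V = (\<Sum>m\<in>I'. (t m)\<^sup>2 * v m)"
  \<comment> \<open>The parameter \<open>r\<close> ranges over the whole characteristic function of
    \<open>Z j\<close>, while \<open>c\<close> is needed at 0, 1 and -1: these are the multiples of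
    \<open>s\<close> that occur when a cosine of \<open>s\<close> is split into
    exponentials.\<close>
  have IH: "(CLINT \<omega>|M. of_real (P \<omega>) * iexp (r * Z j \<omega> + c * s \<omega>))
      = of_real (\<pi> * (exp (- (r\<^sup>2 * v j) / 2) * exp (- (c\<^sup>2 * V) / 2)))" for r c :: real
  proof -
    have *: "\<And>m. m \<in> I' \<Longrightarrow> m \<noteq> j" using IJ by auto
    have "(CLINT \<omega>|M. of_real (P \<omega>) * iexp (r * Z j \<omega> + c * s \<omega>))
      = (CLINT \<omega>|M. of_real (\<Prod>j\<in>J. indicator (B j) (Z j \<omega>)) * iexp (\<Sum>m\<in>I - J. (if m = j then r else c * t m) * Z m \<omega>))"
      using IJ * unfolding P_def s_def sum_distrib_left
      by (intro Bochner_Integration.integral_cong refl) (auto simp: mult_ac intro!: sum.cong arg_cong2[where f="(*)"] arg_cong[where f=exp])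
    also have "\<dots> = of_real (\<pi> * exp (- (\<Sum>m\<in>I - J. ((if m = j then r else c * t m))\<^sup>2 * v m) / 2))"
      unfolding \<pi>_def using insert.prems by (intro insert.IH) auto
    also have "(\<Sum>m\<in>I - J. ((if m = j then r else c * t m))\<^sup>2 * v m) = r\<^sup>2 * v j + c\<^sup>2 * V"
      using IJ * unfolding V_def sum_distrib_left by (auto simp: power_mult_distrib mult_ac intro!: sum.cong)
    finally show ?thesis by (simp add: exp_add[symmetric] add_divide_distrib)
  qed
  have vj: "v j \<ge> 0" using insert.prems v by auto
  define N where "N = normal_measure 0 (v j)"
  have N: "real_distribution N" unfolding N_def by (rule real_distribution_normal_measure[OF vj])
  have chN: "char N r = of_real (exp (- (r\<^sup>2 * v j) / 2))" for r
    unfolding N_def by (rule char_normal_measure[OF vj])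
  have intP[simp]: "integrable M (\<lambda>\<omega>. of_real (P \<omega>) * iexp (h \<omega>))" if [measurable]: "h \<in> borel_measurable M" for h :: "'a \<Rightarrow> real"
    by (rule integrable_const_bound[where B=1]) (auto simp: norm_mult)
  have lin: "(CLINT \<omega>|M. f \<omega> + a * (u * g \<omega> + w * h \<omega>)) = (CLINT \<omega>|M. f \<omega>) + a * (u * (CLINT \<omega>|M. g \<omega>) + w * (CLINT \<omega>|M. h \<omega>))"
    if "integrable M f" "integrable M g" "integrable M h" for f g h :: "'a \<Rightarrow> complex" and a u w
    using that by simp
  have E1: "(\<integral>\<omega>. P \<omega> * indicator (B j) (Z j \<omega>) \<partial>M) = \<pi> * measure N (B j)"
    by (rule weighted_char_uniqueness[where C=1, OF _ _ _ _ _ N]) (use IH[of _ 0] in \<open>auto simp: chN\<close>)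
  have cos_id: "of_real (cos (x - \<phi>)) = (1/2) * (exp (- \<i> * \<phi>) * iexp x + exp (\<i> * \<phi>) * iexp (- x))" for x \<phi> :: real
    by (simp add: cos_of_real[symmetric] cos_exp_eq exp_add[symmetric] algebra_simps)
  \<comment> \<open>The shift \<open>\<phi>\<close> leaves the weight nonnegative. Subtracting
    \<open>E1\<close> at \<open>\<phi> = 0\<close> and at \<open>\<phi> = pi / 2\<close> then
    isolates the cosine and the sine part of the remaining complex character.\<close>
  have E2: "(\<integral>\<omega>. (P \<omega> * (1 + cos (s \<omega> - \<phi>))) * indicator (B j) (Z j \<omega>) \<partial>M) = (\<pi> * (1 + cos \<phi> * exp (- V / 2))) * measure N (B j)" for \<phi>
  proof (rule weighted_char_uniqueness[where C=2, OF _ _ _ _ _ N])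
    show "P \<omega> * (1 + cos (s \<omega> - \<phi>)) \<le> 2" for \<omega>
      using mult_mono[of "P \<omega>" 1 "1 + cos (s \<omega> - \<phi>)" 2] cos_ge_minus_one[of "s \<omega> - \<phi>"] cos_le_one[of "s \<omega> - \<phi>"] by simp
    show "0 \<le> P \<omega> * (1 + cos (s \<omega> - \<phi>))" for \<omega>
      using cos_ge_minus_one[of "s \<omega> - \<phi>"] by (intro mult_nonneg_nonneg P) linarith
    fix r
    have "(CLINT \<omega>|M. of_real (P \<omega> * (1 + cos (s \<omega> - \<phi>))) * iexp (r * Z j \<omega>))
      = (CLINT \<omega>|M. of_real (P \<omega>) * iexp (r * Z j \<omega> + 0 * s \<omega>) +
           (1/2) * (exp (- \<i> * \<phi>) * (of_real (P \<omega>) * iexp (r * Z j \<omega> + 1 * s \<omega>)) + exp (\<i> * \<phi>) * (of_real (P \<omega>) * iexp (r * Z j \<omega> + (-1) * s \<omega>))))"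
    proof (rule Bochner_Integration.integral_cong[OF refl])
      fix \<omega>
      have split: "iexp (x + y) = iexp x * iexp y" for x y by (simp add: exp_add[symmetric] algebra_simps)
      show "of_real (P \<omega> * (1 + cos (s \<omega> - \<phi>))) * iexp (r * Z j \<omega>) = of_real (P \<omega>) * iexp (r * Z j \<omega> + 0 * s \<omega>) +
           (1/2) * (exp (- \<i> * \<phi>) * (of_real (P \<omega>) * iexp (r * Z j \<omega> + 1 * s \<omega>)) + exp (\<i> * \<phi>) * (of_real (P \<omega>) * iexp (r * Z j \<omega> + (-1) * s \<omega>)))"
        unfolding split unfolding of_real_mult of_real_add cos_id by (simp add: algebra_simps)
    qed
    also have "\<dots> = of_real (\<pi> * (exp (- (r\<^sup>2 * v j) / 2) * exp (- (0\<^sup>2 * V) / 2))) +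
        (1/2) * (exp (- \<i> * \<phi>) * of_real (\<pi> * (exp (- (r\<^sup>2 * v j) / 2) * exp (- (1\<^sup>2 * V) / 2)))
          + exp (\<i> * \<phi>) * of_real (\<pi> * (exp (- (r\<^sup>2 * v j) / 2) * exp (- ((-1)\<^sup>2 * V) / 2))))"
      by (subst lin, (intro intP, measurable)+) (simp only: IH)
    also have "\<dots> = of_real (\<pi> * (1 + cos \<phi> * exp (- V / 2))) * char N r"
    proof -
      have "of_real (cos \<phi>) = (1/2) * (exp (- \<i> * \<phi>) + exp (\<i> * \<phi>))" using cos_id[of 0 \<phi>] by simp
      thus ?thesis by (simp add: chN algebra_simps)
    qed
    finally show "(CLINT \<omega>|M. of_real (P \<omega> * (1 + cos (s \<omega> - \<phi>))) * iexp (r * Z j \<omega>)) = of_real (\<pi> * (1 + cos \<phi> * exp (- V / 2))) * char N r" .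
  qed measurable
  define W where "W \<omega> = P \<omega> * indicator (B j) (Z j \<omega>)" for \<omega>
  have W: "\<bar>W \<omega>\<bar> \<le> 1" for \<omega> by (auto simp: W_def split: split_indicator)
  have [measurable]: "W \<in> borel_measurable M" unfolding W_def by measurable
  have iW: "integrable M W" "integrable M (\<lambda>\<omega>. W \<omega> * cos (s \<omega>))" "integrable M (\<lambda>\<omega>. W \<omega> * sin (s \<omega>))"
    using W by (auto intro!: integrable_const_bound[where B=1] simp: abs_mult mult_le_one)
  have C: "(\<integral>\<omega>. W \<omega> * cos (s \<omega>) \<partial>M) = \<pi> * measure N (B j) * exp (- V / 2)"
  proof -
    have "(\<integral>\<omega>. (P \<omega> * (1 + cos (s \<omega>))) * indicator (B j) (Z j \<omega>) \<partial>M) = (\<integral>\<omega>. W \<omega> + W \<omega> * cos (s \<omega>) \<partial>M)"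
      by (intro Bochner_Integration.integral_cong) (auto simp: W_def algebra_simps)
    also have "\<dots> = (\<integral>\<omega>. W \<omega> \<partial>M) + (\<integral>\<omega>. W \<omega> * cos (s \<omega>) \<partial>M)" using iW by simp
    finally show ?thesis using E1 E2[of 0] by (simp add: W_def algebra_simps)
  qed
  have S: "(\<integral>\<omega>. W \<omega> * sin (s \<omega>) \<partial>M) = 0"
  proof -
    have "(\<integral>\<omega>. (P \<omega> * (1 + sin (s \<omega>))) * indicator (B j) (Z j \<omega>) \<partial>M) = (\<integral>\<omega>. W \<omega> + W \<omega> * sin (s \<omega>) \<partial>M)"
      by (intro Bochner_Integration.integral_cong) (auto simp: W_def algebra_simps)
    also have "\<dots> = (\<integral>\<omega>. W \<omega> \<partial>M) + (\<integral>\<omega>. W \<omega> * sin (s \<omega>) \<partial>M)" using iW by simp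
    finally show ?thesis using E1 E2[of "pi / 2"] by (simp add: W_def cos_diff)
  qed
  have "(CLINT \<omega>|M. of_real (\<Prod>j\<in>insert j J. indicator (B j) (Z j \<omega>)) * iexp (\<Sum>m\<in>I - insert j J. t m * Z m \<omega>))
     = (CLINT \<omega>|M. of_real (W \<omega> * cos (s \<omega>)) + \<i> * of_real (W \<omega> * sin (s \<omega>)))"
  proof (intro Bochner_Integration.integral_cong refl)
    fix \<omega>
    have "iexp (s \<omega>) = of_real (cos (s \<omega>)) + \<i> * of_real (sin (s \<omega>))"
      by (simp only: exp_Euler cos_of_real sin_of_real)
    moreover have "(\<Prod>j\<in>insert j J. indicator (B j) (Z j \<omega>)) = W \<omega>"
      using insert.hyps by (simp add: W_def P_def)
    ultimately show "of_real (\<Prod>j\<in>insert j J. indicator (B j) (Z j \<omega>)) * iexp (\<Sum>m\<in>I - insert j J. t m * Z m \<omega>)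
      = of_real (W \<omega> * cos (s \<omega>)) + \<i> * of_real (W \<omega> * sin (s \<omega>))"
      by (simp only: s_def I'_def of_real_mult) (simp add: algebra_simps)
  qed
  also have "\<dots> = of_real (\<integral>\<omega>. W \<omega> * cos (s \<omega>) \<partial>M) + \<i> * of_real (\<integral>\<omega>. W \<omega> * sin (s \<omega>) \<partial>M)"
    using iW by (subst Bochner_Integration.integral_add)
      (auto simp del: of_real_mult simp: integral_complex_of_real)
  also have "\<dots> = of_real (\<pi> * measure N (B j) * exp (- V / 2))" unfolding C S by simp
  also have "\<pi> * measure N (B j) * exp (- V / 2) = (\<Prod>j\<in>insert j J. measure (normal_measure 0 (v j)) (B j)) * exp (- (\<Sum>m\<in>I - insert j J. (t m)\<^sup>2 * v m) / 2)"
    using insert.hyps by (simp add: \<pi>_def N_def V_def I'_def)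
  finally show ?case .
qed

lemma gauss_family_distr:
  assumes gf: "gauss_family M I Z v" and i: "i \<in> I"
  shows "distr M borel (Z i) = normal_measure 0 (v i)"
proof -
  let ?e = "\<lambda>j. if j = i then 1 else 0 :: real"
  have fin: "finite I" and "distr M borel (\<lambda>\<omega>. \<Sum>j\<in>I. ?e j * Z j \<omega>) = normal_measure 0 (\<Sum>j\<in>I. (?e j)\<^sup>2 * v j)"
    using gf by (simp_all only: gauss_family_def)
  moreover have "(\<lambda>\<omega>. \<Sum>j\<in>I. ?e j * Z j \<omega>) = Z i"
    using fin i by (auto simp: if_distrib[of "\<lambda>x. x * _"] cong: if_cong)
  moreover have "(\<Sum>j\<in>I. (?e j)\<^sup>2 * v j) = v i"
    using fin i by (auto simp: if_distrib[of "\<lambda>x. x * _"] if_distrib[of "\<lambda>x. x ^ 2"] cong: if_cong)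
  ultimately show ?thesis by simp
qed

text \<open>With all frequencies \<open>t m\<close> equal to 0 the characters in
  \<open>gauss_family_joint\<close> disappear, and the product formula for each finite subfamily
  remains.\<close>

theorem (in prob_space) gauss_family_indep:
  assumes gf: "gauss_family M I Z v"
  shows "indep_vars (\<lambda>_. borel) Z I"
proof (unfold indep_vars_def2, intro conjI ballI)
  have Z[measurable]: "\<And>i. i \<in> I \<Longrightarrow> Z i \<in> borel_measurable M" using gf by (auto simp: gauss_family_def)
  show "random_variable borel (Z i)" if "i \<in> I" for i using that by measurable
  show "indep_sets (\<lambda>i. {Z i -` A \<inter> space M |A. A \<in> sets borel}) I"
  proof (rule indep_setsI)
    show "{Z i -` A \<inter> space M |A. A \<in> sets borel} \<subseteq> events" if "i \<in> I" for i
      using that by (auto intro!: measurable_sets[OF Z])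
    fix A J assume J: "J \<noteq> {}" "J \<subseteq> I" "finite J" and A: "\<forall>j\<in>J. A j \<in> {Z j -` A \<inter> space M |A. A \<in> sets borel}"
    from A obtain B where B: "\<And>j. j \<in> J \<Longrightarrow> B j \<in> sets borel \<and> A j = Z j -` B j \<inter> space M"
      by (simp only: mem_Collect_eq) metis
    have [measurable]: "\<And>i. i \<in> J \<Longrightarrow> Z i \<in> borel_measurable M" "\<And>i. i \<in> J \<Longrightarrow> B i \<in> sets borel"
      using J B Z by auto
    have "complex_of_real (prob (\<Inter>j\<in>J. A j)) = of_real (\<integral>\<omega>. indicator (\<Inter>j\<in>J. A j) \<omega> \<partial>M)"
      using J B by (subst Bochner_Integration.integral_indicator) (auto intro!: arg_cong[where f=prob])
    also have "(\<integral>\<omega>. indicator (\<Inter>j\<in>J. A j) \<omega> \<partial>M) = (\<integral>\<omega>. (\<Prod>j\<in>J. indicator (B j) (Z j \<omega>) :: real) \<partial>M)"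
    proof (intro Bochner_Integration.integral_cong refl)
      fix \<omega> assume \<omega>: "\<omega> \<in> space M"
      have "(\<Prod>j\<in>J. indicator (B j) (Z j \<omega>) :: real) = (\<Prod>j\<in>J. indicator (A j) \<omega>)"
        using B \<omega> by (intro prod.cong) (auto simp: indicator_def)
      also have "\<dots> = indicator (\<Inter>j\<in>J. A j) \<omega>"
        using J by (auto simp: prod_zero_iff indicator_def)
      finally show "indicator (\<Inter>j\<in>J. A j) \<omega> = (\<Prod>j\<in>J. indicator (B j) (Z j \<omega>) :: real)" by simp
    qed
    also have "of_real (\<integral>\<omega>. (\<Prod>j\<in>J. indicator (B j) (Z j \<omega>)) \<partial>M)
        = (CLINT \<omega>|M. of_real (\<Prod>j\<in>J. indicator (B j) (Z j \<omega>)) * iexp (\<Sum>m\<in>I - J. 0 * Z m \<omega>))"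
      by (simp add: integral_complex_of_real del: of_real_prod)
    also have "\<dots> = of_real (\<Prod>j\<in>J. measure (normal_measure 0 (v j)) (B j))"
      using J B by (subst gauss_family_joint[OF gf, of J B]) auto
    also have "(\<Prod>j\<in>J. measure (normal_measure 0 (v j)) (B j)) = (\<Prod>j\<in>J. prob (A j))"
    proof (rule prod.cong[OF refl])
      fix j assume j: "j \<in> J"
      hence "measure (normal_measure 0 (v j)) (B j) = measure (distr M borel (Z j)) (B j)"
        using gauss_family_distr[OF gf] J by auto
      also have "\<dots> = prob (A j)" using j B by (auto simp: measure_distr)
      finally show "measure (normal_measure 0 (v j)) (B j) = prob (A j)" .
    qed
    finally show "prob (\<Inter>j\<in>J. A j) = (\<Prod>j\<in>J. prob (A j))" by (metis of_real_eq_iff)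
  qed
qed

section \<open>Exponential moments of Gaussian quadratic forms\<close>

text \<open>Completing the square: \<open>exp (a * x^2)\<close> times the standard density is
  \<open>\<sigma>\<close> times the density with variance
  \<open>\<sigma>^2 = 1 / (1 - 2 * a)\<close>.\<close>

lemma has_bochner_integral_std_normal_exp_square:
  fixes a :: real
  assumes a: "2 * a < 1"
  shows "has_bochner_integral std_normal_distribution (\<lambda>x. exp (a * x\<^sup>2)) (1 / sqrt (1 - 2 * a))"
proof -
  define \<sigma> where "\<sigma> = 1 / sqrt (1 - 2 * a)"
  have \<sigma>: "\<sigma> > 0" "1 / \<sigma>\<^sup>2 = 1 - 2 * a" using a by (auto simp: \<sigma>_def power_divide)
  have eq: "std_normal_density x *\<^sub>R exp (a * x\<^sup>2) = \<sigma> *\<^sub>R normal_density 0 \<sigma> x" for x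
  proof -
    have "normal_density 0 \<sigma> x = 1 / (sqrt (2 * pi) * \<sigma>) * exp (- (x\<^sup>2 * (1 / \<sigma>\<^sup>2)) / 2)"
      using \<sigma>(1) by (simp add: normal_density_def real_sqrt_mult)
    also have "- (x\<^sup>2 * (1 / \<sigma>\<^sup>2)) / 2 = - x\<^sup>2 / 2 + a * x\<^sup>2"
      unfolding \<sigma>(2) by (simp add: field_simps)
    finally show ?thesis using \<sigma>(1) by (simp add: std_normal_density_def flip: exp_add)
  qed
  have "has_bochner_integral lborel (normal_density 0 \<sigma>) 1"
    using \<sigma>(1) by (simp add: has_bochner_integral_iff)
  hence "has_bochner_integral lborel (\<lambda>x. std_normal_density x *\<^sub>R exp (a * x\<^sup>2)) \<sigma>"
    unfolding eq using has_bochner_integral_scaleR_right[of \<sigma> lborel "normal_density 0 \<sigma>" 1] by simp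
  thus ?thesis unfolding \<sigma>_def[symmetric]
    by (intro has_bochner_integral_density) auto
qed

lemma has_bochner_integral_normal_transfer:
  fixes f :: "real \<Rightarrow> real"
  assumes [measurable]: "Z \<in> borel_measurable M" "f \<in> borel_measurable borel"
    and d: "distr M borel Z = normal_measure 0 v" and v: "v \<ge> 0"
    and h: "has_bochner_integral std_normal_distribution (\<lambda>x. f (sqrt v * x)) c"
  shows "has_bochner_integral M (\<lambda>\<omega>. f (Z \<omega>)) c"
proof -
  have "has_bochner_integral (distr std_normal_distribution borel (\<lambda>x. sqrt v * x)) f c"
    using h by (simp add: has_bochner_integral_iff integrable_distr_eq integral_distr)
  hence "has_bochner_integral (distr M borel Z) f c" unfolding d normal_measure_eq_distr[OF v] .
  thus ?thesis by (simp add: has_bochner_integral_iff integrable_distr_eq integral_distr)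
qed

lemma has_bochner_integral_std_normal_id: "has_bochner_integral std_normal_distribution (\<lambda>x. x) 0"
  using std_normal_moment_odd[of 0] by (intro has_bochner_integral_density) (auto simp: mult.commute)

lemma has_bochner_integral_std_normal_square: "has_bochner_integral std_normal_distribution (\<lambda>x. x\<^sup>2) 1"
  using std_normal_moment_even[of 1] by (intro has_bochner_integral_density) (auto simp: mult.commute fact_2)

context
  fixes M :: "'a measure" and I :: "'i set" and Z v
  assumes gf: "gauss_family M I Z v"
begin

lemma gauss_family_mean: "i \<in> I \<Longrightarrow> has_bochner_integral M (Z i) 0"
  using gf has_bochner_integral_normal_transfer[OF _ _ gauss_family_distr[OF gf], of i "\<lambda>x. x" 0]
    has_bochner_integral_mult_right[OF has_bochner_integral_std_normal_id, of "sqrt (v i)"]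
  by (auto simp: gauss_family_def)

lemma gauss_family_variance: "i \<in> I \<Longrightarrow> has_bochner_integral M (\<lambda>\<omega>. (Z i \<omega>)\<^sup>2) (v i)"
  using gf has_bochner_integral_normal_transfer[OF _ _ gauss_family_distr[OF gf], of i "\<lambda>x. x\<^sup>2" "v i"]
    has_bochner_integral_mult_right[OF has_bochner_integral_std_normal_square, of "v i"]
  by (auto simp: gauss_family_def power_mult_distrib)

lemma gauss_family_exp_square:
  assumes "i \<in> I" "2 * (c * v i) < 1"
  shows "has_bochner_integral M (\<lambda>\<omega>. exp (c * (Z i \<omega>)\<^sup>2)) (1 / sqrt (1 - 2 * (c * v i)))"
  using gf assms has_bochner_integral_normal_transfer[OF _ _ gauss_family_distr[OF gf], of i "\<lambda>x. exp (c * x\<^sup>2)"]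
    has_bochner_integral_std_normal_exp_square[of "c * v i"]
  by (auto simp: gauss_family_def power_mult_distrib mult.assoc)

end

text \<open>The expansion of \<open>- ln (1 - 2 * x) / 2\<close> begins with \<open>x + x^2\<close>.
  The coefficient of the square must be exact, since it becomes the variance in the Chernoff
  exponent; only the cubic remainder is estimated generously. On either side of 0 the difference
  vanishes at 0 and has a derivative of constant sign.\<close>

lemma inverse_sqrt_le_exp:
  fixes x :: real
  assumes "\<bar>x\<bar> \<le> 1/4"
  shows "1 / sqrt (1 - 2 * x) \<le> exp (x + x\<^sup>2 * (1 + 4 * \<bar>x\<bar>))"
proof -
  have "- ln (1 - 2 * x) / 2 \<le> x + x\<^sup>2 * (1 + 4 * \<bar>x\<bar>)"
  proof (cases "x \<ge> 0")
    case True
    define g where "g y = y + y\<^sup>2 + 4 * y ^ 3 + ln (1 - 2 * y) / 2" for y :: real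
    have "g 0 \<le> g x"
    proof (rule DERIV_nonneg_imp_nondecreasing[OF True])
      fix y assume y: "0 \<le> y" "y \<le> x"
      hence y': "1 - 2 * y > 0" "y \<le> 1/4" using assms by auto
      have "(g has_real_derivative (1 + 2 * y + 12 * y\<^sup>2 - 1 / (1 - 2 * y))) (at y)"
        unfolding g_def using y' by (auto intro!: derivative_eq_intros simp: field_simps)
      moreover have "1 + 2 * y + 12 * y\<^sup>2 - 1 / (1 - 2 * y) = 8 * y\<^sup>2 * (1 - 3 * y) / (1 - 2 * y)"
        using y' by (simp add: field_simps power2_eq_square)
      moreover have "\<dots> \<ge> 0" using y y' by (intro divide_nonneg_pos mult_nonneg_nonneg) auto
      ultimately show "\<exists>z. (g has_real_derivative z) (at y) \<and> 0 \<le> z" by auto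
    qed
    thus ?thesis using True by (simp add: g_def power2_eq_square power3_eq_cube algebra_simps)
  next
    case False
    define g where "g y = y + y\<^sup>2 + ln (1 - 2 * y) / 2" for y :: real
    have "g 0 \<le> g x"
    proof (rule DERIV_nonpos_imp_nonincreasing[where f=g and a=x and b=0])
      from False show "x \<le> 0" by simp
      fix y :: real assume y: "x \<le> y" "y \<le> 0"
      hence y': "1 - 2 * y > 0" by auto
      have "(g has_real_derivative (1 + 2 * y - 1 / (1 - 2 * y))) (at y)"
        unfolding g_def using y' by (auto intro!: derivative_eq_intros simp: field_simps)
      moreover have "1 + 2 * y - 1 / (1 - 2 * y) = - (4 * y\<^sup>2 / (1 - 2 * y))"
        using y' by (simp add: field_simps power2_eq_square)
      moreover have "- (4 * y\<^sup>2 / (1 - 2 * y)) \<le> 0" using y' by simp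
      ultimately show "\<exists>z. (g has_real_derivative z) (at y) \<and> z \<le> 0" by auto
    qed
    moreover have "x\<^sup>2 \<le> x\<^sup>2 * (1 + 4 * \<bar>x\<bar>)" by (simp add: mult_le_cancel_left1)
    ultimately show ?thesis by (simp add: g_def)
  qed
  moreover have "1 / sqrt (1 - 2 * x) = exp (- ln (1 - 2 * x) / 2)"
    using assms by (simp add: ln_sqrt[symmetric] exp_minus inverse_eq_divide)
  ultimately show ?thesis by simp
qed

text \<open>Independence factorises the expectation. The uniform bound \<open>b\<close> only
  inflates the second-order coefficient to \<open>1 + 4 * b\<close>, which tends to 1 for small
  parameters.\<close>

lemma (in prob_space) gauss_family_exp_sum_squares:
  assumes gf: "gauss_family M I Z v" and b: "b \<le> 1/4" "\<And>i. i \<in> I \<Longrightarrow> \<bar>c i * v i\<bar> \<le> b"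
  shows "integrable M (\<lambda>\<omega>. exp (\<Sum>i\<in>I. c i * (Z i \<omega>)\<^sup>2))"
    and "expectation (\<lambda>\<omega>. exp (\<Sum>i\<in>I. c i * (Z i \<omega>)\<^sup>2))
      \<le> exp ((\<Sum>i\<in>I. c i * v i) + (1 + 4 * b) * (\<Sum>i\<in>I. (c i * v i)\<^sup>2))"
proof -
  have fin: "finite I" using gf by (simp add: gauss_family_def)
  have h: "has_bochner_integral M (\<lambda>\<omega>. exp (c i * (Z i \<omega>)\<^sup>2)) (1 / sqrt (1 - 2 * (c i * v i)))" if "i \<in> I" for i
    using b(1) b(2)[OF that] by (intro gauss_family_exp_square[OF gf that]) auto
  have ind: "indep_vars (\<lambda>_. borel) (\<lambda>i \<omega>. exp (c i * (Z i \<omega>)\<^sup>2)) I"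
    by (rule indep_vars_compose2[OF gauss_family_indep[OF gf]]) simp
  have e: "(\<lambda>\<omega>. exp (\<Sum>i\<in>I. c i * (Z i \<omega>)\<^sup>2)) = (\<lambda>\<omega>. \<Prod>i\<in>I. exp (c i * (Z i \<omega>)\<^sup>2))"
    using fin by (simp add: exp_sum)
  show "integrable M (\<lambda>\<omega>. exp (\<Sum>i\<in>I. c i * (Z i \<omega>)\<^sup>2))"
    unfolding e using h by (intro indep_vars_integrable fin ind) (auto simp: has_bochner_integral_iff)
  have "expectation (\<lambda>\<omega>. exp (\<Sum>i\<in>I. c i * (Z i \<omega>)\<^sup>2)) = (\<Prod>i\<in>I. 1 / sqrt (1 - 2 * (c i * v i)))"
    unfolding e using h
    by (subst indep_vars_lebesgue_integral[OF fin ind]) (auto simp: has_bochner_integral_iff)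
  also have "\<dots> \<le> (\<Prod>i\<in>I. exp (c i * v i + (1 + 4 * b) * (c i * v i)\<^sup>2))"
  proof (rule prod_mono, safe)
    fix i assume i: "i \<in> I"
    show "0 \<le> 1 / sqrt (1 - 2 * (c i * v i))" using b(1) b(2)[OF i] by auto
    have "1 / sqrt (1 - 2 * (c i * v i)) \<le> exp (c i * v i + (c i * v i)\<^sup>2 * (1 + 4 * \<bar>c i * v i\<bar>))"
      using b(1) b(2)[OF i] by (intro inverse_sqrt_le_exp) auto
    also have "\<dots> \<le> exp (c i * v i + (1 + 4 * b) * (c i * v i)\<^sup>2)"
      using b(2)[OF i] by (simp add: mult.commute[of _ "(c i * v i)\<^sup>2"] mult_left_mono)
    finally show "1 / sqrt (1 - 2 * (c i * v i)) \<le> exp (c i * v i + (1 + 4 * b) * (c i * v i)\<^sup>2)" .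
  qed
  also have "\<dots> = exp ((\<Sum>i\<in>I. c i * v i) + (1 + 4 * b) * (\<Sum>i\<in>I. (c i * v i)\<^sup>2))"
    using fin by (simp add: exp_sum[symmetric] sum.distrib sum_distrib_left)
  finally show "expectation (\<lambda>\<omega>. exp (\<Sum>i\<in>I. c i * (Z i \<omega>)\<^sup>2))
      \<le> exp ((\<Sum>i\<in>I. c i * v i) + (1 + 4 * b) * (\<Sum>i\<in>I. (c i * v i)\<^sup>2))" .
qed

definition gauss_pair :: "'a measure \<Rightarrow> nat \<Rightarrow> (nat \<Rightarrow> 'a \<Rightarrow> real) \<Rightarrow> (nat \<Rightarrow> 'a \<Rightarrow> real) \<Rightarrow> (nat \<Rightarrow> real) \<Rightarrow> real \<Rightarrow> bool" where
  "gauss_pair M n U V l \<rho> \<longleftrightarrow> \<bar>\<rho>\<bar> \<le> 1 \<and> (\<forall>a<n. U a \<in> borel_measurable M \<and> V a \<in> borel_measurable M \<and> 0 \<le> l a) \<and>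
     (\<forall>\<alpha> \<beta>. distr M borel (\<lambda>\<omega>. \<Sum>a<n. \<alpha> a * U a \<omega> + \<beta> a * V a \<omega>)
        = normal_measure 0 (\<Sum>a<n. l a * ((\<alpha> a)\<^sup>2 + 2 * \<rho> * \<alpha> a * \<beta> a + (\<beta> a)\<^sup>2)))"

text \<open>Polarization: the sums and the differences of the pair form one family of independent normals.\<close>

lemma (in prob_space) gauss_pair_exp:
  assumes gp: "gauss_pair M n U V l \<rho>" and L: "\<And>a. a < n \<Longrightarrow> l a \<le> L" and \<theta>: "\<bar>\<theta>\<bar> * L \<le> 1/4"
  shows "integrable M (\<lambda>\<omega>. exp (\<theta> * (\<Sum>a<n. U a \<omega> * V a \<omega>)))"
    and "expectation (\<lambda>\<omega>. exp (\<theta> * (\<Sum>a<n. U a \<omega> * V a \<omega>)))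
      \<le> exp (\<theta> * \<rho> * (\<Sum>a<n. l a) + \<theta>\<^sup>2 * (1 + \<rho>\<^sup>2) * (\<Sum>a<n. (l a)\<^sup>2) / 2 * (1 + 4 * (\<bar>\<theta>\<bar> * L)))"
proof -
  define I where "I = {..<n} \<times> {1, -1::real}"
  \<comment> \<open>\<open>U * V\<close> is a quarter of \<open>(U + V)^2 - (U - V)^2\<close>,
    whence the weights \<open>s * \<theta> / 4\<close>. Sums and differences are uncorrelated
    because both rows have the same variances.\<close>
  define Z where "Z = (\<lambda>(a, s) \<omega>. U a \<omega> + s * V a \<omega>)"
  define v where "v = (\<lambda>(a, s). 2 * (1 + s * \<rho>) * l a)"
  define c where "c = (\<lambda>(a::nat, s). s * \<theta> / 4)"
  have \<rho>: "\<bar>\<rho>\<bar> \<le> 1" and l: "\<And>a. a < n \<Longrightarrow> 0 \<le> l a" using gp by (auto simp: gauss_pair_def)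
  have sumI: "(\<Sum>i\<in>I. f i) = (\<Sum>a<n. f (a, 1) + f (a, -1))" for f :: "nat \<times> real \<Rightarrow> real"
    using sum.cartesian_product[of "\<lambda>a s. f (a, s)" "{1, -1}" "{..<n}"] by (simp add: I_def sum.distrib)
  have gf: "gauss_family M I Z v"
    unfolding gauss_family_def
  proof (intro conjI ballI allI)
    show "finite I" by (simp add: I_def)
    fix i assume i: "i \<in> I"
    show "Z i \<in> borel_measurable M" using gp i by (auto simp: I_def Z_def gauss_pair_def)
    show "0 \<le> v i" using i \<rho> l by (auto simp: I_def v_def)
  next
    fix b :: "nat \<times> real \<Rightarrow> real"
    define \<alpha> \<beta> where "\<alpha> a = b (a, 1) + b (a, -1)" and "\<beta> a = b (a, 1) - b (a, -1)" for a
    have "(\<lambda>\<omega>. \<Sum>i\<in>I. b i * Z i \<omega>) = (\<lambda>\<omega>. \<Sum>a<n. \<alpha> a * U a \<omega> + \<beta> a * V a \<omega>)"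
      by (simp add: sumI Z_def \<alpha>_def \<beta>_def algebra_simps)
    moreover have "(\<Sum>i\<in>I. (b i)\<^sup>2 * v i) = (\<Sum>a<n. l a * ((\<alpha> a)\<^sup>2 + 2 * \<rho> * \<alpha> a * \<beta> a + (\<beta> a)\<^sup>2))"
      by (simp add: sumI v_def \<alpha>_def \<beta>_def power2_eq_square algebra_simps)
    ultimately show "distr M borel (\<lambda>\<omega>. \<Sum>i\<in>I. b i * Z i \<omega>) = normal_measure 0 (\<Sum>i\<in>I. (b i)\<^sup>2 * v i)"
      using gp by (simp only: gauss_pair_def)
  qed
  have cv: "\<bar>c i * v i\<bar> \<le> \<bar>\<theta>\<bar> * L" if iI: "i \<in> I" for i
  proof -
    obtain a s where i: "i = (a, s)" "a < n" "s = 1 \<or> s = -1" using iI by (auto simp: I_def)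
    have "c i * v i = s * (\<theta> * l a * ((1 + s * \<rho>) / 2))"
      using i(1) by (simp add: c_def v_def)
    hence "\<bar>c i * v i\<bar> = \<bar>\<theta>\<bar> * l a * \<bar>(1 + s * \<rho>) / 2\<bar>"
      using i(2,3) l[of a] by (auto simp only: abs_mult) auto
    also have "\<dots> \<le> \<bar>\<theta>\<bar> * l a * 1"
      using i \<rho> l by (intro mult_left_mono) auto
    also have "\<dots> \<le> \<bar>\<theta>\<bar> * L" using L i by (simp add: mult_left_mono)
    finally show ?thesis .
  qed
  have e: "(\<Sum>i\<in>I. c i * (Z i \<omega>)\<^sup>2) = \<theta> * (\<Sum>a<n. U a \<omega> * V a \<omega>)" for \<omega>
    by (simp add: sumI c_def Z_def sum_distrib_left power2_eq_square algebra_simps)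
  have s1: "(\<Sum>i\<in>I. c i * v i) = \<theta> * \<rho> * (\<Sum>a<n. l a)"
    by (simp add: sumI c_def v_def sum_distrib_left algebra_simps)
  \<comment> \<open>The sharp variance factor arises here, from
    \<open>(1 + \<rho>)^2 + (1 - \<rho>)^2 = 2 * (1 + \<rho>^2)\<close>.\<close>
  have s2: "(\<Sum>i\<in>I. (c i * v i)\<^sup>2) = \<theta>\<^sup>2 * (1 + \<rho>\<^sup>2) * (\<Sum>a<n. (l a)\<^sup>2) / 2"
    unfolding sumI sum_distrib_left sum_divide_distrib
    by (intro sum.cong refl) (simp add: c_def v_def power2_eq_square field_simps)
  note * = gauss_family_exp_sum_squares[OF gf \<theta> cv]
  show "integrable M (\<lambda>\<omega>. exp (\<theta> * (\<Sum>a<n. U a \<omega> * V a \<omega>)))" using *(1) by (simp add: e)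
  show "expectation (\<lambda>\<omega>. exp (\<theta> * (\<Sum>a<n. U a \<omega> * V a \<omega>)))
      \<le> exp (\<theta> * \<rho> * (\<Sum>a<n. l a) + \<theta>\<^sup>2 * (1 + \<rho>\<^sup>2) * (\<Sum>a<n. (l a)\<^sup>2) / 2 * (1 + 4 * (\<bar>\<theta>\<bar> * L)))"
    using *(2) by (simp add: e s1 s2 mult_ac)
qed

text \<open>Markov's inequality for the exponential, applied to either sign. The parameter
  \<open>\<theta>\<close> stays free because the uniform deviation bound and the false alarm bound
  choose it differently.\<close>

lemma (in prob_space) gauss_pair_tail:
  assumes gp: "gauss_pair M n U V l \<rho>" and L: "\<And>a. a < n \<Longrightarrow> l a \<le> L" and \<theta>: "0 < \<theta>" "\<theta> * L \<le> 1/4"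
  shows "prob {\<omega> \<in> space M. x \<le> \<bar>(\<Sum>a<n. U a \<omega> * V a \<omega>) - \<rho> * (\<Sum>a<n. l a)\<bar>}
    \<le> 2 * exp (- \<theta> * x + \<theta>\<^sup>2 * (1 + \<rho>\<^sup>2) * (\<Sum>a<n. (l a)\<^sup>2) / 2 * (1 + 4 * (\<theta> * L)))"
proof -
  define T where "T \<omega> = (\<Sum>a<n. U a \<omega> * V a \<omega>)" for \<omega>
  define t where "t = (\<Sum>a<n. l a)"
  define R where "R = \<theta>\<^sup>2 * (1 + \<rho>\<^sup>2) * (\<Sum>a<n. (l a)\<^sup>2) / 2 * (1 + 4 * (\<theta> * L))"
  have [measurable]: "T \<in> borel_measurable M" unfolding T_def using gp
    by (auto simp: gauss_pair_def intro!: borel_measurable_sum borel_measurable_times)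
  have one_sided: "prob {\<omega> \<in> space M. x \<le> e * (T \<omega> - \<rho> * t)} \<le> exp (- \<theta> * x + R)"
    if e: "\<bar>e\<bar> = 1" for e
  proof -
    have "{\<omega> \<in> space M. x \<le> e * (T \<omega> - \<rho> * t)}
      = {\<omega> \<in> space M. exp (\<theta> * (x + e * \<rho> * t)) \<le> exp (e * \<theta> * T \<omega>)}"
    proof -
      have "x \<le> e * (T \<omega> - \<rho> * t) \<longleftrightarrow> \<theta> * (x + e * \<rho> * t) \<le> \<theta> * (e * T \<omega>)" for \<omega>
        using \<theta>(1) by (subst mult_le_cancel_left_pos) (auto simp: algebra_simps)
      thus ?thesis by (simp add: mult_ac)
    qed
    also have "prob \<dots> \<le> expectation (\<lambda>\<omega>. exp (e * \<theta> * T \<omega>)) / exp (\<theta> * (x + e * \<rho> * t))"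
      using gauss_pair_exp(1)[OF gp L, of "e * \<theta>"] \<theta> e
      by (intro integral_Markov_inequality_measure[where A="{}"]) (auto simp: T_def abs_mult)
    also have "expectation (\<lambda>\<omega>. exp (e * \<theta> * T \<omega>)) \<le> exp (e * \<theta> * \<rho> * t + R)"
    proof -
      have "e\<^sup>2 = 1" using e by (metis power2_abs power_one)
      thus ?thesis using gauss_pair_exp(2)[OF gp L, of "e * \<theta>"] \<theta> e
        by (simp add: T_def t_def R_def abs_mult power_mult_distrib)
    qed
    also have "exp (e * \<theta> * \<rho> * t + R) / exp (\<theta> * (x + e * \<rho> * t)) = exp (- \<theta> * x + R)"
      by (simp add: exp_diff[symmetric] algebra_simps)
    finally show ?thesis by (simp add: divide_right_mono)
  qed
  have "{\<omega> \<in> space M. x \<le> \<bar>T \<omega> - \<rho> * t\<bar>}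
     \<subseteq> {\<omega> \<in> space M. x \<le> 1 * (T \<omega> - \<rho> * t)} \<union> {\<omega> \<in> space M. x \<le> (-1) * (T \<omega> - \<rho> * t)}"
    by auto
  hence "prob {\<omega> \<in> space M. x \<le> \<bar>T \<omega> - \<rho> * t\<bar>}
     \<le> prob ({\<omega> \<in> space M. x \<le> 1 * (T \<omega> - \<rho> * t)} \<union> {\<omega> \<in> space M. x \<le> (-1) * (T \<omega> - \<rho> * t)})"
    by (intro finite_measure_mono) measurable
  also have "\<dots> \<le> prob {\<omega> \<in> space M. x \<le> 1 * (T \<omega> - \<rho> * t)} + prob {\<omega> \<in> space M. x \<le> (-1) * (T \<omega> - \<rho> * t)}"
    by (intro measure_Un_le) measurable
  also have "\<dots> \<le> exp (- \<theta> * x + R) + exp (- \<theta> * x + R)"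
    using one_sided[of 1] one_sided[of "-1"] by (intro add_mono) simp_all
  finally show ?thesis by (simp add: T_def t_def R_def)
qed

lemma power_le_exp:
  fixes y :: real
  assumes "y \<ge> 0"
  shows "y ^ 4 \<le> 256 * exp y" and "y\<^sup>2 \<le> 4 * exp y"
proof -
  have "(y / 4) ^ 4 \<le> exp (y / 4) ^ 4"
  proof (rule power_mono)
    show "y / 4 \<le> exp (y / 4)" using exp_ge_add_one_self[of "y / 4"] by linarith
  qed (use assms in simp)
  also have "\<dots> = exp y" by (simp flip: exp_of_nat_mult)
  finally show "y ^ 4 \<le> 256 * exp y" by (simp add: power_divide)
  have "(y / 2) ^ 2 \<le> exp (y / 2) ^ 2"
  proof (rule power_mono)
    show "y / 2 \<le> exp (y / 2)" using exp_ge_add_one_self[of "y / 2"] by linarith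
  qed (use assms in simp)
  also have "\<dots> = exp y" by (simp flip: exp_of_nat_mult)
  finally show "y\<^sup>2 \<le> 4 * exp y" by (simp add: power_divide)
qed

text \<open>The scale \<open>\<theta> = 1 / (4 * sqrt F)\<close> is admissible because
  \<open>sqrt F\<close> dominates every \<open>l a\<close>, and it makes both exponential moments at
  most 4. Then \<open>y ^ 4 \<le> 256 * exp y\<close> gives a fourth moment of order
  \<open>F^2\<close>, with \<open>2 ^ 19 = 256 * 256 * 8\<close>.\<close>

lemma (in prob_space) gauss_pair_moment4:
  assumes gp: "gauss_pair M n U V l 0" and F: "(\<Sum>a<n. (l a)\<^sup>2) > 0"
  shows "integrable M (\<lambda>\<omega>. (\<Sum>a<n. U a \<omega> * V a \<omega>) ^ 4)"
    and "expectation (\<lambda>\<omega>. (\<Sum>a<n. U a \<omega> * V a \<omega>) ^ 4) \<le> 2 ^ 19 * (\<Sum>a<n. (l a)\<^sup>2)\<^sup>2"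
proof -
  define F where "F = (\<Sum>a<n. (l a)\<^sup>2)"
  have F: "F > 0" using F by (simp add: F_def)
  define \<theta> where "\<theta> = 1 / (4 * sqrt F)"
  have \<theta>: "\<theta> > 0" "\<theta>\<^sup>2 * F = 1/16" "\<theta> * sqrt F = 1/4"
    using F by (simp_all add: \<theta>_def power_divide power_mult_distrib)
  define T where "T \<omega> = (\<Sum>a<n. U a \<omega> * V a \<omega>)" for \<omega>
  have [measurable]: "T \<in> borel_measurable M" unfolding T_def using gp
    by (auto simp: gauss_pair_def intro!: borel_measurable_sum borel_measurable_times)
  have L: "l a \<le> sqrt F" if "a < n" for a
  proof -
    have "(l a)\<^sup>2 \<le> F" unfolding F_def using that by (intro member_le_sum) auto
    thus ?thesis by (rule real_le_rsqrt)
  qed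
  have E: "integrable M (\<lambda>\<omega>. exp (e * \<theta> * T \<omega>)) \<and> expectation (\<lambda>\<omega>. exp (e * \<theta> * T \<omega>)) \<le> 4"
    if e: "\<bar>e\<bar> = 1" for e
  proof -
    have "e\<^sup>2 = 1" using e by (metis power2_abs power_one)
    hence "expectation (\<lambda>\<omega>. exp (e * \<theta> * T \<omega>)) \<le> exp (\<theta>\<^sup>2 * F / 2 * (1 + 4 * (\<theta> * sqrt F)))"
      using gauss_pair_exp(2)[OF gp L, of "e * \<theta>"] \<theta> e
      by (simp add: T_def F_def abs_mult power_mult_distrib)
    also have "\<dots> \<le> exp 1" unfolding \<theta> by simp
    also have "\<dots> \<le> 4" using exp_le by simp
    finally show ?thesis
      using gauss_pair_exp(1)[OF gp L, of "e * \<theta>"] \<theta> e by (simp add: T_def abs_mult)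
  qed
  have bound: "T \<omega> ^ 4 \<le> 256 / \<theta> ^ 4 * (exp (1 * \<theta> * T \<omega>) + exp (-1 * \<theta> * T \<omega>))" for \<omega>
  proof -
    have "\<theta> ^ 4 * T \<omega> ^ 4 = \<bar>\<theta> * T \<omega>\<bar> ^ 4" by (simp add: power_mult_distrib power_even_abs)
    also have "\<dots> \<le> 256 * exp \<bar>\<theta> * T \<omega>\<bar>" by (rule power_le_exp) simp
    also have "\<dots> \<le> 256 * (exp (1 * \<theta> * T \<omega>) + exp (-1 * \<theta> * T \<omega>))"
      by (cases "\<theta> * T \<omega> \<ge> 0") auto
    finally show ?thesis using \<theta>(1) by (simp add: field_simps)
  qed
  have int: "integrable M (\<lambda>\<omega>. 256 / \<theta> ^ 4 * (exp (1 * \<theta> * T \<omega>) + exp (-1 * \<theta> * T \<omega>)))"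
    using E[of 1] E[of "-1"] by simp
  show "integrable M (\<lambda>\<omega>. (\<Sum>a<n. U a \<omega> * V a \<omega>) ^ 4)"
    unfolding T_def[symmetric]
    by (rule Bochner_Integration.integrable_bound[OF int])
      (use bound \<theta> in \<open>auto intro!: AE_I2 order_trans[OF _ abs_ge_self]\<close>)
  hence "expectation (\<lambda>\<omega>. T \<omega> ^ 4) \<le> expectation (\<lambda>\<omega>. 256 / \<theta> ^ 4 * (exp (1 * \<theta> * T \<omega>) + exp (-1 * \<theta> * T \<omega>)))"
    unfolding T_def[symmetric] by (rule integral_mono[OF _ int bound])
  also have "\<dots> = 256 / \<theta> ^ 4 * (expectation (\<lambda>\<omega>. exp (1 * \<theta> * T \<omega>)) + expectation (\<lambda>\<omega>. exp (-1 * \<theta> * T \<omega>)))"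
    using E[of 1] E[of "-1"] by simp
  also have "\<dots> \<le> 256 / \<theta> ^ 4 * (4 + 4)"
    using E[of 1] E[of "-1"] \<theta>(1) by (intro mult_left_mono add_mono) auto
  also have "256 / \<theta> ^ 4 * (4 + 4) = 2 ^ 19 * F\<^sup>2"
  proof -
    have "sqrt F ^ 4 = (sqrt F ^ 2) ^ 2" by (simp flip: power_mult)
    thus ?thesis using F by (simp add: \<theta>_def power_divide power_mult_distrib)
  qed
  finally show "expectation (\<lambda>\<omega>. (\<Sum>a<n. U a \<omega> * V a \<omega>) ^ 4) \<le> 2 ^ 19 * (\<Sum>a<n. (l a)\<^sup>2)\<^sup>2"
    by (simp add: F_def T_def)
qed

text \<open>A sum of squares is nonnegative, so a single exponential moment suffices; its scale
  \<open>1 / (4 * (n * L))\<close> matches the mean, which is at most \<open>n * L\<close>.\<close>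

lemma (in prob_space) gauss_pair_self_moment2:
  assumes gp: "gauss_pair M n U U l 1" and L: "\<And>a. a < n \<Longrightarrow> l a \<le> L" "L > 0" and n: "n > 0"
  shows "integrable M (\<lambda>\<omega>. (\<Sum>a<n. U a \<omega> * U a \<omega>)\<^sup>2)"
    and "expectation (\<lambda>\<omega>. (\<Sum>a<n. U a \<omega> * U a \<omega>)\<^sup>2) \<le> 256 * (real n * L)\<^sup>2"
proof -
  define \<theta> where "\<theta> = 1 / (4 * (real n * L))"
  have \<theta>: "\<theta> > 0" "\<theta> * (real n * L) = 1/4"
    using n L(2) by (simp_all add: \<theta>_def)
  have l: "\<And>a. a < n \<Longrightarrow> 0 \<le> l a" using gp by (auto simp: gauss_pair_def)
  have \<theta>L: "\<theta> * L \<le> 1/4"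
  proof -
    have "\<theta> * L * 1 \<le> \<theta> * L * real n" using n L(2) \<theta>(1) by (intro mult_left_mono) auto
    with \<theta>(2) show ?thesis by (simp add: mult_ac)
  qed
  define T where "T \<omega> = (\<Sum>a<n. U a \<omega> * U a \<omega>)" for \<omega>
  have [measurable]: "T \<in> borel_measurable M" unfolding T_def using gp
    by (auto simp: gauss_pair_def intro!: borel_measurable_sum borel_measurable_times)
  have int: "integrable M (\<lambda>\<omega>. 4 / \<theta>\<^sup>2 * exp (\<theta> * T \<omega>))"
    using gauss_pair_exp(1)[OF gp L(1), of \<theta>] \<theta>L \<theta>(1) by (simp add: T_def)
  have t: "\<theta> * (\<Sum>a<n. l a) \<le> 1/4"
  proof -
    have "(\<Sum>a<n. l a) \<le> real n * L" using sum_bounded_above[of "{..<n}" l L] L by simp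
    hence "\<theta> * (\<Sum>a<n. l a) \<le> \<theta> * (real n * L)" using \<theta>(1) by (intro mult_left_mono) auto
    with \<theta>(2) show ?thesis by simp
  qed
  have F: "\<theta>\<^sup>2 * (\<Sum>a<n. (l a)\<^sup>2) \<le> 1/16"
  proof -
    have "(\<Sum>a<n. (l a)\<^sup>2) \<le> L * (\<Sum>a<n. l a)"
      unfolding sum_distrib_left
      using l L by (intro sum_mono) (auto simp: power2_eq_square intro!: mult_right_mono)
    hence "\<theta>\<^sup>2 * (\<Sum>a<n. (l a)\<^sup>2) \<le> \<theta>\<^sup>2 * (L * (\<Sum>a<n. l a))" by (intro mult_left_mono) auto
    also have "\<dots> = (\<theta> * L) * (\<theta> * (\<Sum>a<n. l a))" by (simp add: power2_eq_square)
    also have "\<dots> \<le> (1/4) * (1/4)" using t \<theta>L \<theta>(1) l L(2) by (intro mult_mono mult_nonneg_nonneg sum_nonneg) auto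
    finally show ?thesis by simp
  qed
  have E: "expectation (\<lambda>\<omega>. exp (\<theta> * T \<omega>)) \<le> 4"
  proof -
    have "expectation (\<lambda>\<omega>. exp (\<theta> * T \<omega>)) \<le> exp (\<theta> * (\<Sum>a<n. l a) + \<theta>\<^sup>2 * (\<Sum>a<n. (l a)\<^sup>2) * (1 + 4 * (\<theta> * L)))"
      using gauss_pair_exp(2)[OF gp L(1), of \<theta>] \<theta>L \<theta>(1) by (simp add: T_def)
    also have "\<theta>\<^sup>2 * (\<Sum>a<n. (l a)\<^sup>2) * (1 + 4 * (\<theta> * L)) \<le> 1/16 * (1 + 4 * (1/4))"
      using F \<theta>L \<theta>(1) L(2) by (intro mult_mono) auto
    hence "exp (\<theta> * (\<Sum>a<n. l a) + \<theta>\<^sup>2 * (\<Sum>a<n. (l a)\<^sup>2) * (1 + 4 * (\<theta> * L))) \<le> exp 1"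
      using t by simp
    also have "exp 1 \<le> (4::real)" using exp_le by simp
    finally show ?thesis by simp
  qed
  have bound: "(T \<omega>)\<^sup>2 \<le> 4 / \<theta>\<^sup>2 * exp (\<theta> * T \<omega>)" for \<omega>
  proof -
    have "T \<omega> \<ge> 0" by (auto simp: T_def intro!: sum_nonneg)
    hence "(\<theta> * T \<omega>)\<^sup>2 \<le> 4 * exp (\<theta> * T \<omega>)" using \<theta>(1) by (intro power_le_exp) simp
    thus ?thesis using \<theta>(1) by (simp add: power_mult_distrib field_simps)
  qed
  show "integrable M (\<lambda>\<omega>. (\<Sum>a<n. U a \<omega> * U a \<omega>)\<^sup>2)"
    unfolding T_def[symmetric]
    by (rule Bochner_Integration.integrable_bound[OF int])
      (use bound \<theta> in \<open>auto intro!: AE_I2 order_trans[OF _ abs_ge_self]\<close>)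
  hence "expectation (\<lambda>\<omega>. (T \<omega>)\<^sup>2) \<le> expectation (\<lambda>\<omega>. 4 / \<theta>\<^sup>2 * exp (\<theta> * T \<omega>))"
    unfolding T_def[symmetric] by (rule integral_mono[OF _ int bound])
  also have "\<dots> = 4 / \<theta>\<^sup>2 * expectation (\<lambda>\<omega>. exp (\<theta> * T \<omega>))" by simp
  also have "\<dots> \<le> 4 / \<theta>\<^sup>2 * 4" using E \<theta>(1) by (intro mult_left_mono) auto
  also have "\<dots> = 256 * (real n * L)\<^sup>2" using n L(2) by (simp add: \<theta>_def power_divide power_mult_distrib)
  finally show "expectation (\<lambda>\<omega>. (\<Sum>a<n. U a \<omega> * U a \<omega>)\<^sup>2) \<le> 256 * (real n * L)\<^sup>2" by (simp add: T_def)
qed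

text \<open>At correlation 0 all the variables are independent, and each cross term has a factor of
  mean 0. An exact value is wanted because the lower bound for \<open>B_hat\<close> must not lose a
  constant factor.\<close>

lemma (in prob_space) gauss_pair_indep_moment2:
  assumes gp: "gauss_pair M n U V l 0"
  shows "expectation (\<lambda>\<omega>. (\<Sum>a<n. U a \<omega> * V a \<omega>)\<^sup>2) = (\<Sum>a<n. (l a)\<^sup>2)"
proof -
  define I where "I = {..<n} \<times> (UNIV :: bool set)"
  define Z where "Z = (\<lambda>(a, s). if s then U a else V a)"
  define v where "v = (\<lambda>(a, s::bool). l a)"
  have l: "\<And>a. a < n \<Longrightarrow> 0 \<le> l a" using gp by (auto simp: gauss_pair_def)
  have sumI: "(\<Sum>i\<in>I. f i) = (\<Sum>a<n. f (a, True) + f (a, False))" for f :: "nat \<times> bool \<Rightarrow> real"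
    using sum.cartesian_product[of "\<lambda>a s. f (a, s)" UNIV "{..<n}"] by (simp add: I_def UNIV_bool sum.distrib)
  have gf: "gauss_family M I Z v"
    unfolding gauss_family_def
  proof (intro conjI ballI allI)
    show "finite I" by (simp add: I_def)
    fix i assume i: "i \<in> I"
    show "Z i \<in> borel_measurable M" using gp i by (auto simp: I_def Z_def gauss_pair_def)
    show "0 \<le> v i" using i l by (auto simp: I_def v_def)
  next
    fix b :: "nat \<times> bool \<Rightarrow> real"
    define \<alpha> \<beta> where "\<alpha> a = b (a, True)" and "\<beta> a = b (a, False)" for a
    have "(\<lambda>\<omega>. \<Sum>i\<in>I. b i * Z i \<omega>) = (\<lambda>\<omega>. \<Sum>a<n. \<alpha> a * U a \<omega> + \<beta> a * V a \<omega>)"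
      by (simp add: sumI Z_def \<alpha>_def \<beta>_def)
    moreover have "(\<Sum>i\<in>I. (b i)\<^sup>2 * v i) = (\<Sum>a<n. l a * ((\<alpha> a)\<^sup>2 + 2 * 0 * \<alpha> a * \<beta> a + (\<beta> a)\<^sup>2))"
      by (simp add: sumI v_def \<alpha>_def \<beta>_def algebra_simps)
    ultimately show "distr M borel (\<lambda>\<omega>. \<Sum>i\<in>I. b i * Z i \<omega>) = normal_measure 0 (\<Sum>i\<in>I. (b i)\<^sup>2 * v i)"
      using gp by (simp only: gauss_pair_def)
  qed
  note ind = gauss_family_indep[OF gf]
  have m: "expectation (Z i) = 0" "integrable M (Z i)" if "i \<in> I" for i
    using gauss_family_mean[OF gf that] by (auto simp: has_bochner_integral_iff)
  have m2: "expectation (\<lambda>\<omega>. (Z i \<omega>)\<^sup>2) = v i" "integrable M (\<lambda>\<omega>. (Z i \<omega>)\<^sup>2)" if "i \<in> I" for i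
    using gauss_family_variance[OF gf that] by (auto simp: has_bochner_integral_iff)
  have E: "has_bochner_integral M (\<lambda>\<omega>. U a \<omega> * V a \<omega> * (U b \<omega> * V b \<omega>)) (if a = b then (l a)\<^sup>2 else 0)"
    if ab: "a < n" "b < n" for a b
  proof (cases "a = b")
    case True
    define K where "K = {(a, True), (a, False)}"
    have K: "K \<subseteq> I" "finite K" using ab by (auto simp: K_def I_def)
    have ind': "indep_vars (\<lambda>_. borel) (\<lambda>i \<omega>. (Z i \<omega>)\<^sup>2) K"
      by (intro indep_vars_compose2[OF indep_vars_subset[OF ind K(1)]]) simp
    have e: "(\<lambda>\<omega>. U a \<omega> * V a \<omega> * (U b \<omega> * V b \<omega>)) = (\<lambda>\<omega>. \<Prod>i\<in>K. (Z i \<omega>)\<^sup>2)"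
      using True by (simp add: K_def Z_def power2_eq_square mult_ac)
    have "expectation (\<lambda>\<omega>. \<Prod>i\<in>K. (Z i \<omega>)\<^sup>2) = (\<Prod>i\<in>K. v i)"
      using K m2 by (subst indep_vars_lebesgue_integral[OF K(2) ind']) (auto intro!: prod.cong)
    also have "\<dots> = (l a)\<^sup>2" by (simp add: K_def v_def power2_eq_square)
    finally show ?thesis unfolding e using True K m2
      by (auto simp: has_bochner_integral_iff intro!: indep_vars_integrable[OF K(2) ind'])
  next
    case False
    define K where "K = {(a, True), (a, False), (b, True), (b, False)}"
    have K: "K \<subseteq> I" "finite K" using ab by (auto simp: K_def I_def)
    have ind': "indep_vars (\<lambda>_. borel) Z K"
      by (rule indep_vars_subset[OF ind K(1)])
    have e: "(\<lambda>\<omega>. U a \<omega> * V a \<omega> * (U b \<omega> * V b \<omega>)) = (\<lambda>\<omega>. \<Prod>i\<in>K. Z i \<omega>)"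
      using False by (simp add: K_def Z_def mult_ac)
    have "expectation (\<lambda>\<omega>. \<Prod>i\<in>K. Z i \<omega>) = (\<Prod>i\<in>K. expectation (Z i))"
      using K m by (subst indep_vars_lebesgue_integral[OF K(2) ind']) auto
    also have "\<dots> = 0" using K m by (intro prod_zero) (auto simp: K_def)
    finally show ?thesis unfolding e using False K m
      by (auto simp: has_bochner_integral_iff intro!: indep_vars_integrable[OF K(2) ind'])
  qed
  have "(\<lambda>\<omega>. (\<Sum>a<n. U a \<omega> * V a \<omega>)\<^sup>2) = (\<lambda>\<omega>. \<Sum>a<n. \<Sum>b<n. U a \<omega> * V a \<omega> * (U b \<omega> * V b \<omega>))"
    by (simp add: power2_eq_square sum_product)
  moreover have "has_bochner_integral M (\<lambda>\<omega>. \<Sum>a<n. \<Sum>b<n. U a \<omega> * V a \<omega> * (U b \<omega> * V b \<omega>))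
      (\<Sum>a<n. \<Sum>b<n. if a = b then (l a)\<^sup>2 else 0)"
    by (intro has_bochner_integral_sum E) auto
  ultimately show ?thesis by (simp add: has_bochner_integral_iff)
qed

section \<open>Arrays of normal variables\<close>

lemma sum_of_bool_diagonal:
  fixes f g :: "nat \<Rightarrow> real"
  shows "(\<Sum>k<p. \<Sum>m<p. of_bool (k = m) * f k * g m) = (\<Sum>k<p. f k * g k)"
proof (rule sum.cong[OF refl])
  fix k assume "k \<in> {..<p}"
  moreover have "(\<Sum>m<p. of_bool (k = m) * f k * g m) = (\<Sum>m<p. if m = k then f k * g m else 0)"
    by (intro sum.cong) auto
  ultimately show "(\<Sum>m<p. of_bool (k = m) * f k * g m) = f k * g k" by simp
qed

text \<open>Entries in the same column \<open>a\<close> have covariance \<open>S k m * l a\<close>,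
  entries in different columns are independent: the Kronecker structure once its second factor has
  been diagonalised.\<close>

definition gauss_array :: "'a measure \<Rightarrow> nat \<Rightarrow> nat \<Rightarrow> (nat \<Rightarrow> nat \<Rightarrow> real) \<Rightarrow> (nat \<Rightarrow> real) \<Rightarrow> (nat \<Rightarrow> nat \<Rightarrow> 'a \<Rightarrow> real) \<Rightarrow> bool" where
  "gauss_array M p n S l G \<longleftrightarrow> (\<forall>k<p. \<forall>a<n. G k a \<in> borel_measurable M) \<and> (\<forall>a<n. 0 \<le> l a) \<and>
     (\<forall>\<alpha>. distr M borel (\<lambda>\<omega>. \<Sum>k<p. \<Sum>a<n. \<alpha> k a * G k a \<omega>)
        = normal_measure 0 (\<Sum>a<n. l a * (\<Sum>k<p. \<Sum>m<p. S k m * \<alpha> k a * \<alpha> m a)))"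

lemma abs_mult_le_half_squares:
  fixes x y :: real
  shows "\<bar>x * y\<bar> \<le> (x\<^sup>2 + y\<^sup>2) / 2"
  using sum_squares_bound[of "\<bar>x\<bar>" "\<bar>y\<bar>"] by (simp add: abs_mult)

lemma gauss_array_measurable: "gauss_array M p n S l G \<Longrightarrow> k < p \<Longrightarrow> a < n \<Longrightarrow> G k a \<in> borel_measurable M"
  unfolding gauss_array_def by blast

lemma gauss_array_nonneg: "gauss_array M p n S l G \<Longrightarrow> a < n \<Longrightarrow> 0 \<le> l a"
  unfolding gauss_array_def by blast

lemma gauss_array_law: "gauss_array M p n S l G \<Longrightarrow> distr M borel (\<lambda>\<omega>. \<Sum>k<p. \<Sum>a<n. \<alpha> k a * G k a \<omega>)
        = normal_measure 0 (\<Sum>a<n. l a * (\<Sum>k<p. \<Sum>m<p. S k m * \<alpha> k a * \<alpha> m a))"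
  unfolding gauss_array_def by blast

lemma gauss_array_pair:
  assumes ga: "gauss_array M p n S l G" and ij: "i < p" "j < p"
    and S: "S i i > 0" "S j j > 0" "S i j = S j i" "\<bar>S i j\<bar> \<le> sqrt (S i i * S j j)"
  shows "gauss_pair M n (\<lambda>a \<omega>. G i a \<omega> / sqrt (S i i)) (\<lambda>a \<omega>. G j a \<omega> / sqrt (S j j)) l
    (S i j / sqrt (S i i * S j j))"
  unfolding gauss_pair_def
proof (intro conjI allI impI)
  show "\<bar>S i j / sqrt (S i i * S j j)\<bar> \<le> 1" using S by (simp add: abs_mult)
  fix a assume a: "a < n"
  show "0 \<le> l a" using gauss_array_nonneg[OF ga] a by simp
  have "G i a \<in> borel_measurable M" "G j a \<in> borel_measurable M"
    using gauss_array_measurable[OF ga] a ij by simp_all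
  thus "(\<lambda>\<omega>. G i a \<omega> / sqrt (S i i)) \<in> borel_measurable M" "(\<lambda>\<omega>. G j a \<omega> / sqrt (S j j)) \<in> borel_measurable M"
    by simp_all
next
  fix \<alpha> \<beta> :: "nat \<Rightarrow> real"
  let ?x = "\<lambda>a. \<alpha> a / sqrt (S i i)" and ?y = "\<lambda>a. \<beta> a / sqrt (S j j)"
  \<comment> \<open>Two summed indicators, rather than nested cases, so that \<open>i = j\<close>
    remains included.\<close>
  define \<gamma> where "\<gamma> k a = (if k = i then ?x a else 0) + (if k = j then ?y a else 0)" for k a
  have delta: "(\<Sum>k<p. \<gamma> k a * h k) = ?x a * h i + ?y a * h j" for a and h :: "nat \<Rightarrow> real"
    using ij by (simp add: \<gamma>_def distrib_right sum.distrib if_distrib[of "\<lambda>x. x * _"] cong: if_cong)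
  have "(\<lambda>\<omega>. \<Sum>k<p. \<Sum>a<n. \<gamma> k a * G k a \<omega>)
    = (\<lambda>\<omega>. \<Sum>a<n. \<alpha> a * (G i a \<omega> / sqrt (S i i)) + \<beta> a * (G j a \<omega> / sqrt (S j j)))"
    by (subst sum.swap) (simp add: delta)
  moreover have "(\<Sum>k<p. \<Sum>m<p. S k m * \<gamma> k a * \<gamma> m a)
    = (\<alpha> a)\<^sup>2 + 2 * (S i j / sqrt (S i i * S j j)) * \<alpha> a * \<beta> a + (\<beta> a)\<^sup>2" for a
  proof -
    have "(\<Sum>k<p. \<Sum>m<p. S k m * \<gamma> k a * \<gamma> m a) = (\<Sum>k<p. \<gamma> k a * (\<Sum>m<p. \<gamma> m a * S k m))"
      by (simp add: sum_distrib_left mult_ac)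
    also have "\<dots> = S i i * (?x a)\<^sup>2 + 2 * S i j * (?x a * ?y a) + S j j * (?y a)\<^sup>2"
      unfolding delta using S(3) by (simp add: algebra_simps power2_eq_square)
    also have "\<dots> = (\<alpha> a)\<^sup>2 + 2 * (S i j / sqrt (S i i * S j j)) * \<alpha> a * \<beta> a + (\<beta> a)\<^sup>2"
      using S by (simp add: power_divide real_sqrt_mult)
    finally show ?thesis .
  qed
  ultimately show "distr M borel (\<lambda>\<omega>. \<Sum>a<n. \<alpha> a * (G i a \<omega> / sqrt (S i i)) + \<beta> a * (G j a \<omega> / sqrt (S j j)))
    = normal_measure 0 (\<Sum>a<n. l a * ((\<alpha> a)\<^sup>2 + 2 * (S i j / sqrt (S i i * S j j)) * \<alpha> a * \<beta> a + (\<beta> a)\<^sup>2))"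
    using gauss_array_law[OF ga, of \<gamma>] by (simp only:)
qed

text \<open>Whitening: rotating the variables into the eigenbasis of \<open>S\<close> and dividing
  by the roots of its positive eigenvalues makes the rows independent and leaves the column
  variances \<open>l\<close> alone.\<close>

lemma gauss_array_rotate_rows:
  assumes ga: "gauss_array M p n S l G" and sd: "spectral_decomp p S w s" and s: "\<And>k. k < p \<Longrightarrow> s k > 0"
  shows "gauss_array M p n (\<lambda>k m. of_bool (k = m)) l (\<lambda>k a \<omega>. (\<Sum>m<p. w k m * G m a \<omega>) / sqrt (s k))"
  unfolding gauss_array_def
proof (intro conjI allI impI)
  show "0 \<le> l a" if "a < n" for a using gauss_array_nonneg[OF ga that] .
  have [measurable]: "G k a \<in> borel_measurable M" if "k < p" "a < n" for k a
    using gauss_array_measurable[OF ga that] .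
  show "(\<lambda>\<omega>. (\<Sum>m<p. w k m * G m a \<omega>) / sqrt (s k)) \<in> borel_measurable M" if "k < p" "a < n" for k a
    using that by (intro borel_measurable_divide borel_measurable_sum borel_measurable_times) auto
next
  fix \<alpha> :: "nat \<Rightarrow> nat \<Rightarrow> real"
  define \<gamma> where "\<gamma> m a = (\<Sum>k<p. \<alpha> k a / sqrt (s k) * w k m)" for m a
  have "(\<lambda>\<omega>. \<Sum>m<p. \<Sum>a<n. \<gamma> m a * G m a \<omega>)
    = (\<lambda>\<omega>. \<Sum>k<p. \<Sum>a<n. \<alpha> k a * ((\<Sum>m<p. w k m * G m a \<omega>) / sqrt (s k)))"
  proof
    fix \<omega>
    have "(\<Sum>m<p. \<Sum>a<n. \<gamma> m a * G m a \<omega>) = (\<Sum>a<n. \<Sum>m<p. \<Sum>k<p. \<alpha> k a / sqrt (s k) * w k m * G m a \<omega>)"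
      by (subst sum.swap) (simp add: \<gamma>_def sum_distrib_right)
    also have "\<dots> = (\<Sum>a<n. \<Sum>k<p. \<Sum>m<p. \<alpha> k a / sqrt (s k) * w k m * G m a \<omega>)"
      by (intro sum.cong[OF refl] sum.swap)
    also have "\<dots> = (\<Sum>k<p. \<Sum>a<n. \<Sum>m<p. \<alpha> k a / sqrt (s k) * w k m * G m a \<omega>)"
      by (rule sum.swap)
    also have "\<dots> = (\<Sum>k<p. \<Sum>a<n. \<alpha> k a * ((\<Sum>m<p. w k m * G m a \<omega>) / sqrt (s k)))"
      by (simp add: sum_distrib_left sum_divide_distrib mult_ac)
    finally show "(\<Sum>m<p. \<Sum>a<n. \<gamma> m a * G m a \<omega>) = (\<Sum>k<p. \<Sum>a<n. \<alpha> k a * ((\<Sum>m<p. w k m * G m a \<omega>) / sqrt (s k)))" .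
  qed
  moreover have "(\<Sum>k<p. \<Sum>m<p. S k m * \<gamma> k a * \<gamma> m a) = (\<Sum>k<p. \<Sum>m<p. of_bool (k = m) * \<alpha> k a * \<alpha> m a)" for a
  proof -
    have wg: "(\<Sum>i<p. w k i * \<gamma> i a) = \<alpha> k a / sqrt (s k)" if k: "k < p" for k
    proof -
      have "(\<Sum>i<p. w k i * \<gamma> i a) = (\<Sum>i<p. \<Sum>m<p. \<alpha> m a / sqrt (s m) * (w k i * w m i))"
        by (simp add: \<gamma>_def sum_distrib_left mult_ac)
      also have "\<dots> = (\<Sum>m<p. \<alpha> m a / sqrt (s m) * (\<Sum>i<p. w k i * w m i))"
        by (subst sum.swap) (simp add: sum_distrib_left)
      also have "\<dots> = (\<Sum>m<p. if m = k then \<alpha> m a / sqrt (s m) else 0)"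
        using k by (intro sum.cong refl) (auto simp: spectral_decomp_orthonormal[OF sd])
      finally show ?thesis using k by simp
    qed
    have "(\<Sum>k<p. \<Sum>m<p. S k m * \<gamma> k a * \<gamma> m a) = (\<Sum>k<p. (\<alpha> k a)\<^sup>2)"
      unfolding spectral_decomp_bilinear[OF sd]
    proof (intro sum.cong refl)
      fix k assume "k \<in> {..<p}"
      thus "s k * (\<Sum>i<p. w k i * \<gamma> i a) * (\<Sum>j<p. w k j * \<gamma> j a) = (\<alpha> k a)\<^sup>2"
        using s[of k] by (simp add: wg power2_eq_square)
    qed
    thus ?thesis by (simp only: sum_of_bool_diagonal power2_eq_square)
  qed
  ultimately show "distr M borel (\<lambda>\<omega>. \<Sum>k<p. \<Sum>a<n. \<alpha> k a * ((\<Sum>m<p. w k m * G m a \<omega>) / sqrt (s k)))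
    = normal_measure 0 (\<Sum>a<n. l a * (\<Sum>k<p. \<Sum>m<p. of_bool (k = m) * \<alpha> k a * \<alpha> m a))"
    using gauss_array_law[OF ga, of \<gamma>] by (simp only:)
qed

text \<open>Rotating the observations into an eigenbasis decorrelates the columns. Nothing is
  divided by an eigenvalue, so a singular \<open>\<Psi>\<close> is allowed, which the centred
  covariance is.\<close>

lemma gauss_array_rotate_cols:
  assumes Y: "\<And>k i. k < p \<Longrightarrow> i < n \<Longrightarrow> Y k i \<in> borel_measurable M"
    and law: "\<And>\<alpha>. distr M borel (\<lambda>\<omega>. \<Sum>k<p. \<Sum>i<n. \<alpha> k i * Y k i \<omega>)
        = normal_measure 0 (\<Sum>k<p. \<Sum>m<p. S k m * (\<Sum>i<n. \<Sum>j<n. \<Psi> i j * \<alpha> k i * \<alpha> m j))"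
    and sd: "spectral_decomp n \<Psi> u l" and l: "\<And>a. a < n \<Longrightarrow> 0 \<le> l a"
  shows "gauss_array M p n S l (\<lambda>k a \<omega>. \<Sum>i<n. u a i * Y k i \<omega>)"
  unfolding gauss_array_def
proof (intro conjI allI impI)
  show "0 \<le> l a" if "a < n" for a using l that .
  show "(\<lambda>\<omega>. \<Sum>i<n. u a i * Y k i \<omega>) \<in> borel_measurable M" if "k < p" "a < n" for k a
    using that Y by (intro borel_measurable_sum borel_measurable_times) auto
next
  fix \<alpha> :: "nat \<Rightarrow> nat \<Rightarrow> real"
  define \<gamma> where "\<gamma> k i = (\<Sum>a<n. \<alpha> k a * u a i)" for k i
  have ug: "(\<Sum>i<n. u a i * \<gamma> k i) = \<alpha> k a" if a: "a < n" for k a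
  proof -
    have "(\<Sum>i<n. u a i * \<gamma> k i) = (\<Sum>i<n. \<Sum>b<n. \<alpha> k b * (u a i * u b i))"
      by (simp add: \<gamma>_def sum_distrib_left mult_ac)
    also have "\<dots> = (\<Sum>b<n. \<alpha> k b * (\<Sum>i<n. u a i * u b i))"
      by (subst sum.swap) (simp add: sum_distrib_left)
    also have "\<dots> = (\<Sum>b<n. if b = a then \<alpha> k b else 0)"
      using a by (intro sum.cong refl) (auto simp: spectral_decomp_orthonormal[OF sd])
    finally show ?thesis using a by simp
  qed
  have "(\<lambda>\<omega>. \<Sum>k<p. \<Sum>i<n. \<gamma> k i * Y k i \<omega>) = (\<lambda>\<omega>. \<Sum>k<p. \<Sum>a<n. \<alpha> k a * (\<Sum>i<n. u a i * Y k i \<omega>))"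
  proof
    fix \<omega>
    have "(\<Sum>k<p. \<Sum>i<n. \<gamma> k i * Y k i \<omega>) = (\<Sum>k<p. \<Sum>i<n. \<Sum>a<n. \<alpha> k a * u a i * Y k i \<omega>)"
      by (simp add: \<gamma>_def sum_distrib_right)
    also have "\<dots> = (\<Sum>k<p. \<Sum>a<n. \<Sum>i<n. \<alpha> k a * u a i * Y k i \<omega>)"
      by (intro sum.cong[OF refl] sum.swap)
    finally show "(\<Sum>k<p. \<Sum>i<n. \<gamma> k i * Y k i \<omega>) = (\<Sum>k<p. \<Sum>a<n. \<alpha> k a * (\<Sum>i<n. u a i * Y k i \<omega>))"
      by (simp add: sum_distrib_left mult_ac)
  qed
  moreover have "(\<Sum>k<p. \<Sum>m<p. S k m * (\<Sum>i<n. \<Sum>j<n. \<Psi> i j * \<gamma> k i * \<gamma> m j))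
    = (\<Sum>a<n. l a * (\<Sum>k<p. \<Sum>m<p. S k m * \<alpha> k a * \<alpha> m a))"
  proof -
    have "(\<Sum>k<p. \<Sum>m<p. S k m * (\<Sum>i<n. \<Sum>j<n. \<Psi> i j * \<gamma> k i * \<gamma> m j))
      = (\<Sum>k<p. \<Sum>m<p. \<Sum>a<n. l a * (S k m * \<alpha> k a * \<alpha> m a))"
    proof (intro sum.cong refl)
      fix k m
      have "(\<Sum>i<n. \<Sum>j<n. \<Psi> i j * \<gamma> k i * \<gamma> m j) = (\<Sum>a<n. l a * \<alpha> k a * \<alpha> m a)"
        unfolding spectral_decomp_bilinear[OF sd] by (intro sum.cong refl) (simp add: ug)
      thus "S k m * (\<Sum>i<n. \<Sum>j<n. \<Psi> i j * \<gamma> k i * \<gamma> m j) = (\<Sum>a<n. l a * (S k m * \<alpha> k a * \<alpha> m a))"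
        by (simp add: sum_distrib_left mult_ac)
    qed
    also have "\<dots> = (\<Sum>k<p. \<Sum>a<n. \<Sum>m<p. l a * (S k m * \<alpha> k a * \<alpha> m a))"
      by (intro sum.cong[OF refl] sum.swap)
    also have "\<dots> = (\<Sum>a<n. \<Sum>k<p. \<Sum>m<p. l a * (S k m * \<alpha> k a * \<alpha> m a))"
      by (rule sum.swap)
    finally show ?thesis by (simp add: sum_distrib_left)
  qed
  ultimately show "distr M borel (\<lambda>\<omega>. \<Sum>k<p. \<Sum>a<n. \<alpha> k a * (\<Sum>i<n. u a i * Y k i \<omega>))
    = normal_measure 0 (\<Sum>a<n. l a * (\<Sum>k<p. \<Sum>m<p. S k m * \<alpha> k a * \<alpha> m a))"
    using law[of \<gamma>] by simp
qed

lemma gauss_array_family: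
  assumes ga: "gauss_array M p n (\<lambda>k m. of_bool (k = m)) l H"
  shows "gauss_family M ({..<p} \<times> {..<n}) (\<lambda>(k, a). H k a) (\<lambda>(k, a). l a)"
  unfolding gauss_family_def
proof (intro conjI ballI allI)
  fix b :: "nat \<times> nat \<Rightarrow> real"
  have "(\<lambda>\<omega>. \<Sum>i\<in>{..<p} \<times> {..<n}. b i * (case i of (k, a) \<Rightarrow> H k a) \<omega>) = (\<lambda>\<omega>. \<Sum>k<p. \<Sum>a<n. b (k, a) * H k a \<omega>)"
    by (simp add: sum.cartesian_product case_prod_beta')
  moreover have "(\<Sum>i\<in>{..<p} \<times> {..<n}. (b i)\<^sup>2 * (case i of (k, a) \<Rightarrow> l a))
    = (\<Sum>a<n. l a * (\<Sum>k<p. \<Sum>m<p. of_bool (k = m) * b (k, a) * b (m, a)))"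
  proof -
    have "(\<Sum>i\<in>{..<p} \<times> {..<n}. (b i)\<^sup>2 * (case i of (k, a) \<Rightarrow> l a)) = (\<Sum>k<p. \<Sum>a<n. (b (k, a))\<^sup>2 * l a)"
      by (simp add: sum.cartesian_product case_prod_beta')
    also have "\<dots> = (\<Sum>a<n. \<Sum>k<p. (b (k, a))\<^sup>2 * l a)" by (rule sum.swap)
    also have "\<dots> = (\<Sum>a<n. l a * (\<Sum>k<p. b (k, a) * b (k, a)))"
      by (simp add: sum_distrib_left power2_eq_square mult_ac)
    finally show ?thesis by (simp only: sum_of_bool_diagonal)
  qed
  ultimately show "distr M borel (\<lambda>\<omega>. \<Sum>i\<in>{..<p} \<times> {..<n}. b i * (case i of (k, a) \<Rightarrow> H k a) \<omega>)
    = normal_measure 0 (\<Sum>i\<in>{..<p} \<times> {..<n}. (b i)\<^sup>2 * (case i of (k, a) \<Rightarrow> l a))"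
    using gauss_array_law[OF ga, of "\<lambda>k a. b (k, a)"] by (simp only:)
next
  fix i assume "i \<in> {..<p} \<times> {..<n}"
  then obtain k a where i: "i = (k, a)" "k < p" "a < n" by auto
  show "(case i of (k, a) \<Rightarrow> H k a) \<in> borel_measurable M"
    using gauss_array_measurable[OF ga] i by simp
  show "0 \<le> (case i of (k, a) \<Rightarrow> l a)"
    using gauss_array_nonneg[OF ga] i by simp
qed simp

section \<open>Concentration of the off-diagonal Gram entries of a white array\<close>

context prob_space
begin

context
  fixes p n :: nat and l :: "nat \<Rightarrow> real" and H :: "nat \<Rightarrow> nat \<Rightarrow> 'a \<Rightarrow> real" and F :: real and T
  assumes ga: "gauss_array M p n (\<lambda>k m. of_bool (k = m)) l H"
  defines "F \<equiv> \<Sum>a<n. (l a)\<^sup>2"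
  defines "T \<equiv> \<lambda>k m \<omega>. \<Sum>a<n. H k a \<omega> * H m a \<omega>"
  assumes Fpos: "F > 0"
begin

lemma white_array_measurable: "k < p \<Longrightarrow> m < p \<Longrightarrow> T k m \<in> borel_measurable M"
  unfolding T_def by (intro borel_measurable_sum borel_measurable_times gauss_array_measurable[OF ga]) auto

lemma white_array_pair_self: "k < p \<Longrightarrow> gauss_pair M n (H k) (H k) l 1"
  using gauss_array_pair[OF ga, of k k] by simp

lemma white_array_pair:
  assumes "k < p" "m < p" "k \<noteq> m"
  shows "gauss_pair M n (H k) (H m) l 0"
proof -
  have "of_bool (k = m) = (0::real)" "of_bool (m = k) = (0::real)" "of_bool (k = k) = (1::real)" "of_bool (m = m) = (1::real)"
    using assms(3) by simp_all
  note * = gauss_array_pair[OF ga assms(1,2), unfolded this]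
  show ?thesis using * by simp
qed

lemma white_array_moments:
  assumes "k < p" "m < p" "k \<noteq> m"
  shows "integrable M (\<lambda>\<omega>. T k m \<omega> ^ 4)" "expectation (\<lambda>\<omega>. T k m \<omega> ^ 4) \<le> 2 ^ 19 * F\<^sup>2"
    "integrable M (\<lambda>\<omega>. (T k m \<omega>)\<^sup>2)" "expectation (\<lambda>\<omega>. (T k m \<omega>)\<^sup>2) = F"
proof -
  note gp = white_array_pair[OF assms]
  show i4: "integrable M (\<lambda>\<omega>. T k m \<omega> ^ 4)" and "expectation (\<lambda>\<omega>. T k m \<omega> ^ 4) \<le> 2 ^ 19 * F\<^sup>2"
    unfolding T_def F_def using gauss_pair_moment4[OF gp] Fpos by (auto simp: F_def)
  show "expectation (\<lambda>\<omega>. (T k m \<omega>)\<^sup>2) = F"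
    unfolding T_def F_def by (rule gauss_pair_indep_moment2[OF gp])
  have "integrable M (\<lambda>\<omega>. 1 + T k m \<omega> ^ 4)" using i4 by simp
  thus "integrable M (\<lambda>\<omega>. (T k m \<omega>)\<^sup>2)"
  proof (rule Bochner_Integration.integrable_bound)
    show "AE \<omega> in M. norm ((T k m \<omega>)\<^sup>2) \<le> norm (1 + T k m \<omega> ^ 4)"
    proof (rule AE_I2)
      fix \<omega>
      define y where "y = (T k m \<omega>)\<^sup>2"
      have "0 \<le> (y - 1)\<^sup>2 + y\<^sup>2 + 1" by simp
      hence "y \<le> 1 + y\<^sup>2" by (simp add: power2_eq_square algebra_simps)
      moreover have "T k m \<omega> ^ 4 = y\<^sup>2" by (simp add: y_def flip: power_mult)
      moreover have "y \<ge> 0" by (simp add: y_def)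
      ultimately have "\<bar>y\<bar> \<le> \<bar>1 + T k m \<omega> ^ 4\<bar>" by linarith
      thus "norm ((T k m \<omega>)\<^sup>2) \<le> norm (1 + T k m \<omega> ^ 4)" by (simp only: y_def real_norm_def)
    qed
    show "(\<lambda>\<omega>. (T k m \<omega>)\<^sup>2) \<in> borel_measurable M"
      using white_array_measurable[OF assms(1,2)] by simp
  qed
qed

text \<open>\<open>T k m\<close> is a function of the rows \<open>k\<close> and \<open>m\<close>
  only, and disjoint blocks of an independent family are independent; both factors have mean
  0.\<close>

lemma white_array_uncorrelated:
  assumes "k < p" "m < p" "k \<noteq> m" "k' < p" "m' < p" "k' \<noteq> m'" "{k, m} \<inter> {k', m'} = {}"
  shows "expectation (\<lambda>\<omega>. ((T k m \<omega>)\<^sup>2 - F) * ((T k' m' \<omega>)\<^sup>2 - F)) = 0"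
proof -
  define A where "A = {k, m} \<times> {..<n}"
  define B where "B = {k', m'} \<times> {..<n}"
  define Z where "Z = (\<lambda>(k, a). H k a)"
  define f where "f k m x = (\<Sum>a<n. x (k, a) * x (m, a))\<^sup>2 - F" for k m :: nat and x :: "nat \<times> nat \<Rightarrow> real"
  have "indep_vars (\<lambda>_. borel) Z ({..<p} \<times> {..<n})"
    unfolding Z_def by (rule gauss_family_indep[OF gauss_array_family[OF ga]])
  hence ind: "indep_var (PiM A (\<lambda>_. borel)) (\<lambda>\<omega>. restrict (\<lambda>i. Z i \<omega>) A) (PiM B (\<lambda>_. borel)) (\<lambda>\<omega>. restrict (\<lambda>i. Z i \<omega>) B)"
    by (rule indep_var_restrict) (use assms in \<open>auto simp: A_def B_def\<close>)
  have "f k m \<in> borel_measurable (PiM A (\<lambda>_. borel))"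
    unfolding f_def by (intro borel_measurable_diff borel_measurable_power borel_measurable_sum borel_measurable_times
        borel_measurable_const measurable_component_singleton) (auto simp: A_def)
  moreover have "f k' m' \<in> borel_measurable (PiM B (\<lambda>_. borel))"
    unfolding f_def by (intro borel_measurable_diff borel_measurable_power borel_measurable_sum borel_measurable_times
        borel_measurable_const measurable_component_singleton) (auto simp: B_def)
  ultimately have "indep_var borel (f k m \<circ> (\<lambda>\<omega>. restrict (\<lambda>i. Z i \<omega>) A)) borel (f k' m' \<circ> (\<lambda>\<omega>. restrict (\<lambda>i. Z i \<omega>) B))"
    by (rule indep_var_compose[OF ind])
  moreover have "f k m \<circ> (\<lambda>\<omega>. restrict (\<lambda>i. Z i \<omega>) A) = (\<lambda>\<omega>. (T k m \<omega>)\<^sup>2 - F)"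
    by (auto simp: f_def A_def T_def Z_def fun_eq_iff)
  moreover have "f k' m' \<circ> (\<lambda>\<omega>. restrict (\<lambda>i. Z i \<omega>) B) = (\<lambda>\<omega>. (T k' m' \<omega>)\<^sup>2 - F)"
    by (auto simp: f_def B_def T_def Z_def fun_eq_iff)
  ultimately have "indep_var borel (\<lambda>\<omega>. (T k m \<omega>)\<^sup>2 - F) borel (\<lambda>\<omega>. (T k' m' \<omega>)\<^sup>2 - F)" by simp
  from indep_var_lebesgue_integral[OF this]
  show ?thesis using white_array_moments assms by (simp add: prob_space)
qed

lemma white_array_covariance_bound:
  assumes "k < p" "m < p" "k \<noteq> m" "k' < p" "m' < p" "k' \<noteq> m'"
  shows "integrable M (\<lambda>\<omega>. ((T k m \<omega>)\<^sup>2 - F) * ((T k' m' \<omega>)\<^sup>2 - F))"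
    "expectation (\<lambda>\<omega>. ((T k m \<omega>)\<^sup>2 - F) * ((T k' m' \<omega>)\<^sup>2 - F)) \<le> 2 ^ 19 * F\<^sup>2"
proof -
  have sq: "integrable M (\<lambda>\<omega>. ((T k m \<omega>)\<^sup>2 - F)\<^sup>2) \<and> expectation (\<lambda>\<omega>. ((T k m \<omega>)\<^sup>2 - F)\<^sup>2) \<le> 2 ^ 19 * F\<^sup>2"
    if km: "k < p" "m < p" "k \<noteq> m" for k m
  proof -
    have e: "(\<lambda>\<omega>. ((T k m \<omega>)\<^sup>2 - F)\<^sup>2) = (\<lambda>\<omega>. T k m \<omega> ^ 4 - 2 * F * (T k m \<omega>)\<^sup>2 + F\<^sup>2)"
      by (simp add: power2_eq_square power4_eq_xxxx algebra_simps)
    have "expectation (\<lambda>\<omega>. T k m \<omega> ^ 4 - 2 * F * (T k m \<omega>)\<^sup>2 + F\<^sup>2) = expectation (\<lambda>\<omega>. T k m \<omega> ^ 4) - 2 * F * F + F\<^sup>2"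
      using white_array_moments[OF km] by (simp add: prob_space)
    also have "\<dots> \<le> 2 ^ 19 * F\<^sup>2"
    proof -
      have "2 * F * F = 2 * F\<^sup>2" by (simp add: power2_eq_square)
      thus ?thesis using white_array_moments(2)[OF km] zero_le_power2[of F] by linarith
    qed
    finally show ?thesis unfolding e using white_array_moments[OF km] by simp
  qed
  let ?f = "\<lambda>\<omega>. (T k m \<omega>)\<^sup>2 - F" and ?g = "\<lambda>\<omega>. (T k' m' \<omega>)\<^sup>2 - F"
  have int: "integrable M (\<lambda>\<omega>. ((?f \<omega>)\<^sup>2 + (?g \<omega>)\<^sup>2) / 2)"
    using sq[OF assms(1-3)] sq[OF assms(4-6)] by simp
  have am: "\<bar>?f \<omega> * ?g \<omega>\<bar> \<le> ((?f \<omega>)\<^sup>2 + (?g \<omega>)\<^sup>2) / 2" for \<omega>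
    by (rule abs_mult_le_half_squares)
  have [measurable]: "T k m \<in> borel_measurable M" "T k' m' \<in> borel_measurable M"
    using white_array_measurable[OF assms(1,2)] white_array_measurable[OF assms(4,5)] .
  show i: "integrable M (\<lambda>\<omega>. ?f \<omega> * ?g \<omega>)"
  proof (rule Bochner_Integration.integrable_bound[OF int])
    show "AE \<omega> in M. norm (?f \<omega> * ?g \<omega>) \<le> norm (((?f \<omega>)\<^sup>2 + (?g \<omega>)\<^sup>2) / 2)"
    proof (rule AE_I2)
      fix \<omega>
      show "norm (?f \<omega> * ?g \<omega>) \<le> norm (((?f \<omega>)\<^sup>2 + (?g \<omega>)\<^sup>2) / 2)"
        using am[of \<omega>] unfolding real_norm_def by linarith
    qed
  qed measurable
  have "expectation (\<lambda>\<omega>. ?f \<omega> * ?g \<omega>) \<le> expectation (\<lambda>\<omega>. ((?f \<omega>)\<^sup>2 + (?g \<omega>)\<^sup>2) / 2)"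
    using am by (intro integral_mono[OF i int]) (meson abs_le_D1)
  also have "\<dots> = (expectation (\<lambda>\<omega>. (?f \<omega>)\<^sup>2) + expectation (\<lambda>\<omega>. (?g \<omega>)\<^sup>2)) / 2"
    using sq[OF assms(1-3)] sq[OF assms(4-6)] by simp
  also have "\<dots> \<le> 2 ^ 19 * F\<^sup>2"
    using sq[OF assms(1-3)] sq[OF assms(4-6)] by simp
  finally show "expectation (\<lambda>\<omega>. ?f \<omega> * ?g \<omega>) \<le> 2 ^ 19 * F\<^sup>2" .
qed

text \<open>Chebyshev's inequality. Only products of two index pairs that share an index contribute
  to the variance, and there are at most \<open>4 * p^3\<close> of them instead of
  \<open>p^4\<close>. With weights bounded away from 0 the mean \<open>E\<close> has order
  \<open>p^2 * F\<close>, so the relative fluctuation is of order \<open>1 / sqrt p\<close>.\<close>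

lemma white_array_weighted_sum:
  fixes s :: "nat \<Rightarrow> real" and c :: real
  assumes s: "\<And>k. k < p \<Longrightarrow> 0 \<le> s k \<and> s k \<le> c"
  defines "D \<equiv> {(k, m). k < p \<and> m < p \<and> k \<noteq> m}"
  defines "Q \<equiv> \<lambda>\<omega>. \<Sum>(k, m)\<in>D. s k * s m * (T k m \<omega>)\<^sup>2"
  defines "E \<equiv> F * (\<Sum>(k, m)\<in>D. s k * s m)"
  shows "expectation Q = E" "integrable M Q"
    "x > 0 \<Longrightarrow> prob {\<omega> \<in> space M. x \<le> \<bar>Q \<omega> - E\<bar>} \<le> 2 ^ 21 * real p ^ 3 * c ^ 4 * F\<^sup>2 / x\<^sup>2"
proof -
  have D: "finite D" "D \<subseteq> {..<p} \<times> {..<p}"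
  proof -
    show "D \<subseteq> {..<p} \<times> {..<p}" by (auto simp: D_def)
    thus "finite D" by (rule finite_subset) simp
  qed
  have iQ: "integrable M (\<lambda>\<omega>. s k * s m * (T k m \<omega>)\<^sup>2)" if "(k, m) \<in> D" for k m
    using that white_array_moments by (auto simp: D_def)
  show [simp]: "integrable M Q" unfolding Q_def using iQ by (intro Bochner_Integration.integrable_sum) auto
  show EQ: "expectation Q = E"
    unfolding Q_def E_def sum_distrib_left using iQ white_array_moments
    by (subst Bochner_Integration.integral_sum) (auto simp: D_def mult_ac intro!: sum.cong)
  define h where "h = (\<lambda>(k, m) \<omega>. s k * s m * ((T k m \<omega>)\<^sup>2 - F))"
  have Qh: "Q \<omega> - E = (\<Sum>d\<in>D. h d \<omega>)" for \<omega>
    unfolding Q_def E_def h_def sum_distrib_left sum_subtractf[symmetric]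
    by (intro sum.cong) (auto simp: algebra_simps)
  \<comment> \<open>A count of coincidences: at least 1 whenever the two pairs meet, and easy to
    sum, since each of its four terms gives \<open>p\<close> when \<open>e\<close> runs over the
    full square.\<close>
  define ov where "ov d e = (real (of_bool (fst e = fst d)) + of_bool (fst e = snd d) + of_bool (snd e = fst d) + of_bool (snd e = snd d))"
    for d e :: "nat \<times> nat"
  have c0: "c \<ge> 0" if "D \<noteq> {}" using that s by (force simp: D_def)
  have hint: "integrable M (\<lambda>\<omega>. h d \<omega> * h e \<omega>) \<and> expectation (\<lambda>\<omega>. h d \<omega> * h e \<omega>) \<le> c ^ 4 * (2 ^ 19 * F\<^sup>2) * ov d e"
    if de: "d \<in> D" "e \<in> D" for d e
  proof -
    obtain k m k' m' where d: "d = (k, m)" "e = (k', m')" by (cases d, cases e) auto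
    have km: "k < p" "m < p" "k \<noteq> m" "k' < p" "m' < p" "k' \<noteq> m'" using de by (auto simp: D_def d)
    define w where "w = s k * s m * (s k' * s m')"
    have w: "0 \<le> w" "w \<le> c ^ 4"
    proof -
      show "0 \<le> w" using s km by (simp add: w_def)
      have "w \<le> c * c * (c * c)" unfolding w_def using s km c0 de
        by (intro mult_mono mult_nonneg_nonneg) auto
      thus "w \<le> c ^ 4" by (simp add: power4_eq_xxxx mult.assoc)
    qed
    have e: "(\<lambda>\<omega>. h d \<omega> * h e \<omega>) = (\<lambda>\<omega>. w * (((T k m \<omega>)\<^sup>2 - F) * ((T k' m' \<omega>)\<^sup>2 - F)))"
      by (simp add: h_def d w_def mult_ac)
    have "expectation (\<lambda>\<omega>. h d \<omega> * h e \<omega>) \<le> c ^ 4 * (2 ^ 19 * F\<^sup>2) * ov d e"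
    proof (cases "{k, m} \<inter> {k', m'} = {}")
      case True
      hence "expectation (\<lambda>\<omega>. h d \<omega> * h e \<omega>) = 0" unfolding e using white_array_uncorrelated[OF km True] by simp
      thus ?thesis by (simp add: ov_def)
    next
      case False
      hence ov: "ov d e \<ge> 1" by (auto simp: ov_def d)
      have "expectation (\<lambda>\<omega>. h d \<omega> * h e \<omega>) \<le> w * (2 ^ 19 * F\<^sup>2)"
        unfolding e using white_array_covariance_bound(2)[OF km] w by (simp add: mult_left_mono)
      also have "\<dots> \<le> c ^ 4 * (2 ^ 19 * F\<^sup>2) * 1" using w by (simp add: mult_right_mono)
      also have "\<dots> \<le> c ^ 4 * (2 ^ 19 * F\<^sup>2) * ov d e" using ov by (intro mult_left_mono) auto
      finally show ?thesis .
    qed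
    thus ?thesis unfolding e using white_array_covariance_bound(1)[OF km] by simp
  qed
  have sq: "(\<lambda>\<omega>. (Q \<omega> - E)\<^sup>2) = (\<lambda>\<omega>. \<Sum>d\<in>D. \<Sum>e\<in>D. h d \<omega> * h e \<omega>)"
    by (simp add: Qh power2_eq_square sum_product)
  have isq: "integrable M (\<lambda>\<omega>. (Q \<omega> - E)\<^sup>2)" unfolding sq using hint by auto
  have "variance Q = expectation (\<lambda>\<omega>. (Q \<omega> - E)\<^sup>2)" by (simp add: EQ)
  also have "\<dots> = (\<Sum>d\<in>D. \<Sum>e\<in>D. expectation (\<lambda>\<omega>. h d \<omega> * h e \<omega>))"
    unfolding sq using hint by simp
  also have "\<dots> \<le> (\<Sum>d\<in>D. \<Sum>e\<in>D. c ^ 4 * (2 ^ 19 * F\<^sup>2) * ov d e)"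
    using hint by (intro sum_mono) auto
  also have "\<dots> = c ^ 4 * (2 ^ 19 * F\<^sup>2) * (\<Sum>d\<in>D. \<Sum>e\<in>D. ov d e)"
    by (simp add: sum_distrib_left)
  also have "(\<Sum>d\<in>D. \<Sum>e\<in>D. ov d e) \<le> 4 * real p ^ 3"
  proof -
    have "(\<Sum>e\<in>D. ov d e) \<le> 4 * real p" if "d \<in> D" for d
    proof -
      have "(\<Sum>e\<in>D. ov d e) \<le> (\<Sum>e\<in>{..<p} \<times> {..<p}. ov d e)"
        using D by (intro sum_mono2) (auto simp: ov_def)
      also have "\<dots> = (\<Sum>k<p. \<Sum>m<p. ov d (k, m))" by (simp add: sum.cartesian_product)
      also have "\<dots> = 4 * real p" using that
        by (auto simp: ov_def sum.distrib D_def of_bool_def if_distrib[of real] simp flip: sum_distrib_left cong: if_cong)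
      finally show ?thesis .
    qed
    hence "(\<Sum>d\<in>D. \<Sum>e\<in>D. ov d e) \<le> real (card D) * (4 * real p)"
      using sum_bounded_above[of D "\<lambda>d. \<Sum>e\<in>D. ov d e" "4 * real p"] by simp
    also have "real (card D) \<le> real p * real p"
      using card_mono[OF _ D(2)] by (simp flip: of_nat_mult)
    finally show ?thesis by (simp add: power3_eq_cube mult_right_mono)
  qed
  finally have var: "variance Q \<le> c ^ 4 * (2 ^ 19 * F\<^sup>2) * (4 * real p ^ 3)"
    by (simp add: mult_left_mono)
  have iQ2: "integrable M (\<lambda>\<omega>. (Q \<omega>)\<^sup>2)"
  proof -
    have "(\<lambda>\<omega>. (Q \<omega>)\<^sup>2) = (\<lambda>\<omega>. (Q \<omega> - E)\<^sup>2 + 2 * E * Q \<omega> - E\<^sup>2)"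
      by (simp add: power2_diff algebra_simps)
    thus ?thesis using isq by simp
  qed
  assume x: "x > 0"
  have "prob {\<omega> \<in> space M. x \<le> \<bar>Q \<omega> - E\<bar>} \<le> variance Q / x\<^sup>2"
    using Chebyshev_inequality[of Q x] x iQ2 borel_measurable_integrable[OF \<open>integrable M Q\<close>] by (simp add: EQ)
  also have "\<dots> \<le> c ^ 4 * (2 ^ 19 * F\<^sup>2) * (4 * real p ^ 3) / x\<^sup>2"
    using var by (intro divide_right_mono) auto
  finally show "prob {\<omega> \<in> space M. x \<le> \<bar>Q \<omega> - E\<bar>} \<le> 2 ^ 21 * real p ^ 3 * c ^ 4 * F\<^sup>2 / x\<^sup>2"
    by (simp add: mult_ac)
qed

end

end

section \<open>The centred sample\<close>

lemma sum_swap4: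
  "(\<Sum>i\<in>A. \<Sum>j\<in>B. \<Sum>k\<in>C. \<Sum>m\<in>D. f i j k m) = (\<Sum>k\<in>C. \<Sum>m\<in>D. \<Sum>i\<in>A. \<Sum>j\<in>B. f i j k m)"
proof -
  have "(\<Sum>i\<in>A. \<Sum>j\<in>B. \<Sum>k\<in>C. \<Sum>m\<in>D. f i j k m) = (\<Sum>i\<in>A. \<Sum>k\<in>C. \<Sum>j\<in>B. \<Sum>m\<in>D. f i j k m)"
    by (rule sum.cong[OF refl], rule sum.swap)
  also have "\<dots> = (\<Sum>k\<in>C. \<Sum>i\<in>A. \<Sum>j\<in>B. \<Sum>m\<in>D. f i j k m)"
    by (rule sum.swap)
  also have "\<dots> = (\<Sum>k\<in>C. \<Sum>i\<in>A. \<Sum>m\<in>D. \<Sum>j\<in>B. f i j k m)"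
    by (rule sum.cong[OF refl], rule sum.cong[OF refl], rule sum.swap)
  also have "\<dots> = (\<Sum>k\<in>C. \<Sum>m\<in>D. \<Sum>i\<in>A. \<Sum>j\<in>B. f i j k m)"
    by (rule sum.cong[OF refl], rule sum.swap)
  finally show ?thesis .
qed

text \<open>A matrix times its transpose and the transpose times the matrix have the same Frobenius
  norm. This exchanges Gram matrices of observations, on which \<open>B_hat\<close> is built, for
  Gram matrices of variables.\<close>

lemma gram_frobenius:
  fixes f :: "nat \<Rightarrow> nat \<Rightarrow> real"
  shows "(\<Sum>k<p. \<Sum>m<p. (\<Sum>a<n. f k a * f m a)\<^sup>2) = (\<Sum>a<n. \<Sum>b<n. (\<Sum>k<p. f k a * f k b)\<^sup>2)"
proof -
  have "(\<Sum>k<p. \<Sum>m<p. (\<Sum>a<n. f k a * f m a)\<^sup>2) = (\<Sum>k<p. \<Sum>m<p. \<Sum>a<n. \<Sum>b<n. f k a * f m a * (f k b * f m b))"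
    by (simp only: power2_eq_square sum_product)
  also have "\<dots> = (\<Sum>a<n. \<Sum>b<n. \<Sum>k<p. \<Sum>m<p. f k a * f m a * (f k b * f m b))"
    by (rule sum_swap4)
  also have "\<dots> = (\<Sum>a<n. \<Sum>b<n. (\<Sum>k<p. f k a * f k b)\<^sup>2)"
    by (intro sum.cong refl) (simp add: power2_eq_square sum_product mult_ac)
  finally show ?thesis .
qed

lemma delta_quadratic_form:
  fixes S :: "nat \<Rightarrow> nat \<Rightarrow> real" and x y :: real
  assumes "i < p" "j < p"
  defines "v \<equiv> \<lambda>k. (if k = i then x else 0) + (if k = j then y else 0)"
  shows "(\<Sum>k<p. \<Sum>m<p. S k m * v k * v m) = S i i * x\<^sup>2 + S i j * x * y + S j i * x * y + S j j * y\<^sup>2"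
proof -
  have d: "(\<Sum>k<p. v k * h k) = x * h i + y * h j" for h :: "nat \<Rightarrow> real"
    using assms by (simp add: v_def distrib_right sum.distrib if_distrib[of "\<lambda>x. x * _"] cong: if_cong)
  have "(\<Sum>k<p. \<Sum>m<p. S k m * v k * v m) = (\<Sum>k<p. v k * (\<Sum>m<p. v m * S k m))"
    by (simp add: sum_distrib_left mult_ac)
  also have "\<dots> = S i i * x\<^sup>2 + S i j * x * y + S j i * x * y + S j j * y\<^sup>2"
    unfolding d by (simp add: algebra_simps power2_eq_square)
  finally show ?thesis .
qed

text \<open>
  \<open>G k\<close> is the centred variable \<open>k\<close> in the eigenbasis of \<open>P\<Psi>P\<close>, and \<open>c\<close> is the constant of (C1).  Below,
  \<open>V\<close> is the Gram matrix of the centred data, \<open>T\<close> its rescaling by the population variances, and \<open>W\<close>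
  the Gram matrix after rotating the variables into the eigenbasis of \<open>S\<close>.
\<close>

locale gauss_sample = prob_space M for M :: "'a measure" +
  fixes p n :: nat and S :: "nat \<Rightarrow> nat \<Rightarrow> real" and l :: "nat \<Rightarrow> real" and G :: "nat \<Rightarrow> nat \<Rightarrow> 'a \<Rightarrow> real"
    and w :: "nat \<Rightarrow> nat \<Rightarrow> real" and s :: "nat \<Rightarrow> real" and c :: real
  assumes ga: "gauss_array M p n S l G"
    and sym: "\<And>i j. i < p \<Longrightarrow> j < p \<Longrightarrow> S i j = S j i"
    and sd: "spectral_decomp p S w s"
    and s_bounds: "\<And>k. k < p \<Longrightarrow> 1 / c \<le> s k \<and> s k \<le> c"
    and c1: "c \<ge> 1"
    and l_le: "\<And>a. a < n \<Longrightarrow> l a \<le> c"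
    and p2: "p \<ge> 2" and n1: "n \<ge> 1"
    and trace_le: "(\<Sum>a<n. l a) \<le> real n" and trace_ge: "real n - c \<le> (\<Sum>a<n. l a)"
    and F_ge: "real n / 4 \<le> (\<Sum>a<n. (l a)\<^sup>2)"
begin

definition "F = (\<Sum>a<n. (l a)\<^sup>2)"
definition "t = (\<Sum>a<n. l a)"
definition "lam = sqrt (ln (real p) / real n)"
definition "\<rho> i j = S i j / sqrt (S i i * S j j)"
definition "V i j \<omega> = (\<Sum>a<n. G i a \<omega> * G j a \<omega>)"
definition "T i j \<omega> = V i j \<omega> / sqrt (S i i * S j j)"
definition "D = {(k, m). k < p \<and> m < p \<and> k \<noteq> m}"

lemma S_diag: assumes "i < p" shows "1 / c \<le> S i i" "S i i \<le> c" "S i i > 0"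
proof -
  have q: "(\<Sum>k<p. \<Sum>m<p. S k m * ((if k = i then 1 else 0) + (if k = i then 0 else 0)) * ((if m = i then 1 else 0) + (if m = i then 0 else 0))) = S i i"
    using delta_quadratic_form[OF assms assms, of S 1 0] by simp
  have v: "(\<Sum>k<p. ((if k = i then 1 else 0) + (if k = i then 0 else 0) :: real)\<^sup>2) = 1"
    using assms by (simp add: if_distrib[of "\<lambda>x. x ^ 2"] cong: if_cong)
  show "1 / c \<le> S i i"
    using spectral_decomp_form_bounds(1)[OF sd, of "1 / c" c "\<lambda>k. (if k = i then 1 else 0) + (if k = i then 0 else 0)"] s_bounds q v by simp
  show "S i i \<le> c"
    using spectral_decomp_form_bounds(2)[OF sd, of "1 / c" c "\<lambda>k. (if k = i then 1 else 0) + (if k = i then 0 else 0)"] s_bounds q v by simp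
  have "1 / c > 0" using c1 by simp
  with \<open>1 / c \<le> S i i\<close> show "S i i > 0" by linarith
qed

text \<open>The form of \<open>S\<close> at \<open>x * e_i + e_j\<close>, minimised over
  \<open>x\<close>, equals the Schur complement \<open>S j j - (S i j)^2 / S i i\<close>, which is
  at least \<open>1 / c\<close>. The square root is then taken through
  \<open>1 - 1 / c^2 \<le> (1 - 1 / (2 * c^2))^2\<close>. This gap keeps sample correlations away
  from 1.\<close>

lemma S_offdiag:
  assumes ij: "i < p" "j < p" "i \<noteq> j"
  shows "\<bar>S i j\<bar> \<le> (1 - 1 / (2 * c\<^sup>2)) * sqrt (S i i * S j j)"
proof -
  note Si = S_diag[OF ij(1)] and Sj = S_diag[OF ij(2)]
  define x where "x = - S i j / S i i"
  let ?v = "\<lambda>k. (if k = i then x else 0) + (if k = j then 1 else 0) :: real"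
  have "1 / c * 1 \<le> 1 / c * (\<Sum>k<p. (?v k)\<^sup>2)"
  proof (rule mult_left_mono)
    have "(?v j)\<^sup>2 \<le> (\<Sum>k<p. (?v k)\<^sup>2)" using ij by (intro member_le_sum) auto
    thus "1 \<le> (\<Sum>k<p. (?v k)\<^sup>2)" using ij by simp
  qed (use c1 in simp)
  also have "\<dots> \<le> (\<Sum>k<p. \<Sum>m<p. S k m * ?v k * ?v m)"
    using spectral_decomp_form_bounds(1)[OF sd, of "1 / c" c ?v] s_bounds by simp
  also have "\<dots> = S i i * x\<^sup>2 + S i j * x + S j i * x + S j j"
    using delta_quadratic_form[OF ij(1,2), of S x 1] by simp
  also have "\<dots> = S j j - (S i j)\<^sup>2 / S i i"
    using Si(3) sym[OF ij(1,2)] by (simp add: x_def field_simps power2_eq_square)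
  finally have "(S i j)\<^sup>2 / S i i \<le> S j j - 1 / c" by simp
  also have "\<dots> \<le> S j j * (1 - 1 / c\<^sup>2)"
  proof -
    have "S j j / c\<^sup>2 \<le> c / c\<^sup>2" using Sj c1 by (intro divide_right_mono) auto
    also have "\<dots> = 1 / c" using c1 by (simp add: power2_eq_square)
    finally show ?thesis by (simp add: algebra_simps)
  qed
  finally have "(S i j)\<^sup>2 \<le> S i i * S j j * (1 - 1 / c\<^sup>2)"
    using Si(3) by (simp add: field_simps)
  also have "\<dots> \<le> S i i * S j j * (1 - 1 / (2 * c\<^sup>2))\<^sup>2"
    using Si Sj by (intro mult_left_mono) (auto simp: power2_eq_square algebra_simps)
  also have "\<dots> = ((1 - 1 / (2 * c\<^sup>2)) * sqrt (S i i * S j j))\<^sup>2"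
    using Si Sj by (simp add: power_mult_distrib)
  finally have "\<bar>S i j\<bar> \<le> \<bar>(1 - 1 / (2 * c\<^sup>2)) * sqrt (S i i * S j j)\<bar>"
    by (simp only: abs_le_square_iff)
  moreover have "(1 - 1 / (2 * c\<^sup>2)) \<ge> 0"
  proof -
    have "1 \<le> c\<^sup>2" using c1 by simp
    hence "1 / (2 * c\<^sup>2) \<le> 1" by (subst pos_divide_le_eq) auto
    thus ?thesis by simp
  qed
  ultimately show ?thesis using Si Sj by (simp add: abs_mult)
qed

lemma rho_bounds:
  assumes "i < p" "j < p"
  shows "\<bar>\<rho> i j\<bar> \<le> 1" "i \<noteq> j \<Longrightarrow> \<bar>\<rho> i j\<bar> \<le> 1 - 1 / (2 * c\<^sup>2)" "i = j \<Longrightarrow> \<rho> i j = 1"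
    "\<bar>S i j\<bar> \<le> sqrt (S i i * S j j)"
proof -
  have pos: "sqrt (S i i * S j j) > 0" using S_diag assms by simp
  show a: "i \<noteq> j \<Longrightarrow> \<bar>\<rho> i j\<bar> \<le> 1 - 1 / (2 * c\<^sup>2)"
    using S_offdiag[OF assms] pos by (simp add: \<rho>_def abs_of_pos pos_divide_le_eq)
  show b: "i = j \<Longrightarrow> \<rho> i j = 1" using S_diag[OF assms(1)] by (simp add: \<rho>_def)
  have nonneg: "1 / (2 * c\<^sup>2) \<ge> 0" by simp
  show "\<bar>\<rho> i j\<bar> \<le> 1"
  proof (cases "i = j")
    case False
    from a[OF this] nonneg show ?thesis by linarith
  qed (use b in simp)
  thus "\<bar>S i j\<bar> \<le> sqrt (S i i * S j j)" using pos by (simp add: \<rho>_def abs_mult field_simps)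
qed

lemma F_bounds: "F \<le> c * real n" "F > 0" "real n / 4 \<le> F"
proof -
  have l0: "\<And>a. a < n \<Longrightarrow> 0 \<le> l a" using gauss_array_nonneg[OF ga] .
  have "F \<le> (\<Sum>a<n. c * l a)" unfolding F_def
    using l0 l_le by (intro sum_mono) (auto simp: power2_eq_square intro!: mult_right_mono)
  also have "\<dots> \<le> c * real n" using trace_le c1 by (simp flip: sum_distrib_left)
  finally show "F \<le> c * real n" .
  show "real n / 4 \<le> F" using F_ge by (simp add: F_def)
  thus "F > 0" using n1 by linarith
qed

lemma ln_p_pos: "ln (real p) > 0" using p2 by simp

lemma lam_pos: "lam > 0" using ln_p_pos n1 by (simp add: lam_def)

lemma lam_squared: "lam\<^sup>2 * real n = ln (real p)"
  using ln_p_pos n1 by (simp add: lam_def)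

lemma V_measurable: "i < p \<Longrightarrow> j < p \<Longrightarrow> V i j \<in> borel_measurable M"
  unfolding V_def by (intro borel_measurable_sum borel_measurable_times gauss_array_measurable[OF ga]) auto

lemma T_measurable: "i < p \<Longrightarrow> j < p \<Longrightarrow> T i j \<in> borel_measurable M"
  unfolding T_def using V_measurable by simp

section \<open>Chernoff bounds for the rescaled sample covariances\<close>

lemma T_tail:
  assumes ij: "i < p" "j < p" and \<theta>: "0 < \<theta>" "\<theta> * c \<le> 1/4"
  shows "prob {\<omega> \<in> space M. x \<le> \<bar>T i j \<omega> - \<rho> i j * t\<bar>}
    \<le> 2 * exp (- \<theta> * x + \<theta>\<^sup>2 * (1 + (\<rho> i j)\<^sup>2) * F / 2 * (1 + 4 * (\<theta> * c)))"
proof -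
  have gp: "gauss_pair M n (\<lambda>a \<omega>. G i a \<omega> / sqrt (S i i)) (\<lambda>a \<omega>. G j a \<omega> / sqrt (S j j)) l (\<rho> i j)"
    unfolding \<rho>_def using S_diag rho_bounds ij sym by (intro gauss_array_pair[OF ga]) auto
  have "(\<Sum>a<n. G i a \<omega> / sqrt (S i i) * (G j a \<omega> / sqrt (S j j))) = T i j \<omega>" for \<omega>
    by (simp add: T_def V_def real_sqrt_mult sum_divide_distrib)
  thus ?thesis using gauss_pair_tail[OF gp l_le \<theta>, of x] by (simp add: t_def F_def)
qed

text \<open>
  With Chernoff parameter \<open>lam\<close> the quadratic term is at most \<open>2 c ln p\<close>, so the deviation constant
  \<open>2 c + 3\<close> leaves \<open>2 / p\<^sup>3\<close> for each pair.
\<close>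

lemma T_uniform_deviation:
  assumes small: "4 * c * lam \<le> 1"
  shows "prob (\<Union>(i, j)\<in>{..<p} \<times> {..<p}. {\<omega> \<in> space M. (2 * c + 3) * real n * lam \<le> \<bar>T i j \<omega> - \<rho> i j * t\<bar>}) \<le> 2 / real p"
proof -
  define E where "E = (\<lambda>(i, j). {\<omega> \<in> space M. (2 * c + 3) * real n * lam \<le> \<bar>T i j \<omega> - \<rho> i j * t\<bar>})"
  have pt: "prob (E d) \<le> 2 / real p ^ 3" if "d \<in> {..<p} \<times> {..<p}" for d
  proof -
    obtain i j where d: "d = (i, j)" "i < p" "j < p" using \<open>d \<in> _\<close> by auto
    have "prob (E d) \<le> 2 * exp (- lam * ((2 * c + 3) * real n * lam) + lam\<^sup>2 * (1 + (\<rho> i j)\<^sup>2) * F / 2 * (1 + 4 * (lam * c)))"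
      unfolding E_def d prod.case using lam_pos small d by (intro T_tail) (auto simp: mult_ac)
    also have "- lam * ((2 * c + 3) * real n * lam) = - (2 * c + 3) * ln (real p)"
      unfolding lam_squared[symmetric] by (simp add: power2_eq_square algebra_simps)
    also have "lam\<^sup>2 * (1 + (\<rho> i j)\<^sup>2) * F / 2 * (1 + 4 * (lam * c)) \<le> lam\<^sup>2 * 2 * (c * real n) / 2 * 2"
    proof (intro mult_mono divide_right_mono)
      show "1 + (\<rho> i j)\<^sup>2 \<le> 2" using rho_bounds(1)[OF d(2,3)] by (simp add: abs_square_le_1)
      show "1 + 4 * (lam * c) \<le> 2" using small by (simp add: mult_ac)
    qed (use F_bounds c1 lam_pos in auto)
    also have "\<dots> = 2 * c * ln (real p)" unfolding lam_squared[symmetric] by simp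
    finally have "prob (E d) \<le> 2 * exp (- 3 * ln (real p))" by (simp add: algebra_simps)
    also have "exp (- 3 * ln (real p)) = 1 / real p ^ 3"
    proof -
      have "exp (- 3 * ln (real p)) = exp (ln (real p)) powr (-3)" by (simp add: powr_def)
      also have "\<dots> = 1 / real p ^ 3" using p2 by (simp add: powr_minus powr_numeral divide_inverse)
      finally show ?thesis .
    qed
    finally show ?thesis by simp
  qed
  have "prob (\<Union>d\<in>{..<p} \<times> {..<p}. E d) \<le> (\<Sum>d\<in>{..<p} \<times> {..<p}. prob (E d))"
  proof (rule measure_UNION_le)
    fix d assume "d \<in> {..<p} \<times> {..<p}"
    then obtain i j where d: "d = (i, j)" "i < p" "j < p" by auto
    have [measurable]: "T i j \<in> borel_measurable M" using T_measurable d by simp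
    show "E d \<in> sets M" unfolding E_def d prod.case by measurable
  qed simp
  also have "\<dots> \<le> (\<Sum>d\<in>{..<p} \<times> {..<p}. 2 / real p ^ 3)" by (intro sum_mono pt)
  also have "\<dots> = 2 / real p" using p2 by (simp add: power3_eq_cube)
  finally show ?thesis by (simp add: E_def)
qed

text \<open>In the exponent, \<open>d^2 / 2\<close> is the ideal rate, \<open>2 * a * d\<close> pays
  for the nonzero mean \<open>\<rho> i j * t\<close>, and \<open>\<kappa> * d^2 / 2\<close> pays for
  the excess of the variance over \<open>F\<close>. The condition \<open>margin\<close> says that at
  least one factor \<open>1 / p\<close> survives.\<close>

lemma T_small_correlation_tail:
  assumes ij: "i < p" "j < p" and \<rho>: "\<bar>\<rho> i j\<bar> \<le> a * lam"
    and d: "d > 0" and small: "8 * d * c * lam \<le> 1" "(1 + (a * lam)\<^sup>2) * (1 + 8 * d * c * lam) \<le> 1 + \<kappa>"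
    and margin: "d\<^sup>2 / 2 - 2 * a * d - \<kappa> * d\<^sup>2 / 2 \<ge> 1" and a: "a \<ge> 0"
  shows "prob {\<omega> \<in> space M. d * sqrt (F * ln (real p)) \<le> \<bar>T i j \<omega>\<bar>} \<le> 2 / real p"
proof -
  define L where "L = sqrt (ln (real p))"
  have L: "L > 0" "L\<^sup>2 = ln (real p)" using ln_p_pos by (auto simp: L_def)
  define f where "f = sqrt F"
  have f: "f > 0" "f\<^sup>2 = F" using F_bounds by (auto simp: f_def)
  have sq: "sqrt (F * ln (real p)) = f * L" by (simp add: f_def L_def real_sqrt_mult)
  \<comment> \<open>Comes from \<open>F \<ge> n / 4\<close> and is the source of the factor 2 in the
    term \<open>2 * a * d\<close>.\<close>
  have nf: "sqrt (real n) \<le> 2 * f"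
  proof (rule real_le_lsqrt)
    show "real n \<le> (2 * f)\<^sup>2" using F_bounds(3) f(2) by (simp add: power_mult_distrib)
  qed (use f in auto)
  have lamL: "lam * sqrt (real n) = L" using n1 ln_p_pos by (simp add: lam_def L_def real_sqrt_divide)
  \<comment> \<open>The optimal Chernoff parameter \<open>x / F\<close> at variance \<open>F\<close>
    and level \<open>x = d * sqrt (F * ln p)\<close>.\<close>
  define \<theta> where "\<theta> = d * L / f"
  have \<theta>: "\<theta> > 0" using d L f by (simp add: \<theta>_def)
  have \<theta>lam: "\<theta> \<le> 2 * d * lam"
  proof -
    have "d * lam * sqrt (real n) \<le> d * lam * (2 * f)" using nf d lam_pos by (intro mult_left_mono) auto
    thus ?thesis using f lamL by (simp add: \<theta>_def field_simps)
  qed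
  have \<theta>c: "\<theta> * c \<le> 2 * d * c * lam" using \<theta>lam c1 mult_right_mono[of \<theta> "2 * d * lam" c] by (simp add: mult_ac)
  have t0: "t \<ge> 0" unfolding t_def using gauss_array_nonneg[OF ga] by (intro sum_nonneg) auto
  have \<rho>t: "\<bar>\<rho> i j * t\<bar> \<le> 2 * a * (f * L)"
  proof -
    have "\<bar>\<rho> i j * t\<bar> = \<bar>\<rho> i j\<bar> * t" using t0 by (simp add: abs_mult)
    also have "\<dots> \<le> (a * lam) * real n" using \<rho> t0 trace_le a lam_pos by (intro mult_mono) (auto simp: t_def)
    also have "\<dots> = a * (lam * sqrt (real n)) * sqrt (real n)" by simp
    also have "\<dots> \<le> a * L * (2 * f)" unfolding lamL using nf a L by (intro mult_left_mono) auto
    finally show ?thesis by (simp add: mult_ac)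
  qed
  define x where "x = (d - 2 * a) * (f * L)"
  have [measurable]: "T i j \<in> borel_measurable M" using T_measurable ij by simp
  have "prob {\<omega> \<in> space M. d * sqrt (F * ln (real p)) \<le> \<bar>T i j \<omega>\<bar>} \<le> prob {\<omega> \<in> space M. x \<le> \<bar>T i j \<omega> - \<rho> i j * t\<bar>}"
  proof (rule finite_measure_mono)
    show "{\<omega> \<in> space M. d * sqrt (F * ln (real p)) \<le> \<bar>T i j \<omega>\<bar>} \<subseteq> {\<omega> \<in> space M. x \<le> \<bar>T i j \<omega> - \<rho> i j * t\<bar>}"
      using \<rho>t unfolding sq x_def left_diff_distrib by (auto simp: mult.assoc)
  qed measurable
  also have "\<dots> \<le> 2 * exp (- \<theta> * x + \<theta>\<^sup>2 * (1 + (\<rho> i j)\<^sup>2) * F / 2 * (1 + 4 * (\<theta> * c)))"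
    using ij \<theta> \<theta>c small by (intro T_tail) auto
  also have "- \<theta> * x = - (d * (d - 2 * a)) * ln (real p)"
    unfolding L(2)[symmetric] using f by (simp add: \<theta>_def x_def power2_eq_square)
  also have "\<theta>\<^sup>2 * (1 + (\<rho> i j)\<^sup>2) * F / 2 * (1 + 4 * (\<theta> * c)) \<le> d\<^sup>2 * ln (real p) / 2 * (1 + \<kappa>)"
  proof -
    have e: "\<theta>\<^sup>2 * F = d\<^sup>2 * ln (real p)"
      unfolding L(2)[symmetric] f(2)[symmetric] using f(1) by (simp add: \<theta>_def power_divide power_mult_distrib)
    have "(\<rho> i j)\<^sup>2 \<le> (a * lam)\<^sup>2" using \<rho> by (metis abs_ge_zero power2_abs power_mono)
    moreover have "1 + 4 * (\<theta> * c) \<le> 1 + 8 * d * c * lam" "0 \<le> 1 + 4 * (\<theta> * c)"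
      using \<theta>c \<theta> c1 by simp_all
    ultimately have "(1 + (\<rho> i j)\<^sup>2) * (1 + 4 * (\<theta> * c)) \<le> (1 + (a * lam)\<^sup>2) * (1 + 8 * d * c * lam)"
      by (intro mult_mono) auto
    also note small(2)
    finally have "d\<^sup>2 * ln (real p) / 2 * ((1 + (\<rho> i j)\<^sup>2) * (1 + 4 * (\<theta> * c))) \<le> d\<^sup>2 * ln (real p) / 2 * (1 + \<kappa>)"
      using ln_p_pos by (intro mult_left_mono) auto
    moreover have "\<theta>\<^sup>2 * (1 + (\<rho> i j)\<^sup>2) * F / 2 * (1 + 4 * (\<theta> * c)) = \<theta>\<^sup>2 * F / 2 * ((1 + (\<rho> i j)\<^sup>2) * (1 + 4 * (\<theta> * c)))"
      by simp
    ultimately show ?thesis unfolding e by (simp only:)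
  qed
  also have "- (d * (d - 2 * a)) * ln (real p) + d\<^sup>2 * ln (real p) / 2 * (1 + \<kappa>) = - (d\<^sup>2 / 2 - 2 * a * d - \<kappa> * d\<^sup>2 / 2) * ln (real p)"
    by (simp add: field_simps power2_eq_square)
  also have "\<dots> \<le> - 1 * ln (real p)" using margin ln_p_pos by (intro mult_right_mono) auto
  also have "exp (- 1 * ln (real p)) = 1 / real p" using p2 by (simp add: exp_minus inverse_eq_divide)
  finally show ?thesis by simp
qed

text \<open>The threshold contains the deterministic \<open>F\<close> in place of the random
  \<open>B_hat\<close>, so that a probability can be attached to every single pair; the data-driven
  threshold is compared with it only on the good event.\<close>

definition false_alarms :: "real \<Rightarrow> real \<Rightarrow> 'a \<Rightarrow> (nat \<times> nat) set" where
  "false_alarms a d \<omega> = {(i, j). i < p \<and> j < p \<and> \<bar>\<rho> i j\<bar> \<le> a * lam \<and> d * sqrt (F * ln (real p)) \<le> \<bar>T i j \<omega>\<bar>}"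

text \<open>Markov's inequality for the count: at most \<open>p^2\<close> pairs, each with
  probability at most \<open>2 / p\<close>, give a mean of at most \<open>2 * p\<close>, without any
  information on the dependence between pairs.\<close>

lemma false_alarms_tail:
  assumes d: "d > 0" and small: "8 * d * c * lam \<le> 1" "(1 + (a * lam)\<^sup>2) * (1 + 8 * d * c * lam) \<le> 1 + \<kappa>"
    and margin: "d\<^sup>2 / 2 - 2 * a * d - \<kappa> * d\<^sup>2 / 2 \<ge> 1" and a: "a \<ge> 0" and N: "N > 0"
  shows "prob {\<omega> \<in> space M. N * real p \<le> real (card (false_alarms a d \<omega>))} \<le> 2 / N"
    and "{\<omega> \<in> space M. N * real p \<le> real (card (false_alarms a d \<omega>))} \<in> sets M"
proof -
  define P where "P = {(i, j). i < p \<and> j < p \<and> \<bar>\<rho> i j\<bar> \<le> a * lam}"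
  have P: "P \<subseteq> {..<p} \<times> {..<p}" "finite P"
  proof -
    show "P \<subseteq> {..<p} \<times> {..<p}" by (auto simp: P_def)
    thus "finite P" by (rule finite_subset) simp
  qed
  define E where "E = (\<lambda>(i, j). {\<omega> \<in> space M. d * sqrt (F * ln (real p)) \<le> \<bar>T i j \<omega>\<bar>})"
  have E[measurable]: "E e \<in> sets M" if e: "e \<in> P" for e
  proof -
    obtain i j where d: "e = (i, j)" "i < p" "j < p" using e by (auto simp: P_def)
    have [measurable]: "T i j \<in> borel_measurable M" using T_measurable d by simp
    show "E e \<in> sets M" unfolding E_def d prod.case by measurable
  qed
  have card: "real (card (false_alarms a d \<omega>)) = (\<Sum>e\<in>P. indicator (E e) \<omega>)" if "\<omega> \<in> space M" for \<omega>
  proof -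
    have "false_alarms a d \<omega> = {e \<in> P. \<omega> \<in> E e}"
      using that by (auto simp: false_alarms_def P_def E_def)
    thus ?thesis using P by (simp add: indicator_def sum.If_cases Int_def)
  qed
  have int: "integrable M (\<lambda>\<omega>. \<Sum>e\<in>P. indicator (E e) \<omega> :: real)"
    using E by (intro Bochner_Integration.integrable_sum) (auto simp: emeasure_eq_measure)
  have eq: "{\<omega> \<in> space M. N * real p \<le> real (card (false_alarms a d \<omega>))} = {\<omega> \<in> space M. N * real p \<le> (\<Sum>e\<in>P. indicator (E e) \<omega>)}"
    using card by auto
  have [measurable]: "(\<lambda>\<omega>. \<Sum>e\<in>P. indicator (E e) \<omega> :: real) \<in> borel_measurable M"
    using int by (rule borel_measurable_integrable)
  show "{\<omega> \<in> space M. N * real p \<le> real (card (false_alarms a d \<omega>))} \<in> sets M"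
    unfolding eq by measurable
  have "prob {\<omega> \<in> space M. N * real p \<le> real (card (false_alarms a d \<omega>))} \<le> expectation (\<lambda>\<omega>. \<Sum>e\<in>P. indicator (E e) \<omega>) / (N * real p)"
    unfolding eq using N p2 by (intro integral_Markov_inequality_measure[OF int, where A="{}"]) (auto intro!: AE_I2 sum_nonneg)
  also have "expectation (\<lambda>\<omega>. \<Sum>e\<in>P. indicator (E e) \<omega>) = (\<Sum>e\<in>P. prob (E e))"
    using E by (subst Bochner_Integration.integral_sum) (auto simp: emeasure_eq_measure sets.Int_space_eq2)
  also have "\<dots> \<le> (\<Sum>e\<in>P. 2 / real p)"
  proof (rule sum_mono)
    fix e assume "e \<in> P"
    then obtain i j where e: "e = (i, j)" "i < p" "j < p" "\<bar>\<rho> i j\<bar> \<le> a * lam" by (auto simp: P_def)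
    show "prob (E e) \<le> 2 / real p" unfolding E_def e(1) prod.case
      by (rule T_small_correlation_tail[OF e(2-4) d small margin a])
  qed
  also have "\<dots> \<le> 2 * real p"
  proof -
    have "real (card P) \<le> real p * real p"
      using card_mono[OF _ P(1)] by (simp flip: of_nat_mult)
    thus ?thesis using p2 by (simp add: field_simps)
  qed
  finally show "prob {\<omega> \<in> space M. N * real p \<le> real (card (false_alarms a d \<omega>))} \<le> 2 / N"
    using p2 N by (simp add: divide_right_mono)
qed

section \<open>The Gram matrix in the eigenbasis of \<open>S\<close>\<close>

definition "W k m \<omega> = (\<Sum>a<n. (\<Sum>i<p. w k i * G i a \<omega>) * (\<Sum>i<p. w m i * G i a \<omega>))"

lemma sum_pairs_split:
  fixes f :: "nat \<Rightarrow> nat \<Rightarrow> real"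
  shows "(\<Sum>k<p. \<Sum>m<p. f k m) = (\<Sum>(k, m)\<in>D. f k m) + (\<Sum>k<p. f k k)"
proof -
  have "(\<Sum>k<p. \<Sum>m<p. f k m) = (\<Sum>(k, m)\<in>{..<p} \<times> {..<p}. f k m)"
    by (simp add: sum.cartesian_product)
  also have "{..<p} \<times> {..<p} = D \<union> (\<lambda>k. (k, k)) ` {..<p}" by (auto simp: D_def)
  also have "(\<Sum>(k, m)\<in>D \<union> (\<lambda>k. (k, k)) ` {..<p}. f k m)
    = (\<Sum>(k, m)\<in>D. f k m) + (\<Sum>(k, m)\<in>(\<lambda>k. (k, k)) ` {..<p}. f k m)"
    by (rule sum.union_disjoint) (auto simp: D_def intro: finite_subset[of _ "{..<p} \<times> {..<p}"])
  also have "(\<Sum>(k, m)\<in>(\<lambda>k. (k, k)) ` {..<p}. f k m) = (\<Sum>k<p. f k k)"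
    by (subst sum.reindex) (auto simp: inj_on_def)
  finally show ?thesis .
qed

text \<open>Each \<open>W k m\<close> is a Gram entry of a white array scaled by
  \<open>sqrt (s k * s m)\<close>. Concentration of the off-diagonal part serves the lower bound for
  \<open>B_hat\<close>; Markov's inequality for the full sum serves the upper one, where
  \<open>p^2 * n\<close> stems from the off-diagonal part, \<open>p * n^2\<close> from the diagonal,
  and \<open>257 = 1 + 256\<close>.\<close>

lemma rotated_rows:
  assumes x: "x > 0" and N: "N > 0"
  defines "E \<equiv> F * (\<Sum>(k, m)\<in>D. s k * s m)"
  shows "prob {\<omega> \<in> space M. x \<le> \<bar>(\<Sum>(k, m)\<in>D. (W k m \<omega>)\<^sup>2) - E\<bar>} \<le> 2 ^ 21 * real p ^ 3 * c ^ 4 * F\<^sup>2 / x\<^sup>2"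
    and "prob {\<omega> \<in> space M. N * (257 * c ^ 4 * (real p ^ 2 * real n + real p * real n ^ 2)) \<le> (\<Sum>k<p. \<Sum>m<p. (W k m \<omega>)\<^sup>2)} \<le> 1 / N"
    and "k < p \<Longrightarrow> m < p \<Longrightarrow> W k m \<in> borel_measurable M"
proof -
  have c0: "c > 0" using c1 by simp
  have s0: "s k > 0" if "k < p" for k
  proof -
    have "1 / c > 0" using c0 by simp
    with s_bounds[OF that] show ?thesis by linarith
  qed
  define H where "H k a \<omega> = (\<Sum>m<p. w k m * G m a \<omega>) / sqrt (s k)" for k a \<omega>
  have gH: "gauss_array M p n (\<lambda>k m. of_bool (k = m)) l H"
    unfolding H_def by (rule gauss_array_rotate_rows[OF ga sd s0])
  have Fp: "(\<Sum>a<n. (l a)\<^sup>2) > 0" using F_bounds(2) by (simp add: F_def)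
  note wa = white_array_weighted_sum[OF gH Fp, of s c]
  have WH: "(W k m \<omega>)\<^sup>2 = s k * s m * (\<Sum>a<n. H k a \<omega> * H m a \<omega>)\<^sup>2" if "k < p" "m < p" for k m \<omega>
  proof -
    have "(\<Sum>a<n. H k a \<omega> * H m a \<omega>) = W k m \<omega> / (sqrt (s k) * sqrt (s m))"
      by (simp add: H_def W_def times_divide_times_eq flip: sum_divide_distrib)
    thus ?thesis using s0[OF that(1)] s0[OF that(2)] by (simp add: power_divide power_mult_distrib)
  qed
  have sb: "0 \<le> s k \<and> s k \<le> c" if "k < p" for k using s_bounds[OF that] s0[OF that] by simp
  have Q: "(\<Sum>(k, m)\<in>D. (W k m \<omega>)\<^sup>2) = (\<Sum>(k, m)\<in>D. s k * s m * (\<Sum>a<n. H k a \<omega> * H m a \<omega>)\<^sup>2)" for \<omega>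
    by (intro sum.cong refl) (auto simp: D_def WH)
  show "prob {\<omega> \<in> space M. x \<le> \<bar>(\<Sum>(k, m)\<in>D. (W k m \<omega>)\<^sup>2) - E\<bar>} \<le> 2 ^ 21 * real p ^ 3 * c ^ 4 * F\<^sup>2 / x\<^sup>2"
    using wa(3)[OF sb x] unfolding Q unfolding E_def F_def D_def by simp
  have eQ: "expectation (\<lambda>\<omega>. \<Sum>(k, m)\<in>D. (W k m \<omega>)\<^sup>2) = E" "integrable M (\<lambda>\<omega>. \<Sum>(k, m)\<in>D. (W k m \<omega>)\<^sup>2)"
    using wa(1,2)[OF sb] unfolding Q unfolding E_def F_def D_def by simp_all
  have W_diag: "integrable M (\<lambda>\<omega>. (W k k \<omega>)\<^sup>2)" "expectation (\<lambda>\<omega>. (W k k \<omega>)\<^sup>2) \<le> 256 * c ^ 4 * real n ^ 2" if k: "k < p" for k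
  proof -
    note m2 = gauss_pair_self_moment2[OF white_array_pair_self[OF gH Fp k] l_le c0, of ]
    have n0: "n > 0" using n1 by simp
    have WHk: "(W k k \<omega>)\<^sup>2 = (s k)\<^sup>2 * (\<Sum>a<n. H k a \<omega> * H k a \<omega>)\<^sup>2" for \<omega>
      using WH[OF k k] by (simp add: power2_eq_square)
    show "integrable M (\<lambda>\<omega>. (W k k \<omega>)\<^sup>2)" unfolding WHk using m2(1) n0 by simp
    have "expectation (\<lambda>\<omega>. (W k k \<omega>)\<^sup>2) = (s k)\<^sup>2 * expectation (\<lambda>\<omega>. (\<Sum>a<n. H k a \<omega> * H k a \<omega>)\<^sup>2)"
      unfolding WHk by simp
    also have "\<dots> \<le> c\<^sup>2 * (256 * (real n * c)\<^sup>2)"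
      using m2(2) n0 sb[OF k] by (intro mult_mono power_mono) (auto intro!: integral_nonneg_AE)
    also have "\<dots> = 256 * c ^ 4 * real n ^ 2" by (simp add: power_mult_distrib power4_eq_xxxx power2_eq_square)
    finally show "expectation (\<lambda>\<omega>. (W k k \<omega>)\<^sup>2) \<le> 256 * c ^ 4 * real n ^ 2" .
  qed
  note split = sum_pairs_split[of "\<lambda>k m. (W k m _)\<^sup>2"]
  have int: "integrable M (\<lambda>\<omega>. \<Sum>k<p. \<Sum>m<p. (W k m \<omega>)\<^sup>2)"
    unfolding split using W_diag(1)
    by (intro Bochner_Integration.integrable_add eQ(2) Bochner_Integration.integrable_sum[where I="{..<p}"]) auto
  have "expectation (\<lambda>\<omega>. \<Sum>k<p. \<Sum>m<p. (W k m \<omega>)\<^sup>2) = E + (\<Sum>k<p. expectation (\<lambda>\<omega>. (W k k \<omega>)\<^sup>2))"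
    unfolding split using eQ W_diag(1) by (subst Bochner_Integration.integral_add) auto
  also have "\<dots> \<le> c * real n * (c\<^sup>2 * real p ^ 2) + (\<Sum>k<p. 256 * c ^ 4 * real n ^ 2)"
  proof (rule add_mono)
    have "(\<Sum>(k, m)\<in>D. s k * s m) \<le> (\<Sum>(k, m)\<in>D. c * c)"
      using sb c0 by (intro sum_mono) (auto simp: D_def intro!: mult_mono)
    also have "\<dots> = real (card D) * c\<^sup>2" by (simp add: power2_eq_square case_prod_beta')
    also have "\<dots> \<le> real p ^ 2 * c\<^sup>2"
    proof (rule mult_right_mono)
      have "card D \<le> card ({..<p} \<times> {..<p})" by (rule card_mono) (auto simp: D_def)
      thus "real (card D) \<le> real p ^ 2" by (simp add: power2_eq_square flip: of_nat_mult)
    qed simp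
    finally show "E \<le> c * real n * (c\<^sup>2 * real p ^ 2)" unfolding E_def
      using F_bounds c0 sb by (intro mult_mono) (auto simp: mult_ac D_def intro!: sum_nonneg)
    show "(\<Sum>k<p. expectation (\<lambda>\<omega>. (W k k \<omega>)\<^sup>2)) \<le> (\<Sum>k<p. 256 * c ^ 4 * real n ^ 2)"
      using W_diag by (intro sum_mono) auto
  qed
  also have "\<dots> \<le> 257 * c ^ 4 * (real p ^ 2 * real n + real p * real n ^ 2)"
  proof -
    define A where "A = c ^ 4 * (real n * real p ^ 2)"
    define B where "B = c ^ 4 * (real p * real n ^ 2)"
    have AB: "A \<ge> 0" "B \<ge> 0" using c0 by (simp_all add: A_def B_def)
    have "c ^ 3 \<le> c ^ 4" using c1 by (intro power_increasing) auto
    hence "c ^ 3 * (real n * real p ^ 2) \<le> A" unfolding A_def by (intro mult_right_mono) auto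
    moreover have "c * real n * (c\<^sup>2 * real p ^ 2) = c ^ 3 * (real n * real p ^ 2)"
      by (simp add: power2_eq_square power3_eq_cube)
    moreover have "(\<Sum>k<p. 256 * c ^ 4 * real n ^ 2) = 256 * B" by (simp add: B_def)
    moreover have "257 * c ^ 4 * (real p ^ 2 * real n + real p * real n ^ 2) = 257 * A + 257 * B"
      by (simp add: A_def B_def algebra_simps)
    ultimately show ?thesis using AB by linarith
  qed
  finally have bound: "expectation (\<lambda>\<omega>. \<Sum>k<p. \<Sum>m<p. (W k m \<omega>)\<^sup>2) \<le> 257 * c ^ 4 * (real p ^ 2 * real n + real p * real n ^ 2)" .
  define b where "b = 257 * c ^ 4 * (real p ^ 2 * real n + real p * real n ^ 2)"
  have b: "b > 0" using c0 p2 n1 by (auto simp: b_def intro!: mult_pos_pos add_pos_pos)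
  have "prob {\<omega> \<in> space M. N * b \<le> (\<Sum>k<p. \<Sum>m<p. (W k m \<omega>)\<^sup>2)} \<le> expectation (\<lambda>\<omega>. \<Sum>k<p. \<Sum>m<p. (W k m \<omega>)\<^sup>2) / (N * b)"
    using N b by (intro integral_Markov_inequality_measure[OF int, where A="{}"]) (auto intro!: AE_I2 sum_nonneg)
  also have "\<dots> \<le> b / (N * b)" using bound N b by (intro divide_right_mono) (auto simp: b_def)
  also have "b / (N * b) = 1 / N" using b by simp
  finally show "prob {\<omega> \<in> space M. N * (257 * c ^ 4 * (real p ^ 2 * real n + real p * real n ^ 2)) \<le> (\<Sum>k<p. \<Sum>m<p. (W k m \<omega>)\<^sup>2)} \<le> 1 / N"
    unfolding b_def .
  show "k < p \<Longrightarrow> m < p \<Longrightarrow> W k m \<in> borel_measurable M"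
    unfolding W_def by (intro borel_measurable_sum borel_measurable_times borel_measurable_const gauss_array_measurable[OF ga]) auto
qed

text \<open>Trace and Frobenius norm are orthogonally invariant. For the latter,
  \<open>gram_frobenius\<close> moves to sums over the variables, where Parseval applies, and
  back.\<close>

lemma V_rotated: "(\<Sum>k<p. W k k \<omega>) = (\<Sum>k<p. V k k \<omega>)" "(\<Sum>k<p. \<Sum>m<p. (W k m \<omega>)\<^sup>2) = (\<Sum>k<p. \<Sum>m<p. (V k m \<omega>)\<^sup>2)"
proof -
  have "(\<Sum>k<p. W k k \<omega>) = (\<Sum>a<n. \<Sum>k<p. (\<Sum>i<p. w k i * G i a \<omega>) * (\<Sum>i<p. w k i * G i a \<omega>))"
    unfolding W_def by (rule sum.swap)
  also have "\<dots> = (\<Sum>a<n. \<Sum>k<p. G k a \<omega> * G k a \<omega>)"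
    by (simp only: spectral_decomp_parseval[OF sd])
  also have "\<dots> = (\<Sum>k<p. V k k \<omega>)" unfolding V_def by (rule sum.swap)
  finally show "(\<Sum>k<p. W k k \<omega>) = (\<Sum>k<p. V k k \<omega>)" .
  have "(\<Sum>k<p. \<Sum>m<p. (W k m \<omega>)\<^sup>2) = (\<Sum>a<n. \<Sum>b<n. (\<Sum>k<p. (\<Sum>i<p. w k i * G i a \<omega>) * (\<Sum>i<p. w k i * G i b \<omega>))\<^sup>2)"
    unfolding W_def by (rule gram_frobenius)
  also have "\<dots> = (\<Sum>k<p. \<Sum>m<p. (V k m \<omega>)\<^sup>2)"
    unfolding spectral_decomp_parseval[OF sd] V_def by (rule gram_frobenius[symmetric])
  finally show "(\<Sum>k<p. \<Sum>m<p. (W k m \<omega>)\<^sup>2) = (\<Sum>k<p. \<Sum>m<p. (V k m \<omega>)\<^sup>2)" .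
qed

end

section \<open>Consequences on the good event\<close>

context gauss_sample
begin

text \<open>The first clause controls every entry of the sample covariance, the second the number of
  wrongly kept pairs; the third bounds \<open>B_hat\<close> from below and the fourth from
  above.\<close>

definition good :: "real \<Rightarrow> real \<Rightarrow> real \<Rightarrow> real \<Rightarrow> 'a \<Rightarrow> bool" where
  "good a d \<eta> N \<omega> \<longleftrightarrow>
     (\<forall>i<p. \<forall>j<p. \<bar>T i j \<omega> - \<rho> i j * t\<bar> < (2 * c + 3) * real n * lam) \<and>
     real (card (false_alarms a d \<omega>)) < N * real p \<and>
     (1 - \<eta>) * (F * (\<Sum>(k, m)\<in>D. s k * s m)) < (\<Sum>(k, m)\<in>D. (W k m \<omega>)\<^sup>2) \<and>
     (\<Sum>k<p. \<Sum>m<p. (V k m \<omega>)\<^sup>2) < N * (257 * c ^ 4 * (real p ^ 2 * real n + real p * real n ^ 2))"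

lemma s_nonneg: "k < p \<Longrightarrow> 0 \<le> s k"
proof -
  assume "k < p"
  moreover have "0 \<le> 1 / c" using c1 by simp
  ultimately show "0 \<le> s k" using s_bounds[of k] by linarith
qed

lemma weight_sum_ge: "real p ^ 2 / (2 * c\<^sup>2) \<le> (\<Sum>(k, m)\<in>D. s k * s m)"
proof -
  have c0: "c > 0" using c1 by simp
  have D: "finite D" "card D = p * p - p"
  proof -
    have "D = {..<p} \<times> {..<p} - (\<lambda>k. (k, k)) ` {..<p}" by (auto simp: D_def)
    moreover have "card ((\<lambda>k. (k, k)) ` {..<p}) = p" by (simp add: card_image inj_on_def)
    moreover have "(\<lambda>k. (k, k)) ` {..<p} \<subseteq> {..<p} \<times> {..<p}" by auto
    ultimately show "finite D" "card D = p * p - p" by (simp_all add: card_Diff_subset)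
  qed
  have "real p ^ 2 / (2 * c\<^sup>2) \<le> real (card D) * (1 / c * (1 / c))"
  proof -
    have "p \<le> p * p" by (cases p) auto
    hence "real (card D) = real p * real p - real p" unfolding D(2) by (simp add: of_nat_diff)
    moreover have "2 * real p \<le> real p * real p" using p2 by (intro mult_right_mono) auto
    ultimately have "real p ^ 2 / 2 \<le> real (card D)" by (simp add: power2_eq_square)
    hence "real p ^ 2 / 2 * (1 / c * (1 / c)) \<le> real (card D) * (1 / c * (1 / c))"
      using c0 by (intro mult_right_mono) auto
    thus ?thesis by (simp add: power2_eq_square)
  qed
  also have "\<dots> = (\<Sum>(k, m)\<in>D. 1 / c * (1 / c))" by (simp add: case_prod_beta')
  also have "\<dots> \<le> (\<Sum>(k, m)\<in>D. s k * s m)"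
  proof (rule sum_mono, clarify)
    fix k m assume "(k, m) \<in> D"
    hence km: "k < p" "m < p" by (auto simp: D_def)
    have "0 \<le> 1 / c" using c0 by simp
    with s_bounds[OF km(1)] s_bounds[OF km(2)] s_nonneg km show "1 / c * (1 / c) \<le> s k * s m"
      by (intro mult_mono) auto
  qed
  finally show ?thesis .
qed

text \<open>A union bound over the four failures. The Chebyshev term uses that \<open>E\<close> is
  at least \<open>F * p^2 / (2 * c^2)\<close>, which turns \<open>2 ^ 21 * c ^ 4\<close> into
  \<open>2 ^ 23 * c ^ 8\<close>; the two Markov bounds add up to \<open>3 / N\<close>.\<close>

lemma good_event:
  assumes \<eta>: "\<eta> > 0" and N: "N > 0"
    and dev_small: "4 * c * lam \<le> 1"
    and d: "d > 0" and small: "8 * d * c * lam \<le> 1" "(1 + (a * lam)\<^sup>2) * (1 + 8 * d * c * lam) \<le> 1 + \<kappa>"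
    and margin: "d\<^sup>2 / 2 - 2 * a * d - \<kappa> * d\<^sup>2 / 2 \<ge> 1" and a: "a \<ge> 0"
  shows "\<exists>A\<in>sets M. prob A \<ge> 1 - (2 / real p + 2 ^ 23 * c ^ 8 / (\<eta>\<^sup>2 * real p) + 3 / N) \<and> (\<forall>\<omega>\<in>A. \<omega> \<in> space M \<and> good a d \<eta> N \<omega>)"
proof -
  have c0: "c > 0" using c1 by simp
  define E where "E = F * (\<Sum>(k, m)\<in>D. s k * s m)"
  have "real p ^ 2 / (2 * c\<^sup>2) > 0" using p2 c0 by simp
  hence E: "E > 0" "F * (real p ^ 2 / (2 * c\<^sup>2)) \<le> E"
    unfolding E_def using weight_sum_ge F_bounds(2) by (intro mult_pos_pos mult_left_mono; linarith)+
  define B1 where "B1 = (\<Union>(i, j)\<in>{..<p} \<times> {..<p}. {\<omega> \<in> space M. (2 * c + 3) * real n * lam \<le> \<bar>T i j \<omega> - \<rho> i j * t\<bar>})"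
  define B2 where "B2 = {\<omega> \<in> space M. N * real p \<le> real (card (false_alarms a d \<omega>))}"
  define B3 where "B3 = {\<omega> \<in> space M. \<eta> * E \<le> \<bar>(\<Sum>(k, m)\<in>D. (W k m \<omega>)\<^sup>2) - E\<bar>}"
  define B4 where "B4 = {\<omega> \<in> space M. N * (257 * c ^ 4 * (real p ^ 2 * real n + real p * real n ^ 2)) \<le> (\<Sum>k<p. \<Sum>m<p. (W k m \<omega>)\<^sup>2)}"
  have Wm: "W k m \<in> borel_measurable M" if "k < p" "m < p" for k m
    using rotated_rows(3)[of 1 1] that by simp
  have [measurable]: "B1 \<in> sets M"
  proof -
    have "{\<omega> \<in> space M. (2 * c + 3) * real n * lam \<le> \<bar>T i j \<omega> - \<rho> i j * t\<bar>} \<in> sets M" if "i < p" "j < p" for i j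
    proof -
      have [measurable]: "T i j \<in> borel_measurable M" using T_measurable that by simp
      show ?thesis by measurable
    qed
    thus ?thesis unfolding B1_def by (intro sets.finite_UN) auto
  qed
  have [measurable]: "B2 \<in> sets M" unfolding B2_def by (rule false_alarms_tail(2)[OF d small margin a N])
  have [measurable]: "(\<lambda>\<omega>. \<Sum>(k, m)\<in>D. (W k m \<omega>)\<^sup>2) \<in> borel_measurable M"
    unfolding case_prod_beta' using Wm by (intro borel_measurable_sum borel_measurable_power) (auto simp: D_def)
  have [measurable]: "B3 \<in> sets M" unfolding B3_def by measurable
  have [measurable]: "(\<lambda>\<omega>. \<Sum>k<p. \<Sum>m<p. (W k m \<omega>)\<^sup>2) \<in> borel_measurable M"
    using Wm by (intro borel_measurable_sum borel_measurable_power) auto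
  have [measurable]: "B4 \<in> sets M" unfolding B4_def by measurable
  have P1: "prob B1 \<le> 2 / real p" unfolding B1_def by (rule T_uniform_deviation[OF dev_small])
  have P2: "prob B2 \<le> 2 / N" unfolding B2_def by (rule false_alarms_tail(1)[OF d small margin a N])
  have P3: "prob B3 \<le> 2 ^ 23 * c ^ 8 / (\<eta>\<^sup>2 * real p)"
  proof -
    have "prob B3 \<le> 2 ^ 21 * real p ^ 3 * c ^ 4 * F\<^sup>2 / (\<eta> * E)\<^sup>2"
      unfolding B3_def E_def using \<eta> E N by (intro rotated_rows(1)[where N=1]) (auto simp: E_def)
    also have "\<dots> \<le> 2 ^ 21 * real p ^ 3 * c ^ 4 * F\<^sup>2 / (\<eta> * (F * (real p ^ 2 / (2 * c\<^sup>2))))\<^sup>2"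
      using \<eta> E F_bounds(2) p2 c0 by (intro divide_left_mono power_mono mult_left_mono mult_pos_pos zero_less_power) auto
    also have "\<dots> = 2 ^ 23 * c ^ 8 / (\<eta>\<^sup>2 * real p)"
      using \<eta> F_bounds(2) p2 c0 by (simp add: power_mult_distrib power_divide field_simps flip: power_mult)
        (simp add: power_numeral_reduce)
    finally show ?thesis .
  qed
  have P4: "prob B4 \<le> 1 / N" unfolding B4_def by (rule rotated_rows(2)[of 1]) (use N in auto)
  define A where "A = space M - (B1 \<union> B2 \<union> B3 \<union> B4)"
  have A: "A \<in> sets M" unfolding A_def by measurable
  have "prob A = 1 - prob (B1 \<union> B2 \<union> B3 \<union> B4)"
    unfolding A_def by (intro prob_compl) measurable
  moreover have "prob (B1 \<union> B2 \<union> B3 \<union> B4) \<le> prob B1 + prob B2 + prob B3 + prob B4"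
  proof -
    have "prob (B1 \<union> B2 \<union> B3 \<union> B4) \<le> prob (B1 \<union> B2 \<union> B3) + prob B4" by (intro measure_Un_le) measurable
    also have "prob (B1 \<union> B2 \<union> B3) \<le> prob (B1 \<union> B2) + prob B3" by (intro measure_Un_le) measurable
    also have "prob (B1 \<union> B2) \<le> prob B1 + prob B2" by (intro measure_Un_le) measurable
    finally show ?thesis by simp
  qed
  moreover have "2 / N + 1 / N = 3 / N" by (simp add: add_divide_distrib[symmetric])
  ultimately have "prob A \<ge> 1 - (2 / real p + 2 ^ 23 * c ^ 8 / (\<eta>\<^sup>2 * real p) + 3 / N)"
    using P1 P2 P3 P4 by linarith
  moreover have "\<omega> \<in> space M \<and> good a d \<eta> N \<omega>" if "\<omega> \<in> A" for \<omega>
  proof -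
    have "(1 - \<eta>) * E < (\<Sum>(k, m)\<in>D. (W k m \<omega>)\<^sup>2)"
      using that by (auto simp: A_def B3_def algebra_simps abs_if split: if_splits)
    moreover have "\<forall>i<p. \<forall>j<p. \<bar>T i j \<omega> - \<rho> i j * t\<bar> < (2 * c + 3) * real n * lam"
    proof (intro allI impI)
      fix i j assume ij: "i < p" "j < p"
      have "\<omega> \<notin> B1" "\<omega> \<in> space M" using that by (auto simp: A_def)
      thus "\<bar>T i j \<omega> - \<rho> i j * t\<bar> < (2 * c + 3) * real n * lam"
        unfolding B1_def using ij by (force simp: not_le)
    qed
    moreover have "real (card (false_alarms a d \<omega>)) < N * real p"
      using that by (auto simp: A_def B2_def)
    moreover have "(\<Sum>k<p. \<Sum>m<p. (V k m \<omega>)\<^sup>2) < N * (257 * c ^ 4 * (real p ^ 2 * real n + real p * real n ^ 2))"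
      using that by (auto simp: A_def B4_def V_rotated(2))
    ultimately show ?thesis using that by (auto simp: good_def E_def A_def)
  qed
  ultimately show ?thesis using A by blast
qed

text \<open>\<open>sh\<close>, \<open>rh\<close> and \<open>Bh\<close> are \<open>sigma_hat\<close>, \<open>rho_hat\<close> and \<open>B_hat\<close> in terms of \<open>V\<close>, as long as \<open>R > 0\<close>.\<close>

definition "sh i j \<omega> = V i j \<omega> / (real n - 1)"
definition "rh i j \<omega> = sh i j \<omega> / sqrt (sh i i \<omega> * sh j j \<omega>)"
definition "R \<omega> = (\<Sum>k<p. V k k \<omega>)"
definition "Bh \<omega> = ((real n - 1)\<^sup>2 * (\<Sum>k<p. \<Sum>m<p. (V k m \<omega>)\<^sup>2) / (R \<omega>)\<^sup>2 - (real n - 1)\<^sup>2 / real p) / real n"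
definition "keep \<delta> i j \<omega> \<longleftrightarrow> \<bar>rh i j \<omega>\<bar> / (1 - (rh i j \<omega>)\<^sup>2) \<ge> \<delta> * sqrt (Bh \<omega> * ln (real p) / real n)"

text \<open>
  \<open>6 c + 6 = 2 (2 c + 3 + c)\<close> accounts for the deviation \<open>(2 c + 3) n lam\<close> and for the defect \<open>c\<close> of the
  trace, both divided by \<open>n - 1 \<ge> n / 2\<close>.
\<close>

definition "err = (6 * c + 6) * lam"

section \<open>Deterministic bounds at one outcome of the good event\<close>

context
  fixes a d \<eta> N \<delta> r \<omega>
  assumes good: "good a d \<eta> N \<omega>"
    and n2: "n \<ge> 2" and h1: "1 \<le> real n * lam" and h4: "4 * c\<^sup>2 * ((6 * c + 6) * lam) < 1"
    and \<eta>: "0 < \<eta>" "\<eta> < 1" and N: "N > 0" and a: "a > 0" and \<delta>: "\<delta> > 0"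
    and hp: "c ^ 4 / real p \<le> 1"
    and h3: "d \<le> (1 - 4 * (a + (6 * c + 6))\<^sup>2 * lam\<^sup>2) * (1 - (6 * c + 6) * lam) * ((real n - 1) / real n)
        * (\<delta> * sqrt ((1 - \<eta>) * (1 - c ^ 4 / real p)) / (1 + (6 * c + 6) * lam))"
    and h5: "4 * (a + (6 * c + 6))\<^sup>2 * lam\<^sup>2 \<le> 1"
    and r: "real n \<le> r * real p"
begin

lemma err_bounds: "0 < err" "err < 1 / 4" "4 * c\<^sup>2 * err < 1"
proof -
  show "0 < err" using c1 lam_pos by (simp add: err_def)
  show "4 * c\<^sup>2 * err < 1" using h4 by (simp add: err_def)
  have "1 \<le> c\<^sup>2" using c1 by simp
  hence "1 * err \<le> c\<^sup>2 * err" using \<open>0 < err\<close> by (intro mult_right_mono) auto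
  with \<open>4 * c\<^sup>2 * err < 1\<close> show "err < 1 / 4" by linarith
qed

lemma n1_pos: "real n - 1 > 0" using n2 by simp

text \<open>The sample covariance in units of the population standard deviations, hence an estimate
  of \<open>\<rho> i j\<close>.\<close>

definition "\<xi> i j = T i j \<omega> / (real n - 1)"

lemma \<xi>_dev: assumes "i < p" "j < p" shows "\<bar>\<xi> i j - \<rho> i j\<bar> \<le> err"
proof -
  have n_le: "real n \<le> 2 * (real n - 1)" using n2 by simp
  have "\<bar>T i j \<omega> - \<rho> i j * t\<bar> \<le> (2 * c + 3) * (real n * lam)"
    using good assms by (auto simp: good_def mult_ac intro: less_imp_le)
  moreover have "\<bar>\<rho> i j * t - \<rho> i j * (real n - 1)\<bar> \<le> c * (real n * lam)"
  proof -
    have "\<bar>\<rho> i j * t - \<rho> i j * (real n - 1)\<bar> = \<bar>\<rho> i j\<bar> * \<bar>t - (real n - 1)\<bar>"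
      by (simp flip: abs_mult right_diff_distrib)
    also have "\<dots> \<le> 1 * c"
      using rho_bounds(1)[OF assms] trace_le trace_ge c1 by (intro mult_mono) (auto simp: t_def)
    \<comment> \<open>The defect of the trace is bounded by a constant;
      \<open>1 \<le> real n * lam\<close> raises it to the scale of the random deviation.\<close>
    also have "\<dots> \<le> c * (real n * lam)" using h1 c1 by simp
    finally show ?thesis .
  qed
  ultimately have "\<bar>T i j \<omega> - \<rho> i j * (real n - 1)\<bar> \<le> (3 * c + 3) * (real n * lam)"
    by (simp add: algebra_simps abs_le_iff)
  also have "\<dots> \<le> (3 * c + 3) * (2 * (real n - 1) * lam)"
    using n_le lam_pos c1 by (intro mult_left_mono mult_right_mono) auto
  also have "\<dots> = err * (real n - 1)" by (simp add: err_def algebra_simps)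
  finally have "\<bar>T i j \<omega> - \<rho> i j * (real n - 1)\<bar> / (real n - 1) \<le> err"
    using n1_pos by (simp add: pos_divide_le_eq)
  moreover have "\<xi> i j - \<rho> i j = (T i j \<omega> - \<rho> i j * (real n - 1)) / (real n - 1)"
    using n1_pos by (simp add: \<xi>_def field_simps)
  ultimately show ?thesis using n1_pos by (simp add: abs_divide)
qed

lemma \<xi>_diag: assumes "i < p" shows "1 - err \<le> \<xi> i i" "\<xi> i i \<le> 1 + err" "\<xi> i i > 0"
  using \<xi>_dev[OF assms assms] rho_bounds(3)[OF assms assms refl] err_bounds by (auto simp: abs_le_iff)

lemma sh_eq: assumes "i < p" "j < p" shows "sh i j \<omega> = \<xi> i j * sqrt (S i i * S j j)"
  using S_diag[OF assms(1)] S_diag[OF assms(2)] by (simp add: sh_def \<xi>_def T_def)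

lemma sqrt_S_le: assumes "i < p" "j < p" shows "sqrt (S i i * S j j) \<le> c" "sqrt (S i i * S j j) > 0"
proof -
  have "S i i * S j j \<le> c\<^sup>2" unfolding power2_eq_square
    using S_diag[OF assms(1)] S_diag[OF assms(2)] c1 by (intro mult_mono) auto
  thus "sqrt (S i i * S j j) \<le> c" using c1 by (intro real_le_lsqrt) auto
  show "sqrt (S i i * S j j) > 0" using S_diag assms by simp
qed

lemma sh_dev: assumes "i < p" "j < p" shows "\<bar>sh i j \<omega> - S i j\<bar> \<le> c * err"
proof -
  have "S i j = sqrt (S i i * S j j) * \<rho> i j"
  proof -
    have "x = q * (x / q)" if "q > 0" for x q :: real using that by simp
    from this[OF sqrt_S_le(2)[OF assms]] show ?thesis unfolding \<rho>_def .
  qed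
  hence "sh i j \<omega> - S i j = sqrt (S i i * S j j) * (\<xi> i j - \<rho> i j)"
    unfolding sh_eq[OF assms] right_diff_distrib by (simp only: mult.commute)
  hence "\<bar>sh i j \<omega> - S i j\<bar> = sqrt (S i i * S j j) * \<bar>\<xi> i j - \<rho> i j\<bar>"
    using sqrt_S_le[OF assms] by (simp add: abs_mult)
  also have "\<dots> \<le> c * err" using sqrt_S_le[OF assms] \<xi>_dev[OF assms] c1 by (intro mult_mono) auto
  finally show ?thesis .
qed

lemma rh_eq:
  assumes "i < p" "j < p"
  shows "rh i j \<omega> = \<xi> i j / sqrt (\<xi> i i * \<xi> j j)" "1 - err \<le> sqrt (\<xi> i i * \<xi> j j)" "sqrt (\<xi> i i * \<xi> j j) \<le> 1 + err"
proof -
  have "sh i i \<omega> * sh j j \<omega> = (\<xi> i i * \<xi> j j) * (S i i * S j j)"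
    using S_diag[OF assms(1)] S_diag[OF assms(2)] by (simp add: sh_eq assms)
  hence "sqrt (sh i i \<omega> * sh j j \<omega>) = sqrt (\<xi> i i * \<xi> j j) * sqrt (S i i * S j j)"
    by (simp only: real_sqrt_mult[of "\<xi> i i * \<xi> j j"])
  moreover have "x * q / (y * q) = x / y" if "q > 0" for x y q :: real using that by simp
  note this[OF sqrt_S_le(2)[OF assms]]
  ultimately show "rh i j \<omega> = \<xi> i j / sqrt (\<xi> i i * \<xi> j j)"
    unfolding rh_def sh_eq[OF assms] by (simp only:)
  have "(1 - err)\<^sup>2 \<le> \<xi> i i * \<xi> j j" unfolding power2_eq_square
    using \<xi>_diag[OF assms(1)] \<xi>_diag[OF assms(2)] err_bounds by (intro mult_mono) auto
  thus "1 - err \<le> sqrt (\<xi> i i * \<xi> j j)" by (rule real_le_rsqrt)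
  have "\<xi> i i * \<xi> j j \<le> (1 + err)\<^sup>2" unfolding power2_eq_square
    using \<xi>_diag[OF assms(1)] \<xi>_diag[OF assms(2)] err_bounds by (intro mult_mono) auto
  thus "sqrt (\<xi> i i * \<xi> j j) \<le> 1 + err" using err_bounds by (intro real_le_lsqrt) auto
qed

lemma rh_le: assumes "i < p" "j < p" shows "\<bar>rh i j \<omega>\<bar> \<le> (\<bar>\<rho> i j\<bar> + err) / (1 - err)"
proof -
  have pos: "sqrt (\<xi> i i * \<xi> j j) > 0" using rh_eq(2)[OF assms] err_bounds by linarith
  have "\<bar>rh i j \<omega>\<bar> = \<bar>\<xi> i j\<bar> / sqrt (\<xi> i i * \<xi> j j)" using pos by (simp add: rh_eq(1)[OF assms])
  also have "\<dots> \<le> (\<bar>\<rho> i j\<bar> + err) / (1 - err)"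
    using \<xi>_dev[OF assms] rh_eq(2)[OF assms] err_bounds by (intro frac_le) auto
  finally show ?thesis .
qed

text \<open>The assumption \<open>4 * c^2 * err < 1\<close> makes \<open>2 * err\<close> smaller
  than the gap \<open>1 / (2 * c^2)\<close> between the population correlations and 1. The quotient
  in the thresholding rule thus has a positive denominator.\<close>

lemma rh_less_1: assumes "i < p" "j < p" "i \<noteq> j" shows "(rh i j \<omega>)\<^sup>2 < 1"
proof -
  have "\<bar>rh i j \<omega>\<bar> \<le> (\<bar>\<rho> i j\<bar> + err) / (1 - err)" using rh_le assms by simp
  also have "\<dots> < 1"
  proof -
    have "2 * err < 1 / (2 * c\<^sup>2)" using err_bounds(3) c1 by (simp add: field_simps)
    hence "\<bar>\<rho> i j\<bar> + err < 1 - err" using rho_bounds(2)[OF assms] by linarith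
    thus ?thesis using err_bounds by simp
  qed
  finally show ?thesis by (simp add: abs_square_less_1)
qed

lemma trace_S_ge: "real p / c \<le> (\<Sum>k<p. S k k)"
proof -
  have "(\<Sum>k<p. 1 / c) \<le> (\<Sum>k<p. S k k)" using S_diag by (intro sum_mono) auto
  thus ?thesis by simp
qed

lemma trace_S_pos: "(\<Sum>k<p. S k k) > 0"
proof -
  have "real p / c > 0" using p2 c1 by simp
  with trace_S_ge show ?thesis by linarith
qed

lemma R_dev: "\<bar>R \<omega> / (real n - 1) - (\<Sum>k<p. S k k)\<bar> \<le> err * (\<Sum>k<p. S k k)"
proof -
  have "R \<omega> / (real n - 1) - (\<Sum>k<p. S k k) = (\<Sum>k<p. (\<xi> k k - 1) * S k k)"
  proof -
    have "V k k \<omega> / (real n - 1) - S k k = (\<xi> k k - 1) * S k k" if "k < p" for k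
      using sh_eq[OF that that] S_diag[OF that] by (simp add: sh_def algebra_simps)
    thus ?thesis by (simp add: R_def sum_divide_distrib flip: sum_subtractf)
  qed
  also have "\<bar>\<dots>\<bar> \<le> (\<Sum>k<p. \<bar>(\<xi> k k - 1) * S k k\<bar>)" by (rule sum_abs)
  also have "\<dots> \<le> (\<Sum>k<p. err * S k k)"
  proof (rule sum_mono)
    fix k assume k: "k \<in> {..<p}"
    have "\<bar>\<xi> k k - 1\<bar> \<le> err" using \<xi>_diag[of k] k by (auto simp: abs_le_iff)
    thus "\<bar>(\<xi> k k - 1) * S k k\<bar> \<le> err * S k k" using S_diag[of k] k by (simp add: abs_mult mult_right_mono)
  qed
  finally show ?thesis by (simp add: sum_distrib_left)
qed

lemma R_bounds:
  shows "(1 - err) * (\<Sum>k<p. S k k) * (real n - 1) \<le> R \<omega>" "R \<omega> \<le> (1 + err) * (\<Sum>k<p. S k k) * (real n - 1)" "R \<omega> > 0"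
proof -
  have "(1 - err) * (\<Sum>k<p. S k k) \<le> R \<omega> / (real n - 1)" using R_dev by (simp add: abs_le_iff algebra_simps)
  thus a: "(1 - err) * (\<Sum>k<p. S k k) * (real n - 1) \<le> R \<omega>" using n1_pos by (simp add: pos_le_divide_eq)
  have "R \<omega> / (real n - 1) \<le> (1 + err) * (\<Sum>k<p. S k k)" using R_dev by (simp add: abs_le_iff algebra_simps)
  thus "R \<omega> \<le> (1 + err) * (\<Sum>k<p. S k k) * (real n - 1)" using n1_pos by (simp add: pos_divide_le_eq)
  have "(1 - err) * (\<Sum>k<p. S k k) * (real n - 1) > 0" using err_bounds trace_S_pos n1_pos by simp
  with a show "R \<omega> > 0" by linarith
qed

text \<open>By Cauchy-Schwarz the diagonal of \<open>W\<close> contributes at least what the bias correction removes.\<close>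

lemma Bh_ge: "(1 - \<eta>) * (1 - c ^ 4 / real p) * F / (1 + err)\<^sup>2 \<le> real n * Bh \<omega>"
proof -
  define Q where "Q = (\<Sum>(k, m)\<in>D. (W k m \<omega>)\<^sup>2)"
  define tS where "tS = (\<Sum>k<p. S k k)"
  have tS: "tS > 0" "real p / c \<le> tS" using trace_S_pos trace_S_ge by (auto simp: tS_def)
  have c0: "c > 0" using c1 by simp
  have "(R \<omega>)\<^sup>2 / real p \<le> (\<Sum>k<p. (W k k \<omega>)\<^sup>2)"
  proof -
    have "(\<Sum>k<p. W k k \<omega>)\<^sup>2 \<le> real p * (\<Sum>k<p. (W k k \<omega>)\<^sup>2)"
      using Cauchy_Schwarz_ineq_sum[of "\<lambda>_. 1" "\<lambda>k. W k k \<omega>" "{..<p}"] by simp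
    thus ?thesis using p2 by (simp add: V_rotated(1) R_def field_simps)
  qed
  hence V2: "Q + (R \<omega>)\<^sup>2 / real p \<le> (\<Sum>k<p. \<Sum>m<p. (V k m \<omega>)\<^sup>2)"
    unfolding V_rotated(2)[symmetric] sum_pairs_split by (simp add: Q_def)
  have "(real n - 1)\<^sup>2 * Q / (R \<omega>)\<^sup>2 + (real n - 1)\<^sup>2 / real p = (real n - 1)\<^sup>2 * (Q + (R \<omega>)\<^sup>2 / real p) / (R \<omega>)\<^sup>2"
    using R_bounds(3) p2 by (simp add: field_simps)
  also have "\<dots> \<le> (real n - 1)\<^sup>2 * (\<Sum>k<p. \<Sum>m<p. (V k m \<omega>)\<^sup>2) / (R \<omega>)\<^sup>2"
    using V2 by (intro divide_right_mono mult_left_mono) auto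
  finally have nB: "(real n - 1)\<^sup>2 * Q / (R \<omega>)\<^sup>2 \<le> real n * Bh \<omega>" using n2 by (simp add: Bh_def)
  \<comment> \<open>All products of eigenvalues sum to the squared trace; dropping the diagonal ones
    removes at most \<open>p * c^2\<close>, a fraction \<open>c ^ 4 / p\<close> of it because
    \<open>tS \<ge> p / c\<close>.\<close>
  have "(\<Sum>(k, m)\<in>D. s k * s m) \<ge> (1 - c ^ 4 / real p) * tS\<^sup>2"
  proof -
    have "(\<Sum>k<p. s k) = tS" using spectral_decomp_trace[OF sd] by (simp add: tS_def)
    hence "tS\<^sup>2 = (\<Sum>k<p. s k) * (\<Sum>k<p. s k)" by (simp only: power2_eq_square)
    also have "\<dots> = (\<Sum>k<p. \<Sum>m<p. s k * s m)" by (rule sum_product)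
    also have "\<dots> = (\<Sum>(k, m)\<in>D. s k * s m) + (\<Sum>k<p. s k * s k)" by (rule sum_pairs_split)
    finally have e1: "(\<Sum>(k, m)\<in>D. s k * s m) = tS\<^sup>2 - (\<Sum>k<p. s k * s k)" by simp
    have "(\<Sum>k<p. s k * s k) \<le> (\<Sum>k<p. c * c)"
    proof (rule sum_mono)
      fix k assume k: "k \<in> {..<p}"
      have "0 \<le> s k" "s k \<le> c" using s_bounds[of k] s_nonneg[of k] k by auto
      thus "s k * s k \<le> c * c" by (intro mult_mono) auto
    qed
    also have "\<dots> = c ^ 4 / real p * (real p / c)\<^sup>2"
      using p2 c0 by (simp add: power2_eq_square power4_eq_xxxx)
    also have "\<dots> \<le> c ^ 4 / real p * tS\<^sup>2" using tS c0 by (intro mult_left_mono power_mono) auto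
    finally show ?thesis unfolding e1 by (simp add: algebra_simps)
  qed
  hence "(1 - \<eta>) * (F * ((1 - c ^ 4 / real p) * tS\<^sup>2)) \<le> (1 - \<eta>) * (F * (\<Sum>(k, m)\<in>D. s k * s m))"
    using \<eta> F_bounds(2) by (intro mult_left_mono) auto
  also have "\<dots> \<le> Q" using good by (simp add: good_def Q_def)
  finally have Q: "(1 - \<eta>) * (F * ((1 - c ^ 4 / real p) * tS\<^sup>2)) \<le> Q" .
  have "(1 - \<eta>) * (1 - c ^ 4 / real p) * F / (1 + err)\<^sup>2
     = (real n - 1)\<^sup>2 * ((1 - \<eta>) * (F * ((1 - c ^ 4 / real p) * tS\<^sup>2))) / ((1 + err) * tS * (real n - 1))\<^sup>2"
    using n1_pos tS err_bounds by (simp add: power_mult_distrib)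
  also have "\<dots> \<le> (real n - 1)\<^sup>2 * Q / (R \<omega>)\<^sup>2"
  proof (rule frac_le)
    have "0 \<le> (1 - \<eta>) * (F * ((1 - c ^ 4 / real p) * tS\<^sup>2))" using \<eta> F_bounds(2) hp by simp
    with Q have "0 \<le> Q" by linarith
    thus "0 \<le> (real n - 1)\<^sup>2 * Q" by simp
    show "(R \<omega>)\<^sup>2 \<le> ((1 + err) * tS * (real n - 1))\<^sup>2"
      using R_bounds by (intro power_mono) (auto simp: tS_def)
  qed (use Q R_bounds(3) in \<open>auto intro: mult_left_mono\<close>)
  also note nB
  finally show ?thesis .
qed

text \<open>The bias correction only lowers \<open>Bh\<close> and is dropped. Since \<open>R\<close>
  is at least \<open>(p / (2 * c)) * (n - 1)\<close>, a factor \<open>4 * c^2 / p^2\<close> appears,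
  so that \<open>1028 = 4 * 257\<close>; the ratio \<open>n / p\<close> is bounded by
  \<open>r\<close>.\<close>

lemma Bh_le: "Bh \<omega> \<le> 1028 * c ^ 6 * N * (1 + r)"
proof -
  define V2 where "V2 = (\<Sum>k<p. \<Sum>m<p. (V k m \<omega>)\<^sup>2)"
  have c0: "c > 0" using c1 by simp
  have V2: "V2 \<le> N * (257 * c ^ 4 * (real p ^ 2 * real n + real p * real n ^ 2))"
    using good by (simp add: good_def V2_def)
  have V20: "0 \<le> V2" by (auto simp: V2_def intro!: sum_nonneg)
  have R2: "(1 / 2 * (real p / c) * (real n - 1))\<^sup>2 \<le> (R \<omega>)\<^sup>2"
  proof (rule power_mono)
    have "1 / 2 * (real p / c) * (real n - 1) \<le> (1 - err) * (\<Sum>k<p. S k k) * (real n - 1)"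
      using err_bounds trace_S_ge n1_pos c0 by (intro mult_right_mono mult_mono) auto
    thus "1 / 2 * (real p / c) * (real n - 1) \<le> R \<omega>" using R_bounds(1) by linarith
  qed (use n1_pos c0 in auto)
  have "real n * Bh \<omega> \<le> (real n - 1)\<^sup>2 * V2 / (R \<omega>)\<^sup>2"
    using n2 by (simp add: Bh_def V2_def)
  also have "\<dots> \<le> (real n - 1)\<^sup>2 * V2 / (1 / 2 * (real p / c) * (real n - 1))\<^sup>2"
    using R2 V20 n1_pos c0 p2 by (intro divide_left_mono mult_pos_pos) (auto simp: R_bounds(3) less_imp_neq[symmetric])
  also have "\<dots> = 4 * c\<^sup>2 * V2 / real p ^ 2"
    using n1_pos c0 p2 by (simp add: power_mult_distrib power_divide)
  also have "\<dots> \<le> 4 * c\<^sup>2 * (N * (257 * c ^ 4 * (real p ^ 2 * real n + real p * real n ^ 2))) / real p ^ 2"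
    using V2 by (intro divide_right_mono mult_left_mono) auto
  also have "\<dots> = 1028 * c ^ 6 * N * real n * (1 + real n / real p)"
    using p2 by (simp add: field_simps power2_eq_square) (simp add: power_numeral_reduce)
  also have "\<dots> \<le> 1028 * c ^ 6 * N * real n * (1 + r)"
    using r p2 N c0 by (intro mult_left_mono add_left_mono) (auto simp: pos_divide_le_eq)
  finally have "real n * Bh \<omega> \<le> real n * (1028 * c ^ 6 * N * (1 + r))" by (simp add: mult_ac)
  thus ?thesis using n2 by simp
qed

lemma threshold_ge:
  "\<delta> * sqrt ((1 - \<eta>) * (1 - c ^ 4 / real p)) / (1 + err) * (sqrt (F * ln (real p)) / real n)
     \<le> \<delta> * sqrt (Bh \<omega> * ln (real p) / real n)"
proof -
  define b where "b = (1 - \<eta>) * (1 - c ^ 4 / real p)"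
  have b: "b \<ge> 0" using \<eta> hp by (simp add: b_def)
  have "b * F / (1 + err)\<^sup>2 \<le> Bh \<omega> * real n" using Bh_ge by (simp only: b_def mult.commute[of "Bh \<omega>"])
  hence "b * F / (1 + err)\<^sup>2 / real n \<le> Bh \<omega>" using n2 by (subst pos_divide_le_eq) auto
  hence "b * F / (1 + err)\<^sup>2 / real n * (ln (real p) / real n) \<le> Bh \<omega> * (ln (real p) / real n)"
    using ln_p_pos by (intro mult_right_mono) auto
  hence "sqrt (b * F / (1 + err)\<^sup>2 / real n * (ln (real p) / real n)) \<le> sqrt (Bh \<omega> * ln (real p) / real n)"
    by simp
  also have "b * F / (1 + err)\<^sup>2 / real n * (ln (real p) / real n) = b * (F * ln (real p)) / ((1 + err) * real n)\<^sup>2"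
    by (simp add: power2_eq_square mult_ac)
  also have "sqrt \<dots> = sqrt b * sqrt (F * ln (real p)) / ((1 + err) * real n)"
    using err_bounds by (simp add: real_sqrt_divide real_sqrt_mult)
  finally have "\<delta> * (sqrt b * sqrt (F * ln (real p)) / ((1 + err) * real n)) \<le> \<delta> * sqrt (Bh \<omega> * ln (real p) / real n)"
    using \<delta> by (intro mult_left_mono) auto
  thus ?thesis by (simp add: b_def)
qed

text \<open>A small correlation makes \<open>rh\<close> of order \<open>lam\<close>, so the factor
  \<open>1 - rh^2\<close> is nearly 1. Undoing the studentisation and the division by
  \<open>n - 1\<close> turns exceeding the empirical threshold into
  \<open>\<bar>T i j \<omega>\<bar>\<close> exceeding a multiple of \<open>sqrt (F * ln p)\<close>;
  the assumption \<open>h3\<close> says that after all these losses the multiple is still at least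
  \<open>d\<close>.\<close>

lemma kept_small_is_false_alarm:
  assumes ij: "i < p" "j < p" "i \<noteq> j" and \<rho>: "\<bar>\<rho> i j\<bar> \<le> a * lam" and keep: "keep \<delta> i j \<omega>"
  shows "(i, j) \<in> false_alarms a d \<omega>"
proof -
  define z where "z = 4 * (a + (6 * c + 6))\<^sup>2 * lam\<^sup>2"
  define th where "th = \<delta> * sqrt ((1 - \<eta>) * (1 - c ^ 4 / real p)) / (1 + err)"
  have th0: "th \<ge> 0" using \<delta> \<eta> hp err_bounds by (simp add: th_def)
  have X: "sqrt (F * ln (real p)) \<ge> 0" using F_bounds ln_p_pos by simp
  have rz: "(rh i j \<omega>)\<^sup>2 \<le> z"
  proof -
    have "\<bar>rh i j \<omega>\<bar> \<le> (\<bar>\<rho> i j\<bar> + err) / (1 - err)" using rh_le ij by simp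
    also have "\<dots> \<le> (a * lam + err) / (1 / 2)" using \<rho> err_bounds by (intro frac_le) auto
    also have "\<dots> = 2 * (a + (6 * c + 6)) * lam" by (simp add: err_def algebra_simps)
    finally have "\<bar>rh i j \<omega>\<bar>\<^sup>2 \<le> (2 * (a + (6 * c + 6)) * lam)\<^sup>2" by (intro power_mono) auto
    moreover have "(2 * g * lam)\<^sup>2 = 4 * g\<^sup>2 * lam\<^sup>2" for g by (simp add: power_mult_distrib)
    ultimately show ?thesis by (simp only: z_def power2_abs)
  qed
  have r1: "1 - (rh i j \<omega>)\<^sup>2 > 0" using rh_less_1[OF ij] by simp
  have "th * (sqrt (F * ln (real p)) / real n) \<le> \<bar>rh i j \<omega>\<bar> / (1 - (rh i j \<omega>)\<^sup>2)"
    using threshold_ge keep by (simp add: th_def keep_def)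
  hence "th * (sqrt (F * ln (real p)) / real n) * (1 - (rh i j \<omega>)\<^sup>2) \<le> \<bar>rh i j \<omega>\<bar>"
    using r1 by (simp add: pos_le_divide_eq)
  moreover have "th * (sqrt (F * ln (real p)) / real n) * (1 - z) \<le> th * (sqrt (F * ln (real p)) / real n) * (1 - (rh i j \<omega>)\<^sup>2)"
    using rz th0 X by (intro mult_left_mono) auto
  ultimately have r2: "th * (sqrt (F * ln (real p)) / real n) * (1 - z) \<le> \<bar>rh i j \<omega>\<bar>" by linarith
  have pos: "sqrt (\<xi> i i * \<xi> j j) > 0" using rh_eq(2)[OF ij(1,2)] err_bounds by linarith
  have "\<bar>T i j \<omega>\<bar> = \<bar>rh i j \<omega>\<bar> * sqrt (\<xi> i i * \<xi> j j) * (real n - 1)"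
  proof -
    have "\<bar>x\<bar> = \<bar>x / m / q\<bar> * q * m" if "q > 0" "m > 0" for x q m :: real
      using that by (simp add: abs_divide)
    from this[OF pos n1_pos] show ?thesis unfolding rh_eq(1)[OF ij(1,2)] \<xi>_def[of i j] .
  qed
  moreover have "\<bar>rh i j \<omega>\<bar> * sqrt (\<xi> i i * \<xi> j j) * (real n - 1) \<ge> (th * (sqrt (F * ln (real p)) / real n) * (1 - z)) * (1 - err) * (real n - 1)"
    using r2 rh_eq(2)[OF ij(1,2)] n1_pos err_bounds h5 th0 X by (intro mult_right_mono mult_mono) (auto simp: z_def)
  moreover have "d * sqrt (F * ln (real p)) \<le> (th * (sqrt (F * ln (real p)) / real n) * (1 - z)) * (1 - err) * (real n - 1)"
  proof -
    have "d \<le> (1 - z) * (1 - err) * ((real n - 1) / real n) * th" using h3 by (simp add: z_def err_def th_def)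
    hence "d * sqrt (F * ln (real p)) \<le> (1 - z) * (1 - err) * ((real n - 1) / real n) * th * sqrt (F * ln (real p))"
      using X by (intro mult_right_mono) auto
    thus ?thesis by (simp add: mult_ac)
  qed
  ultimately show ?thesis using ij \<rho> by (simp add: false_alarms_def)
qed

text \<open>Dividing by \<open>1 - rh^2\<close>, which lies in \<open>(0, 1]\<close>, only increases
  the statistic, so \<open>rh\<close> itself is below the threshold, and this is of order
  \<open>lam\<close> by the upper bound on \<open>Bh\<close>. The factor \<open>2 * c\<close>
  returns from correlations to covariances.\<close>

lemma killed_small:
  assumes ij: "i < p" "j < p" "i \<noteq> j" and nk: "\<not> keep \<delta> i j \<omega>"
  shows "\<bar>sh i j \<omega>\<bar> \<le> 2 * c * \<delta> * sqrt (1028 * c ^ 6 * N * (1 + r)) * lam"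
proof -
  have c0: "c > 0" using c1 by simp
  have r1: "1 - (rh i j \<omega>)\<^sup>2 > 0" "1 - (rh i j \<omega>)\<^sup>2 \<le> 1" using rh_less_1[OF ij] by simp_all
  have "\<bar>rh i j \<omega>\<bar> \<le> \<bar>rh i j \<omega>\<bar> / (1 - (rh i j \<omega>)\<^sup>2)"
    using r1 mult_left_mono[OF r1(2), of "\<bar>rh i j \<omega>\<bar>"] by (simp add: pos_le_divide_eq)
  also have "\<dots> \<le> \<delta> * sqrt (Bh \<omega> * ln (real p) / real n)" using nk by (simp add: keep_def)
  also have "\<dots> = \<delta> * (sqrt (Bh \<omega>) * lam)" by (simp add: lam_def flip: real_sqrt_mult)
  also have "\<dots> \<le> \<delta> * (sqrt (1028 * c ^ 6 * N * (1 + r)) * lam)"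
    using Bh_le \<delta> lam_pos by (intro mult_left_mono mult_right_mono) auto
  finally have rb: "\<bar>rh i j \<omega>\<bar> \<le> \<delta> * (sqrt (1028 * c ^ 6 * N * (1 + r)) * lam)" .
  have pos: "sqrt (\<xi> i i * \<xi> j j) > 0" using rh_eq(2)[OF ij(1,2)] err_bounds by linarith
  have "\<bar>sh i j \<omega>\<bar> = \<bar>rh i j \<omega>\<bar> * (sqrt (\<xi> i i * \<xi> j j) * sqrt (S i i * S j j))"
  proof -
    have "\<bar>x * y\<bar> = \<bar>x / q\<bar> * (q * y)" if "q > 0" "y > 0" for x y q :: real
      using that by (simp add: abs_mult abs_divide)
    from this[OF pos sqrt_S_le(2)[OF ij(1,2)]] show ?thesis
      unfolding rh_eq(1)[OF ij(1,2)] sh_eq[OF ij(1,2)] .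
  qed
  also have "\<dots> \<le> \<delta> * (sqrt (1028 * c ^ 6 * N * (1 + r)) * lam) * (2 * c)"
    using rb pos rh_eq(3)[OF ij(1,2)] err_bounds sqrt_S_le[OF ij(1,2)] c0 \<delta>
    by (intro mult_mono) (auto intro: order_trans[OF abs_ge_zero])
  finally show ?thesis by (simp add: mult_ac)
qed

end

end

section \<open>The thresholding error\<close>

text \<open>A deterministic estimate with one constant per kind of entry: \<open>A1\<close> for the
  diagonal, \<open>A2\<close> for kept entries with tiny \<open>S\<close>, \<open>A3\<close> for
  kept larger ones, \<open>A4\<close> for killed ones. The first two are multiplied by counts of
  order \<open>p\<close>, the last two by \<open>\<bar>S i j\<bar> powr \<tau>\<close>, whose row
  sums are at most \<open>C\<close>.\<close>

lemma thresholded_sum_of_squares: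
  fixes S sh :: "nat \<Rightarrow> nat \<Rightarrow> real" and keep :: "nat \<Rightarrow> nat \<Rightarrow> bool"
  assumes \<tau>: "0 < \<tau>" "\<tau> < 2" and lam: "0 < lam" "lam \<le> 1"
    and S_le: "\<And>i j. i < p \<Longrightarrow> j < p \<Longrightarrow> \<bar>S i j\<bar> \<le> c" and c: "c \<ge> 1"
    and sparse: "\<And>i. i < p \<Longrightarrow> (\<Sum>j<p. \<bar>S i j\<bar> powr \<tau>) \<le> C"
    and dev: "\<And>i j. i < p \<Longrightarrow> j < p \<Longrightarrow> \<bar>sh i j - S i j\<bar> \<le> K * lam" and K: "K > 0"
    and killed: "\<And>i j. i < p \<Longrightarrow> j < p \<Longrightarrow> i \<noteq> j \<Longrightarrow> \<not> keep i j \<Longrightarrow> \<bar>sh i j\<bar> \<le> K' * lam" and K': "K' > 0"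
    and alarms: "real (card {(i, j). i < p \<and> j < p \<and> i \<noteq> j \<and> keep i j \<and> \<bar>S i j\<bar> \<le> a * lam}) \<le> N * real p"
    and a: "0 < a" "a \<le> 1"
  shows "\<bar>(\<Sum>i<p. \<Sum>j<p. (if i = j \<or> keep i j then sh i j else 0)\<^sup>2) - (\<Sum>i<p. \<Sum>j<p. (S i j)\<^sup>2)\<bar>
    \<le> (K * (2 * c + K) + N * ((K + a)\<^sup>2 + a\<^sup>2)
        + (K * (2 + K / a) * (c powr 2 + a powr (1 - \<tau>)) + (K + K') powr (2 - \<tau>)) * C) * lam powr min 1 (2 - \<tau>) * real p"
proof -
  define q where "q = min 1 (2 - \<tau>)"
  define lq where "lq = lam powr q"
  define B where "B = {(i, j). i < p \<and> j < p \<and> i \<noteq> j \<and> keep i j \<and> \<bar>S i j\<bar> \<le> a * lam}"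
  define th where "th i j = (if i = j \<or> keep i j then sh i j else 0)" for i j
  define A1 where "A1 = K * (2 * c + K)"
  define A2 where "A2 = (K + a)\<^sup>2 + a\<^sup>2"
  define A3 where "A3 = K * (2 + K / a) * (c powr 2 + a powr (1 - \<tau>))"
  define A4 where "A4 = (K + K') powr (2 - \<tau>)"
  have Apos: "A1 \<ge> 0" "A2 \<ge> 0" "A3 \<ge> 0" "A4 \<ge> 0"
    using K c a by (auto simp: A1_def A2_def A3_def A4_def)
  have q: "0 < q" "q \<le> 1" "q \<le> 2 - \<tau>" using \<tau> by (auto simp: q_def)
  have lq0: "lq > 0" using lam by (simp add: lq_def)
  have lam_lq: "lam \<le> lq" unfolding lq_def using powr_mono'[of q 1 lam] lam q by simp
  have lam2_lq: "lam\<^sup>2 \<le> lq"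
  proof -
    have "lam\<^sup>2 \<le> lam * 1" unfolding power2_eq_square using lam by (intro mult_left_mono) auto
    with lam_lq show ?thesis by simp
  qed
  have lam2\<tau>: "lam powr (2 - \<tau>) \<le> lq" unfolding lq_def using lam q by (intro powr_mono') auto
  have sq_diff: "\<bar>(sh i j)\<^sup>2 - (S i j)\<^sup>2\<bar> \<le> K * lam * (2 * \<bar>S i j\<bar> + K * lam)" if ij: "i < p" "j < p" for i j
  proof -
    have "(sh i j)\<^sup>2 - (S i j)\<^sup>2 = (sh i j - S i j) * (sh i j + S i j)"
      by (simp add: power2_eq_square algebra_simps)
    hence "\<bar>(sh i j)\<^sup>2 - (S i j)\<^sup>2\<bar> = \<bar>sh i j - S i j\<bar> * \<bar>sh i j + S i j\<bar>" by (simp add: abs_mult)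
    also have "\<dots> \<le> (K * lam) * (2 * \<bar>S i j\<bar> + K * lam)"
      using dev[OF ij] by (intro mult_mono) auto
    finally show ?thesis .
  qed
  \<comment> \<open>The surplus factor \<open>\<bar>S i j\<bar> powr (1 - \<tau>)\<close> is bounded
    by the size of \<open>S\<close> when \<open>\<tau> \<le> 1\<close>, leaving \<open>lam\<close>.
    For larger \<open>\<tau>\<close> the exponent is negative and the lower bound
    \<open>a * lam\<close> is used, leaving \<open>lam powr (2 - \<tau>)\<close>.\<close>
  have large: "lam * \<bar>S i j\<bar> \<le> (c powr 2 + a powr (1 - \<tau>)) * \<bar>S i j\<bar> powr \<tau> * lq"
    if ij: "i < p" "j < p" and big: "\<bar>S i j\<bar> > a * lam" for i j
  proof -
    have S0: "\<bar>S i j\<bar> > 0" using big a lam by (meson less_trans mult_pos_pos)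
    have split: "\<bar>S i j\<bar> = \<bar>S i j\<bar> powr \<tau> * \<bar>S i j\<bar> powr (1 - \<tau>)"
      using S0 by (simp flip: powr_add)
    show ?thesis
    proof (cases "\<tau> \<le> 1")
      case True
      have "\<bar>S i j\<bar> powr (1 - \<tau>) \<le> c powr (1 - \<tau>)" using True S_le[OF ij] by (intro powr_mono2) auto
      also have "\<dots> \<le> c powr 2" using \<tau> c by (intro powr_mono) auto
      finally have "\<bar>S i j\<bar> powr (1 - \<tau>) \<le> c powr 2 + a powr (1 - \<tau>)" by (simp add: add_increasing2)
      hence "lam * (\<bar>S i j\<bar> powr \<tau> * \<bar>S i j\<bar> powr (1 - \<tau>)) \<le> lq * (\<bar>S i j\<bar> powr \<tau> * (c powr 2 + a powr (1 - \<tau>)))"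
        using lam_lq lam by (intro mult_mono) auto
      thus ?thesis using split by (simp add: mult_ac)
    next
      case False
      have "\<bar>S i j\<bar> powr (1 - \<tau>) \<le> (a * lam) powr (1 - \<tau>)" using False big a lam by (intro powr_mono2') auto
      also have "\<dots> = a powr (1 - \<tau>) * lam powr (1 - \<tau>)" using a lam by (simp add: powr_mult)
      finally have "lam * (\<bar>S i j\<bar> powr \<tau> * \<bar>S i j\<bar> powr (1 - \<tau>)) \<le> lam * (\<bar>S i j\<bar> powr \<tau> * (a powr (1 - \<tau>) * lam powr (1 - \<tau>)))"
        using lam by (intro mult_left_mono) auto
      also have "\<dots> = a powr (1 - \<tau>) * \<bar>S i j\<bar> powr \<tau> * (lam powr 1 * lam powr (1 - \<tau>))"
        using lam by simp
      also have "lam powr 1 * lam powr (1 - \<tau>) = lam powr (2 - \<tau>)" unfolding powr_add[symmetric] by simp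
      also have "a powr (1 - \<tau>) * \<bar>S i j\<bar> powr \<tau> * lam powr (2 - \<tau>) \<le> (c powr 2 + a powr (1 - \<tau>)) * \<bar>S i j\<bar> powr \<tau> * lq"
        using lam2\<tau> by (intro mult_mono) auto
      finally show ?thesis using split by simp
    qed
  qed
  have entry: "\<bar>(th i j)\<^sup>2 - (S i j)\<^sup>2\<bar>
      \<le> A1 * lq * of_bool (i = j) + A2 * lq * of_bool ((i, j) \<in> B) + (A3 + A4) * lq * \<bar>S i j\<bar> powr \<tau>"
    if ij: "i < p" "j < p" for i j
  proof -
    have nn: "A1 * lq * of_bool (i = j) \<ge> 0" "A2 * lq * of_bool ((i, j) \<in> B) \<ge> 0"
      "A3 * lq * \<bar>S i j\<bar> powr \<tau> \<ge> 0" "A4 * lq * \<bar>S i j\<bar> powr \<tau> \<ge> 0"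
      using Apos lq0 by (auto intro!: mult_nonneg_nonneg)
    have dist: "(A3 + A4) * lq * \<bar>S i j\<bar> powr \<tau> = A3 * lq * \<bar>S i j\<bar> powr \<tau> + A4 * lq * \<bar>S i j\<bar> powr \<tau>"
      by (simp add: algebra_simps)
    consider "i = j" | "i \<noteq> j" "keep i j" "\<bar>S i j\<bar> \<le> a * lam" | "i \<noteq> j" "keep i j" "\<bar>S i j\<bar> > a * lam" | "i \<noteq> j" "\<not> keep i j"
      by linarith
    thus ?thesis
    proof cases
      case 1
      have "\<bar>(th i j)\<^sup>2 - (S i j)\<^sup>2\<bar> \<le> K * lam * (2 * \<bar>S i j\<bar> + K * lam)" using sq_diff[OF ij] 1 by (simp add: th_def)
      also have "\<dots> \<le> K * lq * (2 * c + K * 1)"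
        using K lam lam_lq S_le[OF ij] c by (intro mult_mono add_mono) auto
      also have "\<dots> = A1 * lq * of_bool (i = j)" using 1 by (simp add: A1_def)
      finally show ?thesis using nn dist by linarith
    next
      case 2
      have "\<bar>sh i j\<bar> \<le> (K + a) * lam" using dev[OF ij] 2(3) by (simp add: algebra_simps abs_le_iff)
      hence "(sh i j)\<^sup>2 \<le> ((K + a) * lam)\<^sup>2" by (metis abs_ge_zero power2_abs power_mono)
      moreover have "(S i j)\<^sup>2 \<le> (a * lam)\<^sup>2" using 2(3) by (metis abs_ge_zero power2_abs power_mono)
      moreover have "\<bar>(th i j)\<^sup>2 - (S i j)\<^sup>2\<bar> \<le> (sh i j)\<^sup>2 + (S i j)\<^sup>2"
        using 2(2) by (auto simp: th_def abs_le_iff intro: order_trans[of _ 0])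
      moreover have "A2 * lam\<^sup>2 = ((K + a) * lam)\<^sup>2 + (a * lam)\<^sup>2"
        unfolding A2_def power_mult_distrib by (rule distrib_right)
      ultimately have "\<bar>(th i j)\<^sup>2 - (S i j)\<^sup>2\<bar> \<le> A2 * lam\<^sup>2" by linarith
      also have "\<dots> \<le> A2 * lq" using lam2_lq Apos by (intro mult_left_mono) auto
      also have "A2 * lq = A2 * lq * of_bool ((i, j) \<in> B)" using 2 ij by (simp add: B_def)
      finally show ?thesis using nn dist by linarith
    next
      case 3
      have "\<bar>(th i j)\<^sup>2 - (S i j)\<^sup>2\<bar> \<le> K * lam * (2 * \<bar>S i j\<bar> + K * lam)" using sq_diff[OF ij] 3 by (simp add: th_def)
      also have "\<dots> \<le> K * lam * (2 * \<bar>S i j\<bar> + K / a * \<bar>S i j\<bar>)"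
      proof -
        \<comment> \<open>Above the level \<open>a * lam\<close> the quadratic part of the error is
          absorbed into the linear one.\<close>
        have "K / a * (a * lam) \<le> K / a * \<bar>S i j\<bar>" using 3 K a by (intro mult_left_mono) auto
        thus ?thesis using K lam a by (intro mult_left_mono) auto
      qed
      also have "\<dots> = K * (2 + K / a) * (lam * \<bar>S i j\<bar>)" by (simp add: algebra_simps)
      also have "\<dots> \<le> K * (2 + K / a) * ((c powr 2 + a powr (1 - \<tau>)) * \<bar>S i j\<bar> powr \<tau> * lq)"
        using large[OF ij 3(3)] K a by (intro mult_left_mono) auto
      also have "\<dots> = A3 * lq * \<bar>S i j\<bar> powr \<tau>" by (simp add: A3_def)
      finally show ?thesis using nn dist by linarith
    next
      case 4
      have "\<bar>S i j\<bar> \<le> (K + K') * lam" using dev[OF ij] killed[OF ij 4] by (simp add: algebra_simps abs_le_iff)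
      moreover have "\<bar>(th i j)\<^sup>2 - (S i j)\<^sup>2\<bar> = \<bar>S i j\<bar> powr 2"
        using 4 by (cases "S i j = 0") (auto simp: th_def powr_numeral)
      moreover have "\<bar>S i j\<bar> powr 2 = \<bar>S i j\<bar> powr \<tau> * \<bar>S i j\<bar> powr (2 - \<tau>)" by (simp flip: powr_add)
      ultimately have "\<bar>(th i j)\<^sup>2 - (S i j)\<^sup>2\<bar> \<le> \<bar>S i j\<bar> powr \<tau> * ((K + K') * lam) powr (2 - \<tau>)"
        using \<tau> by (auto intro!: mult_left_mono powr_mono2)
      also have "((K + K') * lam) powr (2 - \<tau>) = A4 * lam powr (2 - \<tau>)"
        using K K' lam by (simp add: A4_def powr_mult)
      also have "\<bar>S i j\<bar> powr \<tau> * (A4 * lam powr (2 - \<tau>)) \<le> \<bar>S i j\<bar> powr \<tau> * (A4 * lq)"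
        using lam2\<tau> Apos by (intro mult_left_mono) auto
      finally show ?thesis using nn dist by (simp add: mult_ac)
    qed
  qed
  have finB: "B \<subseteq> {..<p} \<times> {..<p}" by (auto simp: B_def)
  have "\<bar>(\<Sum>i<p. \<Sum>j<p. (th i j)\<^sup>2) - (\<Sum>i<p. \<Sum>j<p. (S i j)\<^sup>2)\<bar> = \<bar>\<Sum>i<p. \<Sum>j<p. (th i j)\<^sup>2 - (S i j)\<^sup>2\<bar>"
    by (simp add: sum_subtractf)
  also have "\<dots> \<le> (\<Sum>i<p. \<Sum>j<p. \<bar>(th i j)\<^sup>2 - (S i j)\<^sup>2\<bar>)"
    by (intro order_trans[OF sum_abs] sum_mono sum_abs)
  also have "\<dots> \<le> (\<Sum>i<p. \<Sum>j<p. A1 * lq * of_bool (i = j) + A2 * lq * of_bool ((i, j) \<in> B) + (A3 + A4) * lq * \<bar>S i j\<bar> powr \<tau>)"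
    by (intro sum_mono entry) auto
  also have "\<dots> = A1 * lq * (\<Sum>i<p. \<Sum>j<p. of_bool (i = j)) + A2 * lq * (\<Sum>i<p. \<Sum>j<p. of_bool ((i, j) \<in> B))
      + (A3 + A4) * lq * (\<Sum>i<p. \<Sum>j<p. \<bar>S i j\<bar> powr \<tau>)"
    by (simp only: sum.distrib sum_distrib_left)
  also have "(\<Sum>i<p. \<Sum>j<p. of_bool (i = j)) = real p"
  proof -
    have "(\<Sum>j<p. of_bool (i = j)) = (1::real)" if "i < p" for i
      using that by (simp add: of_bool_def)
    thus ?thesis by simp
  qed
  also have "(\<Sum>i<p. \<Sum>j<p. of_bool ((i, j) \<in> B)) = real (card B)"
  proof -
    have "(\<Sum>i<p. \<Sum>j<p. of_bool ((i, j) \<in> B)) = (\<Sum>e\<in>{..<p} \<times> {..<p}. of_bool (e \<in> B) :: real)"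
      unfolding sum.cartesian_product by (rule sum.cong) auto
    also have "\<dots> = real (card B)"
      using finB by (simp add: of_bool_def sum.If_cases Int_absorb1)
    finally show ?thesis .
  qed
  also have "A1 * lq * real p + A2 * lq * real (card B) + (A3 + A4) * lq * (\<Sum>i<p. \<Sum>j<p. \<bar>S i j\<bar> powr \<tau>)
    \<le> A1 * lq * real p + A2 * lq * (N * real p) + (A3 + A4) * lq * (C * real p)"
  proof -
    have "(\<Sum>i<p. \<Sum>j<p. \<bar>S i j\<bar> powr \<tau>) \<le> (\<Sum>i<p. C)" by (intro sum_mono sparse) auto
    hence "(\<Sum>i<p. \<Sum>j<p. \<bar>S i j\<bar> powr \<tau>) \<le> C * real p" by (simp add: mult.commute)
    thus ?thesis using alarms Apos lq0 unfolding B_def[symmetric]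
      by (intro add_mono mult_left_mono order_refl) auto
  qed
  also have "\<dots> = (A1 + N * A2 + (A3 + A4) * C) * lq * real p" by (simp add: algebra_simps)
  finally show ?thesis unfolding th_def lq_def q_def A1_def A2_def A3_def A4_def .
qed

section \<open>The estimators\<close>

lemma frobenius_norm_squared: "(frobenius_norm A)\<^sup>2 = (\<Sum>i<dim_row A. \<Sum>j<dim_col A. (A $$ (i, j))\<^sup>2)"
  by (simp add: frobenius_norm_def sum_nonneg)

locale data_sample = gauss_sample M p n S l G w s c
  for M :: "'a measure" and p n S l G w s c +
  fixes X :: "'a \<Rightarrow> real mat"
  assumes X_dim: "\<And>\<omega>. \<omega> \<in> space M \<Longrightarrow> X \<omega> \<in> carrier_mat p n"
    and X_meas: "\<And>i k. i < p \<Longrightarrow> k < n \<Longrightarrow> (\<lambda>\<omega>. X \<omega> $$ (i, k)) \<in> borel_measurable M"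
    and V_data: "\<And>\<omega> i j. \<omega> \<in> space M \<Longrightarrow> i < p \<Longrightarrow> j < p \<Longrightarrow>
      V i j \<omega> = (\<Sum>k<n. (X \<omega> $$ (i, k) - sample_mean (X \<omega>) i) * (X \<omega> $$ (j, k) - sample_mean (X \<omega>) j))"
begin

lemma X_dims: "\<omega> \<in> space M \<Longrightarrow> dim_row (X \<omega>) = p" "\<omega> \<in> space M \<Longrightarrow> dim_col (X \<omega>) = n"
  using X_dim by auto

lemma sigma_hat_eq: "\<omega> \<in> space M \<Longrightarrow> i < p \<Longrightarrow> j < p \<Longrightarrow> sigma_hat (X \<omega>) i j = sh i j \<omega>"
  by (simp add: sigma_hat_def sh_def V_data X_dims)

lemma rho_hat_eq: "\<omega> \<in> space M \<Longrightarrow> i < p \<Longrightarrow> j < p \<Longrightarrow> rho_hat (X \<omega>) i j = rh i j \<omega>"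
  by (simp add: rho_hat_def rh_def sigma_hat_eq)

lemma trace_Sigma_hat: "\<omega> \<in> space M \<Longrightarrow> mat_trace (Sigma_hat (X \<omega>)) = R \<omega> / (real n - 1)"
  by (simp add: mat_trace_def Sigma_hat_def X_dims sigma_hat_eq sh_def R_def sum_divide_distrib)

text \<open>\<open>Psi_hat\<close> is the Gram matrix of the observations divided by the trace of
  \<open>Sigma_hat\<close>; \<open>gram_frobenius\<close> rewrites its norm through
  \<open>V\<close>. Its own trace is exactly \<open>n - 1\<close>, as both traces are multiples of
  \<open>R\<close>, so the bias correction is not random.\<close>

lemma B_hat_eq:
  assumes \<omega>: "\<omega> \<in> space M" and R: "R \<omega> > 0" and n2: "n \<ge> 2"
  shows "B_hat (X \<omega>) = Bh \<omega>"
proof -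
  define y where "y k i = X \<omega> $$ (k, i) - sample_mean (X \<omega>) k" for k i
  define tr where "tr = R \<omega> / (real n - 1)"
  have tr: "tr > 0" "real n - 1 > 0" using R n2 by (simp_all add: tr_def)
  have psi: "psi_hat (X \<omega>) i j = (\<Sum>k<p. y k i * y k j) / real p" for i j
    by (simp add: psi_hat_def X_dims[OF \<omega>] y_def)
  have V: "V k m \<omega> = (\<Sum>i<n. y k i * y m i)" if "k < p" "m < p" for k m
    using V_data[OF \<omega> that] by (simp add: y_def)
  have entry: "Psi_hat (X \<omega>) $$ (i, j) = (\<Sum>k<p. y k i * y k j) / tr" if "i < n" "j < n" for i j
    using that p2 by (simp add: Psi_hat_def X_dims[OF \<omega>] trace_Sigma_hat[OF \<omega>] tr_def[symmetric] psi)
  have dims: "dim_row (Psi_hat (X \<omega>)) = n" "dim_col (Psi_hat (X \<omega>)) = n"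
    by (simp_all add: Psi_hat_def X_dims[OF \<omega>])
  have "(frobenius_norm (Psi_hat (X \<omega>)))\<^sup>2 = (\<Sum>i<n. \<Sum>j<n. (\<Sum>k<p. y k i * y k j)\<^sup>2 / tr\<^sup>2)"
    by (simp add: frobenius_norm_squared dims entry power_divide)
  also have "\<dots> = (\<Sum>i<n. \<Sum>j<n. (\<Sum>k<p. y k i * y k j)\<^sup>2) / tr\<^sup>2"
    by (simp only: sum_divide_distrib)
  also have "(\<Sum>i<n. \<Sum>j<n. (\<Sum>k<p. y k i * y k j)\<^sup>2) = (\<Sum>k<p. \<Sum>m<p. (V k m \<omega>)\<^sup>2)"
  proof -
    have h: "(\<Sum>k<p. \<Sum>m<p. (V k m \<omega>)\<^sup>2) = (\<Sum>k<p. \<Sum>m<p. (\<Sum>i<n. y k i * y m i)\<^sup>2)"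
      by (intro sum.cong refl) (simp add: V)
    show ?thesis by (rule trans[OF gram_frobenius[symmetric] h[symmetric]])
  qed
  also have "\<dots> / tr\<^sup>2 = (real n - 1)\<^sup>2 * (\<Sum>k<p. \<Sum>m<p. (V k m \<omega>)\<^sup>2) / (R \<omega>)\<^sup>2"
    by (simp add: tr_def power_divide)
  finally have f: "(frobenius_norm (Psi_hat (X \<omega>)))\<^sup>2 = (real n - 1)\<^sup>2 * (\<Sum>k<p. \<Sum>m<p. (V k m \<omega>)\<^sup>2) / (R \<omega>)\<^sup>2" .
  have "mat_trace (Psi_hat (X \<omega>)) = (\<Sum>i<n. \<Sum>k<p. y k i * y k i) / tr"
    by (simp add: mat_trace_def dims entry sum_divide_distrib)
  also have "(\<Sum>i<n. \<Sum>k<p. y k i * y k i) = R \<omega>"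
    by (subst sum.swap) (simp add: R_def V)
  also have "R \<omega> / tr = real n - 1" using R tr by (simp add: tr_def)
  finally show ?thesis by (simp add: B_hat_def Bh_def f X_dims[OF \<omega>])
qed

section \<open>Measurability of the estimators\<close>

lemma sample_mean_measurable:
  assumes "i < p" shows "(\<lambda>\<omega>. sample_mean (X \<omega>) i) \<in> borel_measurable M"
proof -
  have "(\<lambda>\<omega>. (\<Sum>k<n. X \<omega> $$ (i, k)) / real n) \<in> borel_measurable M"
    using X_meas assms by (intro borel_measurable_divide borel_measurable_sum) auto
  thus ?thesis by (subst measurable_cong[where g="\<lambda>\<omega>. (\<Sum>k<n. X \<omega> $$ (i, k)) / real n"])
    (simp_all add: sample_mean_def X_dims)
qed

lemma sigma_hat_measurable:
  assumes "i < p" "j < p" shows "(\<lambda>\<omega>. sigma_hat (X \<omega>) i j) \<in> borel_measurable M"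
proof -
  have "sh i j \<in> borel_measurable M" unfolding sh_def using V_measurable[OF assms] by simp
  thus ?thesis by (subst measurable_cong[where g="sh i j"]) (simp_all add: sigma_hat_eq assms)
qed

lemma psi_hat_measurable:
  assumes "i < n" "j < n" shows "(\<lambda>\<omega>. psi_hat (X \<omega>) i j) \<in> borel_measurable M"
proof -
  let ?g = "\<lambda>\<omega>. (\<Sum>k<p. (X \<omega> $$ (k, i) - sample_mean (X \<omega>) k) * (X \<omega> $$ (k, j) - sample_mean (X \<omega>) k)) / real p"
  have "?g \<in> borel_measurable M"
    using X_meas sample_mean_measurable assms
    by (intro borel_measurable_divide borel_measurable_sum borel_measurable_times borel_measurable_diff borel_measurable_const) auto
  thus ?thesis by (subst measurable_cong[where g="?g"]) (simp_all add: psi_hat_def X_dims)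
qed

lemma B_hat_measurable: "(\<lambda>\<omega>. B_hat (X \<omega>)) \<in> borel_measurable M"
proof -
  define tr where "tr \<omega> = (\<Sum>i<p. sigma_hat (X \<omega>) i i)" for \<omega>
  let ?g = "\<lambda>\<omega>. ((\<Sum>i<n. \<Sum>j<n. (real p / tr \<omega> * psi_hat (X \<omega>) i j)\<^sup>2) - (\<Sum>i<n. real p / tr \<omega> * psi_hat (X \<omega>) i i)\<^sup>2 / real p) / real n"
  have tr: "tr \<in> borel_measurable M" unfolding tr_def using sigma_hat_measurable by (intro borel_measurable_sum) auto
  have "?g \<in> borel_measurable M"
    using tr psi_hat_measurable
    by (intro borel_measurable_divide borel_measurable_diff borel_measurable_sum borel_measurable_power borel_measurable_times borel_measurable_const) auto
  thus ?thesis by (subst measurable_cong[where g="?g"])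
    (simp_all add: B_hat_def frobenius_norm_squared mat_trace_def Psi_hat_def Sigma_hat_def X_dims tr_def)
qed

definition "kept \<delta> i j \<omega> \<longleftrightarrow> \<bar>rho_hat (X \<omega>) i j\<bar> / (1 - (rho_hat (X \<omega>) i j)\<^sup>2) \<ge> \<delta> * sqrt (B_hat (X \<omega>) * ln (real p) / real n)"

lemma Sigma_thr_entry: "\<omega> \<in> space M \<Longrightarrow> i < p \<Longrightarrow> j < p \<Longrightarrow>
    Sigma_thr \<delta> (X \<omega>) $$ (i, j) = (if i = j \<or> kept \<delta> i j \<omega> then sh i j \<omega> else 0)"
  by (auto simp: Sigma_thr_def X_dims kept_def sigma_hat_eq)

lemma Sigma_thr_dims: "\<omega> \<in> space M \<Longrightarrow> dim_row (Sigma_thr \<delta> (X \<omega>)) = p" "\<omega> \<in> space M \<Longrightarrow> dim_col (Sigma_thr \<delta> (X \<omega>)) = p"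
  by (auto simp: Sigma_thr_def X_dims)

lemma frobenius_Sigma_thr:
  assumes "\<omega> \<in> space M"
  shows "(frobenius_norm (Sigma_thr \<delta> (X \<omega>)))\<^sup>2 = (\<Sum>i<p. \<Sum>j<p. (if i = j \<or> kept \<delta> i j \<omega> then sh i j \<omega> else 0)\<^sup>2)"
  using assms by (simp add: frobenius_norm_squared Sigma_thr_dims Sigma_thr_entry)

lemma A_ratio_Sigma_thr:
  assumes "\<omega> \<in> space M"
  shows "A_ratio (Sigma_thr \<delta> (X \<omega>)) = real p * (frobenius_norm (Sigma_thr \<delta> (X \<omega>)))\<^sup>2 / (R \<omega> / (real n - 1))\<^sup>2"
proof -
  have "mat_trace (Sigma_thr \<delta> (X \<omega>)) = R \<omega> / (real n - 1)"
    using assms by (simp add: mat_trace_def Sigma_thr_dims Sigma_thr_entry sh_def R_def sum_divide_distrib)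
  thus ?thesis using assms by (simp add: A_ratio_def Sigma_thr_dims)
qed

text \<open>Containing a good event of large probability yields a lower bound on the measure of a
  set only if that set is itself an event.\<close>

lemma frobenius_Sigma_thr_measurable: "(\<lambda>\<omega>. (frobenius_norm (Sigma_thr \<delta> (X \<omega>)))\<^sup>2) \<in> borel_measurable M"
proof -
  have "(\<lambda>\<omega>. (if i = j \<or> kept \<delta> i j \<omega> then sh i j \<omega> else 0)\<^sup>2) \<in> borel_measurable M" if ij: "i < p" "j < p" for i j
  proof -
    have [measurable]: "sh i j \<in> borel_measurable M" unfolding sh_def using V_measurable[OF ij] by simp
    have [measurable]: "(\<lambda>\<omega>. rho_hat (X \<omega>) i j) \<in> borel_measurable M"
      unfolding rho_hat_def using sigma_hat_measurable ij by measurable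
    note [measurable] = B_hat_measurable
    show ?thesis unfolding kept_def by measurable
  qed
  hence "(\<lambda>\<omega>. \<Sum>i<p. \<Sum>j<p. (if i = j \<or> kept \<delta> i j \<omega> then sh i j \<omega> else 0)\<^sup>2) \<in> borel_measurable M"
    by (intro borel_measurable_sum) auto
  thus ?thesis
    by (subst measurable_cong[where g="\<lambda>\<omega>. \<Sum>i<p. \<Sum>j<p. (if i = j \<or> kept \<delta> i j \<omega> then sh i j \<omega> else 0)\<^sup>2"])
      (simp_all add: frobenius_Sigma_thr)
qed

lemma A_ratio_Sigma_thr_measurable: "(\<lambda>\<omega>. A_ratio (Sigma_thr \<delta> (X \<omega>))) \<in> borel_measurable M"
proof -
  have "R \<in> borel_measurable M" unfolding R_def using V_measurable by (intro borel_measurable_sum) auto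
  hence "(\<lambda>\<omega>. real p * (frobenius_norm (Sigma_thr \<delta> (X \<omega>)))\<^sup>2 / (R \<omega> / (real n - 1))\<^sup>2) \<in> borel_measurable M"
    using frobenius_Sigma_thr_measurable by measurable
  thus ?thesis
    by (subst measurable_cong[where g="\<lambda>\<omega>. real p * (frobenius_norm (Sigma_thr \<delta> (X \<omega>)))\<^sup>2 / (R \<omega> / (real n - 1))\<^sup>2"])
      (simp_all add: A_ratio_Sigma_thr)
qed

text \<open>The constant of \<open>thresholded_sum_of_squares\<close>, with \<open>K\<close> from
  \<open>sh_dev\<close> and \<open>K'\<close> from \<open>killed_small\<close>. The level is
  \<open>b = a / c\<close> because \<open>\<bar>S i j\<bar> \<le> a / c * lam\<close> forces
  \<open>\<bar>\<rho> i j\<bar> \<le> a * lam\<close>. Neither \<open>n\<close> nor \<open>p\<close>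
  occurs in it, so one constant serves the whole sequence.\<close>

definition "sq_err \<tau> C a \<delta> r N =
   (let K = c * (6 * c + 6); K' = 2 * c * \<delta> * sqrt (1028 * c ^ 6 * N * (1 + r)); b = a / c in
    K * (2 * c + K) + N * ((K + b)\<^sup>2 + b\<^sup>2)
        + (K * (2 + K / b) * (c powr 2 + b powr (1 - \<tau>)) + (K + K') powr (2 - \<tau>)) * C)"

text \<open>The first ratio has a denominator of order at least \<open>p\<close>, matching the
  factor \<open>p\<close> in the error. For the second, the diagonal is never thresholded, so the
  trace is that of \<open>Sigma_hat\<close> and \<open>A_ratio\<close> becomes
  \<open>x / y^2\<close> with \<open>y\<close> the relative trace; its error \<open>err\<close> has
  order \<open>lam\<close>, hence at most \<open>lam powr q\<close>.\<close>

lemma estimation_error: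
  assumes good: "good a d \<eta> N \<omega>" and \<omega>: "\<omega> \<in> space M"
    and n2: "n \<ge> 2" and h1: "1 \<le> real n * lam" and h4: "4 * c\<^sup>2 * ((6 * c + 6) * lam) < 1"
    and \<eta>: "0 < \<eta>" "\<eta> < 1" and N: "N > 0" and a: "a > 0" "a \<le> 1" and \<delta>: "\<delta> > 0"
    and hp: "c ^ 4 / real p \<le> 1"
    and h3: "d \<le> (1 - 4 * (a + (6 * c + 6))\<^sup>2 * lam\<^sup>2) * (1 - (6 * c + 6) * lam) * ((real n - 1) / real n)
        * (\<delta> * sqrt ((1 - \<eta>) * (1 - c ^ 4 / real p)) / (1 + (6 * c + 6) * lam))"
    and h5: "4 * (a + (6 * c + 6))\<^sup>2 * lam\<^sup>2 \<le> 1"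
    and r: "real n \<le> r * real p" and lam1: "lam \<le> 1"
    and \<tau>: "0 < \<tau>" "\<tau> < 2" and C: "\<And>i. i < p \<Longrightarrow> (\<Sum>j<p. \<bar>S i j\<bar> powr \<tau>) \<le> C"
  defines "q \<equiv> min 1 (2 - \<tau>)"
  defines "x \<equiv> (frobenius_norm (Sigma_thr \<delta> (X \<omega>)))\<^sup>2 / (\<Sum>i<p. \<Sum>j<p. (S i j)\<^sup>2)"
  defines "B \<equiv> c\<^sup>2 * sq_err \<tau> C a \<delta> r N"
  shows "\<bar>x - 1\<bar> \<le> B * lam powr q"
    and "\<bar>A_ratio (Sigma_thr \<delta> (X \<omega>)) / (real p * (\<Sum>i<p. \<Sum>j<p. (S i j)\<^sup>2) / (\<Sum>i<p. S i i)\<^sup>2) - 1\<bar>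
      \<le> (4 * B + 12 * (6 * c + 6)) * lam powr q"
proof -
  note ctx = good n2 h1 h4 \<eta> N a(1) \<delta> hp h3 h5 r
  have c0: "c > 0" using c1 by simp
  have r0: "r > 0"
  proof (rule ccontr)
    assume "\<not> r > 0"
    hence "r * real p \<le> 0" by (simp add: mult_nonpos_nonneg)
    with r n2 show False by simp
  qed
  have R: "R \<omega> > 0" by (rule R_bounds(3)[OF ctx])
  have kept: "kept \<delta> i j \<omega> \<longleftrightarrow> keep \<delta> i j \<omega>" if "i < p" "j < p" for i j
    using that by (simp add: kept_def keep_def rho_hat_eq[OF \<omega>] B_hat_eq[OF \<omega> R n2])
  have S_abs: "\<bar>S i j\<bar> \<le> c" if ij: "i < p" "j < p" for i j
    using rho_bounds(4)[OF ij] sqrt_S_le(1)[OF ctx ij] by simp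
  have dev: "\<bar>sh i j \<omega> - S i j\<bar> \<le> c * (6 * c + 6) * lam" if "i < p" "j < p" for i j
    using sh_dev[OF ctx that] by (simp add: err_def mult_ac)
  have alarms: "real (card {(i, j). i < p \<and> j < p \<and> i \<noteq> j \<and> kept \<delta> i j \<omega> \<and> \<bar>S i j\<bar> \<le> a / c * lam}) \<le> N * real p"
  proof -
    have "{(i, j). i < p \<and> j < p \<and> i \<noteq> j \<and> kept \<delta> i j \<omega> \<and> \<bar>S i j\<bar> \<le> a / c * lam} \<subseteq> false_alarms a d \<omega>"
    proof clarify
      fix i j assume ij: "i < p" "j < p" "i \<noteq> j" and k: "kept \<delta> i j \<omega>" and small: "\<bar>S i j\<bar> \<le> a / c * lam"
      have "1 / c * (1 / c) \<le> S i i * S j j" using S_diag ij c0 by (intro mult_mono) (auto intro: less_imp_le)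
      hence "(1 / c)\<^sup>2 \<le> S i i * S j j" by (simp add: power2_eq_square)
      hence q: "1 / c \<le> sqrt (S i i * S j j)" by (rule real_le_rsqrt)
      have "\<bar>\<rho> i j\<bar> = \<bar>S i j\<bar> / sqrt (S i i * S j j)"
        using sqrt_S_le(2)[OF ctx ij(1,2)] by (simp add: \<rho>_def)
      also have "\<dots> \<le> (a / c * lam) / (1 / c)" using small q c0 by (intro frac_le) auto
      also have "\<dots> = a * lam" using c0 by simp
      finally show "(i, j) \<in> false_alarms a d \<omega>"
        using k ij by (intro kept_small_is_false_alarm[OF ctx ij]) (simp_all add: kept)
    qed
    moreover have "finite (false_alarms a d \<omega>)"
      by (rule finite_subset[of _ "{..<p} \<times> {..<p}"]) (auto simp: false_alarms_def)
    ultimately have "card {(i, j). i < p \<and> j < p \<and> i \<noteq> j \<and> kept \<delta> i j \<omega> \<and> \<bar>S i j\<bar> \<le> a / c * lam} \<le> card (false_alarms a d \<omega>)"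
      by (intro card_mono)
    also have "real (card (false_alarms a d \<omega>)) \<le> N * real p" using good by (simp add: good_def)
    finally show ?thesis by simp
  qed
  define S2 where "S2 = (\<Sum>i<p. \<Sum>j<p. (S i j)\<^sup>2)"
  have S2: "real p / c\<^sup>2 \<le> S2"
  proof -
    have "(\<Sum>i<p. (1 / c)\<^sup>2) \<le> (\<Sum>i<p. \<Sum>j<p. (S i j)\<^sup>2)"
    proof (rule sum_mono)
      fix i assume i: "i \<in> {..<p}"
      have "(1 / c)\<^sup>2 \<le> (S i i)\<^sup>2" using S_diag[of i] i c0 by (intro power_mono) auto
      also have "\<dots> \<le> (\<Sum>j<p. (S i j)\<^sup>2)" using i by (intro member_le_sum) auto
      finally show "(1 / c)\<^sup>2 \<le> (\<Sum>j<p. (S i j)\<^sup>2)" .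
    qed
    thus ?thesis by (simp add: S2_def power_divide)
  qed
  have "real p / c\<^sup>2 > 0" using p2 c0 by simp
  with S2 have S2p: "S2 > 0" by linarith
  define E where "E = sq_err \<tau> C a \<delta> r N"
  define f2 where "f2 = (frobenius_norm (Sigma_thr \<delta> (X \<omega>)))\<^sup>2"
  have sqerr: "\<bar>f2 - S2\<bar> \<le> E * lam powr q * real p"
    unfolding f2_def S2_def E_def q_def sq_err_def Let_def frobenius_Sigma_thr[OF \<omega>]
  proof (rule thresholded_sum_of_squares[OF \<tau> lam_pos lam1 S_abs c1 C dev _ _ _ alarms])
    show "\<bar>sh i j \<omega>\<bar> \<le> 2 * c * \<delta> * sqrt (1028 * c ^ 6 * N * (1 + r)) * lam"
      if "i < p" "j < p" "i \<noteq> j" "\<not> kept \<delta> i j \<omega>" for i j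
      using that by (intro killed_small[OF ctx that(1-3)]) (simp add: kept)
    show "0 < 2 * c * \<delta> * sqrt (1028 * c ^ 6 * N * (1 + r))" using c0 \<delta> N r0 by simp
    show "0 < c * (6 * c + 6)" using c0 by simp
    show "0 < a / c" using a c0 by simp
    show "a / c \<le> 1" using a c1 by (simp add: pos_divide_le_eq)
  qed
  have E0: "E * lam powr q \<ge> 0"
  proof -
    have "0 \<le> E * lam powr q * real p" using sqerr by linarith
    thus ?thesis using p2 by (simp add: zero_le_mult_iff)
  qed
  have "\<bar>x - 1\<bar> = \<bar>f2 - S2\<bar> / S2"
  proof -
    have "x - 1 = (f2 - S2) / S2" using S2p by (simp add: x_def f2_def S2_def[symmetric] diff_divide_distrib)
    thus ?thesis using S2p by simp
  qed
  also have "\<dots> \<le> (E * lam powr q * real p) / (real p / c\<^sup>2)"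
    using sqerr S2 E0 p2 c0 by (intro frac_le) auto
  also have "\<dots> = B * lam powr q" using p2 c0 by (simp add: B_def E_def)
  finally show x: "\<bar>x - 1\<bar> \<le> B * lam powr q" .
  define tS where "tS = (\<Sum>i<p. S i i)"
  have tS: "tS > 0" unfolding tS_def by (rule trace_S_pos[OF ctx])
  define y where "y = R \<omega> / (real n - 1) / tS"
  have e4: "0 < err" "err < 1 / 4" using err_bounds(1,2)[OF ctx] by (simp_all add: err_def)
  have y: "\<bar>y - 1\<bar> \<le> err"
  proof -
    have "\<bar>y - 1\<bar> = \<bar>R \<omega> / (real n - 1) - tS\<bar> / tS"
    proof -
      have "y - 1 = (R \<omega> / (real n - 1) - tS) / tS" using tS by (simp add: y_def diff_divide_distrib)
      thus ?thesis using tS by simp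
    qed
    also have "\<dots> \<le> err * tS / tS"
      using R_dev[OF ctx] tS by (intro divide_right_mono) (auto simp: err_def tS_def)
    finally show ?thesis using tS by simp
  qed
  hence y34: "3 / 4 \<le> y" "y \<le> 5 / 4" using e4 by (auto simp: abs_le_iff)
  have ratio: "A_ratio (Sigma_thr \<delta> (X \<omega>)) / (real p * S2 / tS\<^sup>2) = x / y\<^sup>2"
  proof -
    have "k * f / z\<^sup>2 / (k * b / h\<^sup>2) = f / b / (z / h)\<^sup>2" if "k > 0" "b > 0" "h > 0" for k f z b h :: real
      using that by (simp add: power_divide field_simps)
    from this[of "real p" S2 tS] show ?thesis
      using p2 S2p tS by (simp add: A_ratio_Sigma_thr[OF \<omega>] x_def y_def S2_def[symmetric])
  qed
  have lam_q: "lam \<le> lam powr q"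
  proof -
    have "q \<le> 1" by (simp add: q_def)
    hence "lam powr 1 \<le> lam powr q" using lam_pos lam1 by (intro powr_mono') auto
    thus ?thesis using lam_pos by simp
  qed
  have y2: "y\<^sup>2 \<ge> 1 / 2"
  proof -
    have "(3 / 4)\<^sup>2 \<le> y\<^sup>2" using y34 by (intro power_mono) auto
    thus ?thesis by (simp add: power2_eq_square)
  qed
  \<comment> \<open>Writes \<open>1 - y^2\<close> as \<open>(1 - y) * (1 + y)\<close>, so that the
    error of the trace enters linearly.\<close>
  have "x / y\<^sup>2 - 1 = ((x - 1) + (1 - y) * (1 + y)) / y\<^sup>2"
  proof -
    have "y \<noteq> 0" using y34 by simp
    thus ?thesis by (simp add: field_simps power2_eq_square)
  qed
  hence "\<bar>x / y\<^sup>2 - 1\<bar> = \<bar>(x - 1) + (1 - y) * (1 + y)\<bar> / y\<^sup>2" by (simp add: abs_divide)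
  also have "\<dots> \<le> (B * lam powr q + err * 3) / (1 / 2)"
  proof (rule frac_le)
    have "\<bar>(1 - y) * (1 + y)\<bar> \<le> err * 3" unfolding abs_mult
      using y y34 e4 by (intro mult_mono) auto
    with x show "\<bar>(x - 1) + (1 - y) * (1 + y)\<bar> \<le> B * lam powr q + err * 3" by linarith
    from x have "0 \<le> B * lam powr q" by linarith
    with e4 show "0 \<le> B * lam powr q + err * 3" by simp
  qed (use y2 in auto)
  also have "\<dots> = 2 * (B * lam powr q) + 6 * err" by simp
  also have "\<dots> \<le> 4 * (B * lam powr q) + 12 * ((6 * c + 6) * lam powr q)"
  proof (rule add_mono)
    from x have "0 \<le> B * lam powr q" by linarith
    thus "2 * (B * lam powr q) \<le> 4 * (B * lam powr q)" by simp
    have "6 * err \<le> 12 * err" using e4 by simp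
    also have "\<dots> \<le> 12 * ((6 * c + 6) * lam powr q)" unfolding err_def using lam_q c0 by simp
    finally show "6 * err \<le> 12 * ((6 * c + 6) * lam powr q)" .
  qed
  finally show "\<bar>A_ratio (Sigma_thr \<delta> (X \<omega>)) / (real p * (\<Sum>i<p. \<Sum>j<p. (S i j)\<^sup>2) / (\<Sum>i<p. S i i)\<^sup>2) - 1\<bar>
      \<le> (4 * B + 12 * (6 * c + 6)) * lam powr q"
    unfolding ratio[unfolded S2_def tS_def] by (simp add: algebra_simps)
qed

end

section \<open>From the matrix-variate normal law to the centred array\<close>

lemma sum_div_mod:
  fixes f :: "nat \<Rightarrow> nat \<Rightarrow> real"
  assumes "n > 0"
  shows "(\<Sum>r<n * p. f (r div n) (r mod n)) = (\<Sum>k<p. \<Sum>i<n. f k i)"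
proof -
  have "(\<Sum>r<n * p. f (r div n) (r mod n)) = (\<Sum>k<p. \<Sum>r\<in>{k * n..<k * n + n}. f (r div n) (r mod n))"
    using sum.nat_group[of "\<lambda>r. f (r div n) (r mod n)" n p] by (simp add: mult.commute)
  also have "\<dots> = (\<Sum>k<p. \<Sum>i<n. f k i)"
  proof (rule sum.cong[OF refl])
    fix k
    have "(\<Sum>r\<in>{k * n..<k * n + n}. f (r div n) (r mod n)) = (\<Sum>i\<in>{0..<n}. f ((i + k * n) div n) ((i + k * n) mod n))"
      using sum.shift_bounds_nat_ivl[of "\<lambda>r. f (r div n) (r mod n)" 0 "k * n" n] by (simp add: add.commute)
    also have "\<dots> = (\<Sum>i<n. f k i)" using assms by (intro sum.cong) auto
    finally show "(\<Sum>r\<in>{k * n..<k * n + n}. f (r div n) (r mod n)) = (\<Sum>i<n. f k i)" .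
  qed
  finally show ?thesis .
qed

text \<open>Stacking the columns of the transposed data puts entry \<open>(k, i)\<close> at position
  \<open>k * n + i\<close>, which matches the block structure of
  \<open>kronecker \<Sigma> \<Psi>\<close>; a coefficient array is flattened in the same
  way.\<close>

lemma matrix_normal_linear_combination:
  assumes mn: "matrix_normal M X (mat p n (\<lambda>(k, i). \<mu> $ k)) \<Sigma> \<Psi>"
    and \<Sigma>: "\<Sigma> \<in> carrier_mat p p" and \<Psi>: "\<Psi> \<in> carrier_mat n n" and n: "n > 0"
  shows "(\<lambda>\<omega>. \<Sum>k<p. \<Sum>i<n. \<beta> k i * X \<omega> $$ (k, i)) \<in> borel_measurable M"
    and "distr M borel (\<lambda>\<omega>. \<Sum>k<p. \<Sum>i<n. \<beta> k i * X \<omega> $$ (k, i))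
      = normal_measure (\<Sum>k<p. \<Sum>i<n. \<beta> k i * \<mu> $ k)
          (\<Sum>k<p. \<Sum>m<p. \<Sigma> $$ (k, m) * (\<Sum>i<n. \<Sum>j<n. \<Psi> $$ (i, j) * \<beta> k i * \<beta> m j))"
proof -
  let ?\<mu> = "mat p n (\<lambda>(k, i). \<mu> $ k)"
  define a where "a = vec (n * p) (\<lambda>r. \<beta> (r div n) (r mod n))"
  have X: "X \<omega> \<in> carrier_mat p n" if "\<omega> \<in> space M" for \<omega>
    using mn that by (auto simp: matrix_normal_def)
  have idx: "r div n < p" "r mod n < n" if "r < n * p" for r
    using that n by (auto simp: less_mult_imp_div_less mult.commute)
  have vecz: "a \<bullet> vectorize (transpose_mat A) = (\<Sum>k<p. \<Sum>i<n. \<beta> k i * A $$ (k, i))" if A: "A \<in> carrier_mat p n" for A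
  proof -
    have "a \<bullet> vectorize (transpose_mat A) = (\<Sum>r<n * p. a $ r * vectorize (transpose_mat A) $ r)"
      using A by (simp add: scalar_prod_def vectorize_def atLeast0LessThan)
    also have "\<dots> = (\<Sum>r<n * p. \<beta> (r div n) (r mod n) * A $$ (r div n, r mod n))"
    proof (rule sum.cong[OF refl])
      fix r assume "r \<in> {..<n * p}"
      thus "a $ r * vectorize (transpose_mat A) $ r = \<beta> (r div n) (r mod n) * A $$ (r div n, r mod n)"
        using A idx[of r] by (simp add: a_def vectorize_def)
    qed
    also have "\<dots> = (\<Sum>k<p. \<Sum>i<n. \<beta> k i * A $$ (k, i))"
      by (rule sum_div_mod[OF n, of "\<lambda>k i. \<beta> k i * A $$ (k, i)"])
    finally show ?thesis .
  qed
  define m where "m = vectorize (transpose_mat ?\<mu>)"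
  have dm: "dim_vec m = n * p" by (simp add: m_def vectorize_def)
  have am: "a \<bullet> m = (\<Sum>k<p. \<Sum>i<n. \<beta> k i * \<mu> $ k)"
    unfolding m_def by (subst vecz) (auto intro!: sum.cong)
  have K: "kronecker \<Sigma> \<Psi> $$ (r, s) = \<Sigma> $$ (r div n, s div n) * \<Psi> $$ (r mod n, s mod n)" if "r < n * p" "s < n * p" for r s
    using \<Sigma> \<Psi> that by (simp add: kronecker_def mult.commute)
  have dK: "dim_row (kronecker \<Sigma> \<Psi>) = n * p" "dim_col (kronecker \<Sigma> \<Psi>) = n * p"
    using \<Sigma> \<Psi> by (simp_all add: kronecker_def mult.commute)
  have aK: "a \<bullet> (kronecker \<Sigma> \<Psi> *\<^sub>v a) = (\<Sum>k<p. \<Sum>m<p. \<Sigma> $$ (k, m) * (\<Sum>i<n. \<Sum>j<n. \<Psi> $$ (i, j) * \<beta> k i * \<beta> m j))"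
  proof -
    have "a \<bullet> (kronecker \<Sigma> \<Psi> *\<^sub>v a) = (\<Sum>r<n * p. a $ r * (\<Sum>s<n * p. kronecker \<Sigma> \<Psi> $$ (r, s) * a $ s))"
      using dK by (simp add: scalar_prod_def atLeast0LessThan a_def)
    also have "\<dots> = (\<Sum>r<n * p. \<beta> (r div n) (r mod n) * (\<Sum>s<n * p. \<Sigma> $$ (r div n, s div n) * \<Psi> $$ (r mod n, s mod n) * \<beta> (s div n) (s mod n)))"
      by (intro sum.cong refl arg_cong2[where f="(*)"]) (auto simp: a_def K)
    also have "\<dots> = (\<Sum>r<n * p. \<beta> (r div n) (r mod n) * (\<Sum>m<p. \<Sum>j<n. \<Sigma> $$ (r div n, m) * \<Psi> $$ (r mod n, j) * \<beta> m j))"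
      by (intro sum.cong refl arg_cong2[where f="(*)"] sum_div_mod[OF n, of "\<lambda>m j. \<Sigma> $$ (_, m) * \<Psi> $$ (_, j) * \<beta> m j"])
    also have "\<dots> = (\<Sum>k<p. \<Sum>i<n. \<beta> k i * (\<Sum>m<p. \<Sum>j<n. \<Sigma> $$ (k, m) * \<Psi> $$ (i, j) * \<beta> m j))"
      by (rule sum_div_mod[OF n, of "\<lambda>k i. \<beta> k i * (\<Sum>m<p. \<Sum>j<n. \<Sigma> $$ (k, m) * \<Psi> $$ (i, j) * \<beta> m j)"])
    also have "\<dots> = (\<Sum>k<p. \<Sum>i<n. \<Sum>m<p. \<Sum>j<n. \<Sigma> $$ (k, m) * (\<Psi> $$ (i, j) * \<beta> k i * \<beta> m j))"
      by (simp add: sum_distrib_left mult_ac)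
    also have "\<dots> = (\<Sum>k<p. \<Sum>m<p. \<Sum>i<n. \<Sum>j<n. \<Sigma> $$ (k, m) * (\<Psi> $$ (i, j) * \<beta> k i * \<beta> m j))"
      by (rule sum.cong[OF refl], rule sum.swap)
    finally show ?thesis by (simp add: sum_distrib_left)
  qed
  have ac: "a \<in> carrier_vec (dim_vec m)" by (simp add: a_def dm)
  have mv: "(\<lambda>\<omega>. a \<bullet> vectorize (transpose_mat (X \<omega>))) \<in> borel_measurable M"
    "distr M borel (\<lambda>\<omega>. a \<bullet> vectorize (transpose_mat (X \<omega>))) = normal_measure (a \<bullet> m) (a \<bullet> (kronecker \<Sigma> \<Psi> *\<^sub>v a))"
    using mn ac unfolding matrix_normal_def multivariate_normal_def m_def by blast+
  have eq: "a \<bullet> vectorize (transpose_mat (X \<omega>)) = (\<Sum>k<p. \<Sum>i<n. \<beta> k i * X \<omega> $$ (k, i))" if "\<omega> \<in> space M" for \<omega>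
    using vecz[OF X[OF that]] .
  show "(\<lambda>\<omega>. \<Sum>k<p. \<Sum>i<n. \<beta> k i * X \<omega> $$ (k, i)) \<in> borel_measurable M"
    using mv(1) by (subst measurable_cong[OF eq[symmetric]])
  have "distr M borel (\<lambda>\<omega>. \<Sum>k<p. \<Sum>i<n. \<beta> k i * X \<omega> $$ (k, i)) = distr M borel (\<lambda>\<omega>. a \<bullet> vectorize (transpose_mat (X \<omega>)))"
    by (intro distr_cong refl) (simp add: eq)
  thus "distr M borel (\<lambda>\<omega>. \<Sum>k<p. \<Sum>i<n. \<beta> k i * X \<omega> $$ (k, i))
      = normal_measure (\<Sum>k<p. \<Sum>i<n. \<beta> k i * \<mu> $ k)
          (\<Sum>k<p. \<Sum>m<p. \<Sigma> $$ (k, m) * (\<Sum>i<n. \<Sum>j<n. \<Psi> $$ (i, j) * \<beta> k i * \<beta> m j))"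
    using mv(2) by (simp only: am aK)
qed

section \<open>The centring projection \<open>P\<close> and the covariance of centred
  observations\<close>

definition centered :: "nat \<Rightarrow> (nat \<Rightarrow> real) \<Rightarrow> nat \<Rightarrow> real" where
  "centered n x i = x i - (\<Sum>j<n. x j) / real n"

definition centering :: "nat \<Rightarrow> nat \<Rightarrow> nat \<Rightarrow> real" where
  "centering n i j = of_bool (i = j) - 1 / real n"

text \<open>This is \<open>P\<Psi>P\<close>, as \<open>P\<close> is symmetric.\<close>

definition centered_cov :: "nat \<Rightarrow> (nat \<Rightarrow> nat \<Rightarrow> real) \<Rightarrow> nat \<Rightarrow> nat \<Rightarrow> real" where
  "centered_cov n \<Psi> i j = (\<Sum>k<n. \<Sum>m<n. \<Psi> k m * centering n i k * centering n j m)"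

lemma centered_eq_sum:
  assumes "k < n"
  shows "centered n x k = (\<Sum>i<n. x i * centering n i k)"
proof -
  have "(\<Sum>i<n. x i * centering n i k) = (\<Sum>i<n. if i = k then x i else 0) - (\<Sum>i<n. x i / real n)"
    unfolding sum_subtractf[symmetric] by (intro sum.cong) (auto simp: centering_def algebra_simps)
  thus ?thesis using assms by (simp add: centered_def sum_divide_distrib)
qed

lemma centered_cov_form:
  "(\<Sum>i<n. \<Sum>j<n. centered_cov n \<Psi> i j * x i * y j) = (\<Sum>k<n. \<Sum>m<n. \<Psi> k m * centered n x k * centered n y m)"
proof -
  have "(\<Sum>k<n. \<Sum>m<n. \<Psi> k m * centered n x k * centered n y m)
    = (\<Sum>k<n. \<Sum>m<n. \<Psi> k m * ((\<Sum>i<n. x i * centering n i k) * (\<Sum>j<n. y j * centering n j m)))"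
    by (intro sum.cong refl) (simp add: centered_eq_sum)
  also have "\<dots> = (\<Sum>k<n. \<Sum>m<n. \<Sum>i<n. \<Sum>j<n. \<Psi> k m * centering n i k * centering n j m * x i * y j)"
    unfolding sum_product by (simp add: sum_distrib_left mult_ac)
  also have "\<dots> = (\<Sum>i<n. \<Sum>j<n. \<Sum>k<n. \<Sum>m<n. \<Psi> k m * centering n i k * centering n j m * x i * y j)"
    by (rule sum_swap4)
  also have "\<dots> = (\<Sum>i<n. \<Sum>j<n. centered_cov n \<Psi> i j * x i * y j)"
    by (simp add: centered_cov_def sum_distrib_right)
  finally show ?thesis by simp
qed

lemma centered_sum_squares_le:
  assumes "n > 0"
  shows "(\<Sum>i<n. (centered n x i)\<^sup>2) \<le> (\<Sum>i<n. (x i)\<^sup>2)"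
proof -
  define \<mu> where "\<mu> = (\<Sum>j<n. x j) / real n"
  have "(\<Sum>i<n. (centered n x i)\<^sup>2) = (\<Sum>i<n. (x i)\<^sup>2) - 2 * \<mu> * (\<Sum>i<n. x i) + real n * \<mu>\<^sup>2"
    by (simp add: centered_def \<mu>_def[symmetric] power2_diff sum.distrib sum_subtractf sum_distrib_left mult_ac)
  also have "(\<Sum>i<n. x i) = real n * \<mu>" using assms by (simp add: \<mu>_def)
  finally have "(\<Sum>i<n. (centered n x i)\<^sup>2) = (\<Sum>i<n. (x i)\<^sup>2) - real n * \<mu>\<^sup>2" by (simp add: power2_eq_square)
  thus ?thesis by simp
qed

lemma centering_gram:
  assumes "k < n" "m < n"
  shows "(\<Sum>i<n. centering n i k * centering n i m) = of_bool (k = m) - 1 / real n"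
proof -
  have "(\<Sum>i<n. centering n i k * centering n i m) = centered n (\<lambda>i. centering n i k) m"
    using assms by (simp add: centered_eq_sum)
  moreover have "(\<Sum>i<n. centering n i k) = 0"
  proof -
    have "(\<Sum>i<n. centering n i k) = (\<Sum>i<n. if i = k then 1 else 0) - (\<Sum>i<n. 1 / real n)"
      unfolding sum_subtractf[symmetric] by (intro sum.cong) (auto simp: centering_def)
    thus ?thesis using assms by simp
  qed
  ultimately show ?thesis by (auto simp: centered_def centering_def)
qed

text \<open>\<open>P\<close> is idempotent, so the trace of \<open>P\<Psi>P\<close> is that of
  \<open>P\<Psi>\<close>: the trace \<open>n\<close> of \<open>\<Psi>\<close> minus the form of
  \<open>\<Psi>\<close> at the all-ones vector divided by \<open>n\<close>.\<close>

lemma centered_cov_trace: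
  assumes diag: "\<And>i. i < n \<Longrightarrow> \<Psi> i i = 1"
  shows "(\<Sum>i<n. centered_cov n \<Psi> i i) = real n - (\<Sum>k<n. \<Sum>m<n. \<Psi> k m) / real n"
proof -
  have "(\<Sum>i<n. centered_cov n \<Psi> i i) = (\<Sum>i<n. \<Sum>k<n. \<Sum>m<n. \<Psi> k m * (centering n i k * centering n i m))"
    by (simp add: centered_cov_def mult.assoc)
  also have "\<dots> = (\<Sum>k<n. \<Sum>i<n. \<Sum>m<n. \<Psi> k m * (centering n i k * centering n i m))" by (rule sum.swap)
  also have "\<dots> = (\<Sum>k<n. \<Sum>m<n. \<Sum>i<n. \<Psi> k m * (centering n i k * centering n i m))"
    by (rule sum.cong[OF refl], rule sum.swap)
  also have "\<dots> = (\<Sum>k<n. \<Sum>m<n. \<Psi> k m * (of_bool (k = m) - 1 / real n))"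
    by (intro sum.cong refl) (simp add: centering_gram flip: sum_distrib_left)
  also have "\<dots> = (\<Sum>k<n. (\<Sum>m<n. if m = k then \<Psi> k m else 0) - (\<Sum>m<n. \<Psi> k m / real n))"
    unfolding sum_subtractf[symmetric] by (intro sum.cong) (auto simp: algebra_simps)
  also have "\<dots> = (\<Sum>k<n. 1 - (\<Sum>m<n. \<Psi> k m / real n))"
    by (intro sum.cong refl) (simp add: diag)
  finally show ?thesis by (simp add: sum_subtractf sum_divide_distrib)
qed

text \<open>Centring is a contraction, so the eigenvalues of \<open>P\<Psi>P\<close> inherit the
  bounds 0 and \<open>c\<close> from \<open>\<Psi>\<close>. The unknown mean disappears, and
  Parseval in the eigenbasis identifies the Gram entries \<open>V\<close> with sums of products of
  centred data.\<close>

lemma data_sample_exists: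
  assumes prob: "prob_space M"
    and cov: "covariance_mat p \<Sigma>" "covariance_mat n \<Psi>" and diag: "\<And>i. i < n \<Longrightarrow> \<Psi> $$ (i, i) = 1"
    and mn: "matrix_normal M X (mat p n (\<lambda>(k, i). \<mu> $ k)) \<Sigma> \<Psi>"
    and \<Sigma>_bounds: "1 / c \<le> lambda_min \<Sigma>" "lambda_max \<Sigma> \<le> c"
    and \<Psi>_bounds: "1 / c \<le> lambda_min \<Psi>" "lambda_max \<Psi> \<le> c"
    and c: "c \<ge> 1" and p: "p \<ge> 2" and n: "n \<ge> 1" "2 * c \<le> real n"
  shows "\<exists>l G w s. data_sample M p n (\<lambda>i j. \<Sigma> $$ (i, j)) l G w s c X"
proof -
  interpret prob_space M by fact
  let ?S = "\<lambda>i j. \<Sigma> $$ (i, j)" and ?P = "\<lambda>i j. \<Psi> $$ (i, j)"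
  have carr: "\<Sigma> \<in> carrier_mat p p" "\<Psi> \<in> carrier_mat n n" using cov by (auto simp: covariance_mat_def)
  have n0: "n > 0" using n by simp
  have symm: "A $$ (i, j) = A $$ (j, i)" if "covariance_mat d A" "i < d" "j < d" for A d i j
    using that unfolding covariance_mat_def by (metis carrier_matD index_transpose_mat(1))
  have \<Sigma>_sym: "?S i j = ?S j i" if "i < p" "j < p" for i j using symm[OF cov(1) that] .
  have \<Psi>_sym: "?P i j = ?P j i" if "i < n" "j < n" for i j using symm[OF cov(2) that] .
  obtain w s where sd\<Sigma>: "spectral_decomp p ?S w s" using spectral_decomp_exists[of p ?S] \<Sigma>_sym by auto
  have s: "1 / c \<le> s k \<and> s k \<le> c" if "k < p" for k
    using spectral_decomp_lambda_bounds[OF carr(1) sd\<Sigma> that] \<Sigma>_bounds by linarith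
  obtain w' s' where sd\<Psi>: "spectral_decomp n ?P w' s'" using spectral_decomp_exists[of n ?P] \<Psi>_sym by auto
  have c0: "1 / c > 0" "c > 0" using c by simp_all
  have s': "0 \<le> s' k" "s' k \<le> c" if "k < n" for k
    using spectral_decomp_lambda_bounds[OF carr(2) sd\<Psi> that] \<Psi>_bounds c0 by linarith+
  have form: "0 \<le> (\<Sum>i<n. \<Sum>j<n. ?P i j * x i * x j)" "(\<Sum>i<n. \<Sum>j<n. ?P i j * x i * x j) \<le> c * (\<Sum>i<n. (x i)\<^sup>2)" for x
    using spectral_decomp_form_bounds[OF sd\<Psi>, of 0 c x] s' by auto
  let ?Q = "centered_cov n ?P"
  have Q_sym: "?Q i j = ?Q j i" for i j
  proof -
    have "?Q i j = (\<Sum>k<n. \<Sum>m<n. ?P m k * centering n j m * centering n i k)"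
      unfolding centered_cov_def by (intro sum.cong refl) (simp add: \<Psi>_sym)
    also have "\<dots> = ?Q j i" unfolding centered_cov_def by (rule sum.swap)
    finally show ?thesis .
  qed
  obtain u l where sdQ: "spectral_decomp n ?Q u l" using spectral_decomp_exists[of n ?Q] Q_sym by auto
  have l: "0 \<le> l a" "l a \<le> c" if a: "a < n" for a
  proof -
    have e: "l a = (\<Sum>k<n. \<Sum>m<n. ?P k m * centered n (u a) k * centered n (u a) m)"
      using spectral_decomp_eigenvalue[OF sdQ a] by (simp only: centered_cov_form)
    show "0 \<le> l a" unfolding e by (rule form)
    have "l a \<le> c * (\<Sum>i<n. (centered n (u a) i)\<^sup>2)" unfolding e by (rule form)
    also have "\<dots> \<le> c * (\<Sum>i<n. (u a i)\<^sup>2)"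
      using centered_sum_squares_le[OF n0] c0 by (intro mult_left_mono) auto
    also have "(\<Sum>i<n. (u a i)\<^sup>2) = 1"
      using spectral_decomp_orthonormal[OF sdQ a a] by (simp add: power2_eq_square)
    finally show "l a \<le> c" by simp
  qed
  have tr: "(\<Sum>a<n. l a) = real n - (\<Sum>k<n. \<Sum>m<n. ?P k m) / real n"
    using spectral_decomp_trace[OF sdQ] centered_cov_trace[of n ?P] diag by simp
  \<comment> \<open>The form of \<open>\<Psi>\<close> at the all-ones vector, whose squared norm is
    \<open>n\<close>.\<close>
  have ones: "0 \<le> (\<Sum>k<n. \<Sum>m<n. ?P k m) / real n" "(\<Sum>k<n. \<Sum>m<n. ?P k m) / real n \<le> c"
    using form[of "\<lambda>_. 1"] n0 by (simp_all add: pos_divide_le_eq)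
  \<comment> \<open>The trace is at least \<open>n - c\<close>, hence at least \<open>n / 2\<close>
    by \<open>2 * c \<le> n\<close>; Cauchy-Schwarz converts this into a bound on the sum of
    squares.\<close>
  have F: "real n / 4 \<le> (\<Sum>a<n. (l a)\<^sup>2)"
  proof -
    have "(real n / 2)\<^sup>2 \<le> (\<Sum>a<n. l a)\<^sup>2" using tr ones n(2) by (intro power_mono) auto
    also have "\<dots> \<le> real n * (\<Sum>a<n. (l a)\<^sup>2)"
      using Cauchy_Schwarz_ineq_sum[of "\<lambda>_. 1" l "{..<n}"] by simp
    finally show ?thesis using n0 by (simp add: power2_eq_square field_simps)
  qed
  have X_dim: "X \<omega> \<in> carrier_mat p n" if "\<omega> \<in> space M" for \<omega>
    using mn that by (auto simp: matrix_normal_def)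
  note lin = matrix_normal_linear_combination[OF mn carr n0]
  have X_meas: "(\<lambda>\<omega>. X \<omega> $$ (k, i)) \<in> borel_measurable M" if "k < p" "i < n" for k i
  proof -
    have "(\<Sum>k'<p. \<Sum>i'<n. (if k' = k then if i' = i then 1 else 0 else 0) * X \<omega> $$ (k', i')) = X \<omega> $$ (k, i)" for \<omega>
    proof -
      have "(\<Sum>k'<p. \<Sum>i'<n. (if k' = k then if i' = i then 1 else 0 else 0) * X \<omega> $$ (k', i'))
        = (\<Sum>k'<p. if k' = k then \<Sum>i'<n. if i' = i then X \<omega> $$ (k', i') else 0 else 0)"
        by (intro sum.cong refl) (simp add: if_distrib[of "\<lambda>x. x * _"] cong: if_cong)
      thus ?thesis using that by simp
    qed
    with lin(1)[of "\<lambda>k' i'. if k' = k then if i' = i then 1 else 0 else 0"] show ?thesis by (simp only:)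
  qed
  define Y where "Y k i \<omega> = centered n (\<lambda>i. X \<omega> $$ (k, i)) i" for k i \<omega>
  have Y_meas: "Y k i \<in> borel_measurable M" if "k < p" "i < n" for k i
    unfolding Y_def centered_def using X_meas that
    by (intro borel_measurable_diff borel_measurable_divide borel_measurable_sum) auto
  have Y_law: "distr M borel (\<lambda>\<omega>. \<Sum>k<p. \<Sum>i<n. \<alpha> k i * Y k i \<omega>)
        = normal_measure 0 (\<Sum>k<p. \<Sum>m<p. ?S k m * (\<Sum>i<n. \<Sum>j<n. ?Q i j * \<alpha> k i * \<alpha> m j))" for \<alpha>
  proof -
    \<comment> \<open>Centring moves from the data to the coefficients. Centred coefficients sum to
      0 in every row, which cancels the mean.\<close>
    have self_adj: "(\<Sum>i<n. x i * centered n y i) = (\<Sum>i<n. centered n x i * y i)" for x y :: "nat \<Rightarrow> real"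
      by (simp add: centered_def algebra_simps sum_subtractf flip: sum_distrib_left sum_distrib_right sum_divide_distrib)
    have "(\<Sum>i<n. centered n (\<alpha> k) i) = 0" for k
      using self_adj[of "\<lambda>_. 1" "\<alpha> k"] n0 by (simp add: centered_def)
    hence mean: "(\<Sum>k<p. \<Sum>i<n. centered n (\<alpha> k) i * \<mu> $ k) = 0" by (simp flip: sum_distrib_right)
    have "(\<lambda>\<omega>. \<Sum>k<p. \<Sum>i<n. \<alpha> k i * Y k i \<omega>) = (\<lambda>\<omega>. \<Sum>k<p. \<Sum>i<n. centered n (\<alpha> k) i * X \<omega> $$ (k, i))"
      by (simp add: Y_def self_adj)
    thus ?thesis using lin(2)[of "\<lambda>k. centered n (\<alpha> k)"] by (simp only: mean centered_cov_form)
  qed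
  define G where "G k a \<omega> = (\<Sum>i<n. u a i * Y k i \<omega>)" for k a \<omega>
  have ga: "gauss_array M p n ?S l G"
    unfolding G_def using Y_meas Y_law sdQ l(1) by (rule gauss_array_rotate_cols)
  have gs: "gauss_sample M p n ?S l G w s c"
    by unfold_locales (use ga \<Sigma>_sym sd\<Sigma> s c l p n tr ones F in auto)
  interpret gauss_sample M p n ?S l G w s c by (rule gs)
  have "data_sample M p n ?S l G w s c X"
  proof (unfold_locales)
    fix \<omega> i j assume \<omega>: "\<omega> \<in> space M" and ij: "i < p" "j < p"
    have "V i j \<omega> = (\<Sum>a<n. (\<Sum>k<n. u a k * Y i k \<omega>) * (\<Sum>k<n. u a k * Y j k \<omega>))"
      by (simp add: V_def G_def)
    also have "\<dots> = (\<Sum>k<n. Y i k \<omega> * Y j k \<omega>)" by (rule spectral_decomp_parseval[OF sdQ])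
    finally show "V i j \<omega> = (\<Sum>k<n. (X \<omega> $$ (i, k) - sample_mean (X \<omega>) i) * (X \<omega> $$ (j, k) - sample_mean (X \<omega>) j))"
      using X_dim[OF \<omega>] by (simp add: Y_def centered_def sample_mean_def)
  qed (use X_dim X_meas in auto)
  thus ?thesis by blast
qed

section \<open>Asymptotics\<close>

text \<open>The result at one fixed \<open>n\<close>, with every requirement an explicit inequality;
  the asymptotic statement then only has to check that these hold eventually, with parameters chosen
  independently of \<open>n\<close>.\<close>

lemma estimation_error_probability:
  fixes \<tau> c d a \<eta> \<kappa> \<delta> r N C :: real
  assumes prob: "prob_space M"
    and cov: "covariance_mat p \<Sigma>" "covariance_mat n \<Psi>" and diag: "\<And>i. i < n \<Longrightarrow> \<Psi> $$ (i, i) = 1"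
    and mn: "matrix_normal M X (mat p n (\<lambda>(k, i). \<mu> $ k)) \<Sigma> \<Psi>"
    and \<Sigma>_bounds: "1 / c \<le> lambda_min \<Sigma>" "lambda_max \<Sigma> \<le> c"
    and \<Psi>_bounds: "1 / c \<le> lambda_min \<Psi>" "lambda_max \<Psi> \<le> c"
    and c: "c \<ge> 1" and p: "p \<ge> 2" and n: "n \<ge> 2" "2 * c \<le> real n"
    and \<tau>: "0 < \<tau>" "\<tau> < 2" and C: "\<And>i. i < p \<Longrightarrow> (\<Sum>j<p. \<bar>\<Sigma> $$ (i, j)\<bar> powr \<tau>) \<le> C"
    and d: "d > 0" and margin: "d\<^sup>2 / 2 - 2 * a * d - \<kappa> * d\<^sup>2 / 2 \<ge> 1" and a: "a > 0" "a \<le> 1"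
    and \<eta>: "0 < \<eta>" "\<eta> < 1" and N: "N > 0" and \<delta>: "\<delta> > 0" and r: "real n \<le> r * real p"
    and lam: "lam = sqrt (ln (real p) / real n)" "lam \<le> 1" "1 \<le> real n * lam"
    and small: "4 * c * lam \<le> 1" "8 * d * c * lam \<le> 1" "(1 + (a * lam)\<^sup>2) * (1 + 8 * d * c * lam) \<le> 1 + \<kappa>"
      "4 * c\<^sup>2 * ((6 * c + 6) * lam) < 1" "4 * (a + (6 * c + 6))\<^sup>2 * lam\<^sup>2 \<le> 1" "c ^ 4 / real p \<le> 1"
    and h3: "d \<le> (1 - 4 * (a + (6 * c + 6))\<^sup>2 * lam\<^sup>2) * (1 - (6 * c + 6) * lam) * ((real n - 1) / real n)
        * (\<delta> * sqrt ((1 - \<eta>) * (1 - c ^ 4 / real p)) / (1 + (6 * c + 6) * lam))"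
  defines "q \<equiv> min 1 (2 - \<tau>)" and "B \<equiv> c\<^sup>2 * data_sample.sq_err c \<tau> C a \<delta> r N"
    and "P \<equiv> 1 - (2 / real p + 2 ^ 23 * c ^ 8 / (\<eta>\<^sup>2 * real p) + 3 / N)"
  shows "measure M {\<omega> \<in> space M. \<bar>(frobenius_norm (Sigma_thr \<delta> (X \<omega>)))\<^sup>2 / (frobenius_norm \<Sigma>)\<^sup>2 - 1\<bar> \<le> B * lam powr q} \<ge> P"
    and "measure M {\<omega> \<in> space M. \<bar>A_ratio (Sigma_thr \<delta> (X \<omega>)) / A_ratio \<Sigma> - 1\<bar> \<le> (4 * B + 12 * (6 * c + 6)) * lam powr q} \<ge> P"
proof -
  interpret prob_space M by fact
  have "\<exists>l G w s. data_sample M p n (\<lambda>i j. \<Sigma> $$ (i, j)) l G w s c X"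
    by (rule data_sample_exists[OF prob cov diag mn \<Sigma>_bounds \<Psi>_bounds c p _ n(2)]) (use n in auto)
  then obtain l G w s where ds: "data_sample M p n (\<lambda>i j. \<Sigma> $$ (i, j)) l G w s c X" by blast
  interpret ds: data_sample M p n "\<lambda>i j. \<Sigma> $$ (i, j)" l G w s c X by (rule ds)
  have L: "ds.lam = lam" by (simp add: ds.lam_def lam(1))
  have carr: "\<Sigma> \<in> carrier_mat p p" using cov by (auto simp: covariance_mat_def)
  have f\<Sigma>: "(frobenius_norm \<Sigma>)\<^sup>2 = (\<Sum>i<p. \<Sum>j<p. (\<Sigma> $$ (i, j))\<^sup>2)"
    using carr by (simp add: frobenius_norm_squared)
  have A\<Sigma>: "A_ratio \<Sigma> = real p * (\<Sum>i<p. \<Sum>j<p. (\<Sigma> $$ (i, j))\<^sup>2) / (\<Sum>i<p. \<Sigma> $$ (i, i))\<^sup>2"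
    using carr by (simp add: A_ratio_def f\<Sigma> mat_trace_def)
  obtain A where A: "A \<in> sets M" "P \<le> prob A" "\<And>\<omega>. \<omega> \<in> A \<Longrightarrow> \<omega> \<in> space M" "\<And>\<omega>. \<omega> \<in> A \<Longrightarrow> ds.good a d \<eta> N \<omega>"
    using ds.good_event[of \<eta> N d a \<kappa>] \<eta> N d margin a small unfolding L P_def by auto
  have err: "\<bar>(frobenius_norm (Sigma_thr \<delta> (X \<omega>)))\<^sup>2 / (frobenius_norm \<Sigma>)\<^sup>2 - 1\<bar> \<le> B * lam powr q"
    "\<bar>A_ratio (Sigma_thr \<delta> (X \<omega>)) / A_ratio \<Sigma> - 1\<bar> \<le> (4 * B + 12 * (6 * c + 6)) * lam powr q" if \<omega>: "\<omega> \<in> A" for \<omega>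
    unfolding f\<Sigma> A\<Sigma> B_def q_def
    by (rule ds.estimation_error[OF A(4,3)[OF \<omega>], unfolded L]; fact n(1) lam small \<eta> N a \<delta> h3 r \<tau> C)+
  have m: "(\<lambda>\<omega>. (frobenius_norm (Sigma_thr \<delta> (X \<omega>)))\<^sup>2) \<in> borel_measurable M" "(\<lambda>\<omega>. A_ratio (Sigma_thr \<delta> (X \<omega>))) \<in> borel_measurable M"
    by (rule ds.frobenius_Sigma_thr_measurable ds.A_ratio_Sigma_thr_measurable)+
  note [measurable] = m
  have "prob A \<le> prob {\<omega> \<in> space M. \<bar>(frobenius_norm (Sigma_thr \<delta> (X \<omega>)))\<^sup>2 / (frobenius_norm \<Sigma>)\<^sup>2 - 1\<bar> \<le> B * lam powr q}"
    using A(3) err(1) by (intro finite_measure_mono) (auto, measurable)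
  with A(2) show "prob {\<omega> \<in> space M. \<bar>(frobenius_norm (Sigma_thr \<delta> (X \<omega>)))\<^sup>2 / (frobenius_norm \<Sigma>)\<^sup>2 - 1\<bar> \<le> B * lam powr q} \<ge> P"
    by linarith
  have "prob A \<le> prob {\<omega> \<in> space M. \<bar>A_ratio (Sigma_thr \<delta> (X \<omega>)) / A_ratio \<Sigma> - 1\<bar> \<le> (4 * B + 12 * (6 * c + 6)) * lam powr q}"
    using A(3) err(2) by (intro finite_measure_mono) (auto, measurable)
  with A(2) show "prob {\<omega> \<in> space M. \<bar>A_ratio (Sigma_thr \<delta> (X \<omega>)) / A_ratio \<Sigma> - 1\<bar> \<le> (4 * B + 12 * (6 * c + 6)) * lam powr q} \<ge> P"
    by linarith
qed

theorem theorem2p1: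
  fixes M :: "nat \<Rightarrow> 'a measure"
    and p :: "nat \<Rightarrow> nat"
    and X :: "nat \<Rightarrow> 'a \<Rightarrow> real mat"
    and \<mu> :: "nat \<Rightarrow> real vec"
    and \<Sigma> \<Psi> :: "nat \<Rightarrow> real mat"
    and c\<^sub>1 C c\<^sub>3 \<tau> \<epsilon> \<delta> :: real
  assumes prob: "\<And>n. n \<ge> 1 \<Longrightarrow> prob_space (M n)"
    and mean: "\<And>n. n \<ge> 1 \<Longrightarrow> \<mu> n \<in> carrier_vec (p n)"
    and cov_Sigma: "\<And>n. n \<ge> 1 \<Longrightarrow> covariance_mat (p n) (\<Sigma> n)"
    and cov_Psi: "\<And>n. n \<ge> 1 \<Longrightarrow> covariance_mat n (\<Psi> n)"
    and Psi_diag: "\<And>n i. n \<ge> 1 \<Longrightarrow> i < n \<Longrightarrow> \<Psi> n $$ (i, i) = 1"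
    and normal: "\<And>n. n \<ge> 1 \<Longrightarrow>
      matrix_normal (M n) (X n) (mat (p n) n (\<lambda>(k, i). \<mu> n $ k)) (\<Sigma> n) (\<Psi> n)"
    and C1_const: "c\<^sub>1 > 0"
    and C1_Sigma: "\<And>n. n \<ge> 1 \<Longrightarrow>
      1 / c\<^sub>1 \<le> lambda_min (\<Sigma> n) \<and> lambda_min (\<Sigma> n) \<le> lambda_max (\<Sigma> n) \<and> lambda_max (\<Sigma> n) \<le> c\<^sub>1"
    and C1_Psi: "\<And>n. n \<ge> 1 \<Longrightarrow>
      1 / c\<^sub>1 \<le> lambda_min (\<Psi> n) \<and> lambda_min (\<Psi> n) \<le> lambda_max (\<Psi> n) \<and> lambda_max (\<Psi> n) \<le> c\<^sub>1"
    and C2_tau: "0 < \<tau>" "\<tau> < 2"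
    and C2_Psi: "\<And>n i. n \<ge> 1 \<Longrightarrow> i < n \<Longrightarrow> (\<Sum>k<n. \<bar>\<Psi> n $$ (i, k)\<bar> powr \<tau>) \<le> C"
    and C2_Sigma: "\<And>n j. n \<ge> 1 \<Longrightarrow> j < p n \<Longrightarrow> (\<Sum>k<p n. \<bar>\<Sigma> n $$ (j, k)\<bar> powr \<tau>) \<le> C"
    and C3_const: "c\<^sub>3 > 0" "\<epsilon> > 0"
    and C3_lower: "\<And>n. n \<ge> 1 \<Longrightarrow> real (p n) > c\<^sub>3 * real n"
    and C3_upper: "(\<lambda>n. ln (real (p n))) \<in> o(\<lambda>n. real n powr min (1 - \<epsilon>) (2 / \<tau> - 1))"
    and delta: "\<delta> > sqrt 2"
  shows "bigO_prob M (\<lambda>n \<omega>. A_ratio (Sigma_thr \<delta> (X n \<omega>)) / A_ratio (\<Sigma> n) - 1)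
           (\<lambda>n. sqrt (ln (real (p n)) / real n) powr min 1 (2 - \<tau>)) \<and>
         bigO_prob M (\<lambda>n \<omega>. (frobenius_norm (Sigma_thr \<delta> (X n \<omega>)))\<^sup>2 / (frobenius_norm (\<Sigma> n))\<^sup>2 - 1)
           (\<lambda>n. sqrt (ln (real (p n)) / real n) powr min 1 (2 - \<tau>))"
proof -
  define c where "c = c\<^sub>1"
  \<comment> \<open>Already \<open>n = 1\<close> forces it, since the eigenvalue bounds give
    \<open>1 / c \<le> c\<close>.\<close>
  have c1: "c \<ge> 1"
  proof (rule ccontr)
    assume "\<not> c \<ge> 1"
    hence "c < 1" "c > 0" using C1_const by (simp_all add: c_def)
    hence "1 < 1 / c" by simp
    with C1_Sigma[of 1] \<open>c < 1\<close> show False by (simp add: c_def)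
  qed
  define d where "d = (sqrt 2 + \<delta>) / 2"
  have s2: "sqrt 2 > (0::real)" by simp
  have d: "d > 0" "sqrt 2 < d" "d < \<delta>" using delta s2 by (auto simp: d_def simp del: real_sqrt_gt_0_iff)
  have \<delta>0: "\<delta> > 0" using d by linarith
  \<comment> \<open>The surplus of the ideal Chernoff rate over 1. One half is spent on
    \<open>a\<close>, since \<open>2 * a * d \<le> e / 2\<close>, and the other half on
    \<open>\<kappa>\<close>.\<close>
  define e where "e = d\<^sup>2 / 2 - 1"
  have "(sqrt 2)\<^sup>2 < d\<^sup>2" using d(2) by (intro power_strict_mono) auto
  hence e: "e > 0" by (simp add: e_def)
  define a where "a = min 1 (e / (4 * d))"
  define \<kappa> where "\<kappa> = e / d\<^sup>2"
  have a: "a > 0" "a \<le> 1" using e d(1) by (auto simp: a_def)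
  have \<kappa>0: "\<kappa> > 0" using e d(1) by (simp add: \<kappa>_def)
  have margin: "d\<^sup>2 / 2 - 2 * a * d - \<kappa> * d\<^sup>2 / 2 \<ge> 1"
  proof -
    have "a * (4 * d) \<le> e / (4 * d) * (4 * d)" using d(1) by (intro mult_right_mono) (auto simp: a_def)
    hence "2 * a * d \<le> e / 2" using d(1) by simp
    moreover have "\<kappa> * d\<^sup>2 / 2 = e / 2" using d(1) by (simp add: \<kappa>_def)
    moreover have "d\<^sup>2 / 2 = 1 + e" by (simp add: e_def)
    ultimately show ?thesis by linarith
  qed
  \<comment> \<open>Half the distance of \<open>(d / \<delta>)^2\<close> from 1, so that
    \<open>d < \<delta> * sqrt (1 - \<eta>)\<close> holds strictly and absorbs all vanishing
    corrections.\<close>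
  define \<eta> where "\<eta> = (1 - (d / \<delta>)\<^sup>2) / 2"
  have "(d / \<delta>)\<^sup>2 < 1\<^sup>2" using d \<delta>0 by (intro power_strict_mono) auto
  moreover have "(d / \<delta>)\<^sup>2 > 0" using d \<delta>0 by simp
  ultimately have \<eta>: "0 < \<eta>" "\<eta> < 1" "(d / \<delta>)\<^sup>2 < 1 - \<eta>" by (auto simp: \<eta>_def field_simps)
  have "d / \<delta> < sqrt (1 - \<eta>)" using \<eta>(3) d \<delta>0 by (intro real_less_rsqrt) auto
  hence d\<eta>: "d < \<delta> * sqrt (1 - \<eta>)" using \<delta>0 by (simp add: field_simps)
  define lam where "lam n = sqrt (ln (real (p n)) / real n)" for n
  have p_inf: "filterlim (\<lambda>n. real (p n)) at_top sequentially"
  proof (rule filterlim_at_top_mono)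
    show "filterlim (\<lambda>n. c\<^sub>3 * real n) at_top sequentially"
      using C3_const(1) by (intro filterlim_tendsto_pos_mult_at_top[OF tendsto_const] filterlim_real_sequentially)
    show "\<forall>\<^sub>F n in sequentially. c\<^sub>3 * real n \<le> real (p n)"
      using C3_lower by (auto intro!: eventually_sequentiallyI[of 1] less_imp_le)
  qed
  have lnp_inf: "filterlim (\<lambda>n. ln (real (p n))) at_top sequentially"
    by (rule filterlim_compose[OF ln_at_top p_inf])
  \<comment> \<open>The exponent is at most 1, so \<open>ln p = o(n)\<close> and \<open>lam\<close>
    tends to 0.\<close>
  have "(\<lambda>n. real n powr min (1 - \<epsilon>) (2 / \<tau> - 1)) \<in> O(\<lambda>n. real n)"
  proof (rule bigoI[where c=1])
    show "\<forall>\<^sub>F n in sequentially. norm (real n powr min (1 - \<epsilon>) (2 / \<tau> - 1)) \<le> 1 * norm (real n)"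
    proof (rule eventually_sequentiallyI[of 1])
      fix n :: nat assume n: "1 \<le> n"
      have "min (1 - \<epsilon>) (2 / \<tau> - 1) \<le> 1" using C3_const by simp
      hence "real n powr min (1 - \<epsilon>) (2 / \<tau> - 1) \<le> real n powr 1" using n by (intro powr_mono) auto
      thus "norm (real n powr min (1 - \<epsilon>) (2 / \<tau> - 1)) \<le> 1 * norm (real n)" using n by simp
    qed
  qed
  with C3_upper have "(\<lambda>n. ln (real (p n))) \<in> o(\<lambda>n. real n)" by (rule landau_o.small_big_trans)
  hence "((\<lambda>n. ln (real (p n)) / real n) \<longlongrightarrow> 0) sequentially" by (rule smalloD_tendsto)
  hence "((\<lambda>n. sqrt (ln (real (p n)) / real n)) \<longlongrightarrow> sqrt 0) sequentially" by (rule tendsto_real_sqrt)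
  hence lam0: "(lam \<longlongrightarrow> 0) sequentially" by (simp add: lam_def[abs_def])
  have pinv: "((\<lambda>n. x / real (p n)) \<longlongrightarrow> 0) sequentially" for x
    by (rule tendsto_divide_0[OF tendsto_const]) (rule filterlim_at_top_imp_at_infinity[OF p_inf])
  have ninv: "((\<lambda>n. (real n - 1) / real n) \<longlongrightarrow> 1) sequentially"
  proof -
    have "((\<lambda>n. 1 - 1 / real n) \<longlongrightarrow> 1 - 0) sequentially"
      by (intro tendsto_intros lim_1_over_n)
    moreover have "\<forall>\<^sub>F n in sequentially. 1 - 1 / real n = (real n - 1) / real n"
      by (rule eventually_sequentiallyI[of 1]) (simp add: diff_divide_distrib)
    ultimately show ?thesis using tendsto_cong by force
  qed
  \<comment> \<open>Most smallness conditions are continuous functions of \<open>lam\<close> alone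
    and hold strictly at \<open>lam = 0\<close>.\<close>
  have ev_lam: "\<forall>\<^sub>F n in sequentially. f (lam n) < y" if "isCont f 0" "f 0 < y" for f :: "real \<Rightarrow> real" and y
    using isCont_tendsto_compose[OF that(1) lam0] that(2) by (rule order_tendstoD(2))
  have ev1: "\<forall>\<^sub>F n in sequentially. lam n < 1" using ev_lam[of "\<lambda>x. x" 1] by simp
  have ev2: "\<forall>\<^sub>F n in sequentially. 4 * c * lam n < 1" using ev_lam[of "\<lambda>x. 4 * c * x" 1] by simp
  have ev3: "\<forall>\<^sub>F n in sequentially. 8 * d * c * lam n < 1" using ev_lam[of "\<lambda>x. 8 * d * c * x" 1] by simp
  have ev4: "\<forall>\<^sub>F n in sequentially. (1 + (a * lam n)\<^sup>2) * (1 + 8 * d * c * lam n) < 1 + \<kappa>"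
    using ev_lam[of "\<lambda>x. (1 + (a * x)\<^sup>2) * (1 + 8 * d * c * x)" "1 + \<kappa>"] \<kappa>0 by simp
  have ev5: "\<forall>\<^sub>F n in sequentially. 4 * c\<^sup>2 * ((6 * c + 6) * lam n) < 1"
    using ev_lam[of "\<lambda>x. 4 * c\<^sup>2 * ((6 * c + 6) * x)" 1] by simp
  have ev6: "\<forall>\<^sub>F n in sequentially. 4 * (a + (6 * c + 6))\<^sup>2 * (lam n)\<^sup>2 < 1"
    using ev_lam[of "\<lambda>x. 4 * (a + (6 * c + 6))\<^sup>2 * x\<^sup>2" 1] by simp
  have ev7: "\<forall>\<^sub>F n in sequentially. c ^ 4 / real (p n) < 1"
    by (rule order_tendstoD(2)[OF pinv]) simp
  have ev8: "\<forall>\<^sub>F n in sequentially. d < (1 - 4 * (a + (6 * c + 6))\<^sup>2 * (lam n)\<^sup>2) * (1 - (6 * c + 6) * lam n) * ((real n - 1) / real n)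
        * (\<delta> * sqrt ((1 - \<eta>) * (1 - c ^ 4 / real (p n))) / (1 + (6 * c + 6) * lam n))"
  \<comment> \<open>The right-hand side converges to \<open>\<delta> * sqrt (1 - \<eta>)\<close>,
    which exceeds \<open>d\<close>.\<close>
  proof (rule order_tendstoD(1))
    show "((\<lambda>n. (1 - 4 * (a + (6 * c + 6))\<^sup>2 * (lam n)\<^sup>2) * (1 - (6 * c + 6) * lam n) * ((real n - 1) / real n)
        * (\<delta> * sqrt ((1 - \<eta>) * (1 - c ^ 4 / real (p n))) / (1 + (6 * c + 6) * lam n)))
      \<longlongrightarrow> (1 - 4 * (a + (6 * c + 6))\<^sup>2 * 0\<^sup>2) * (1 - (6 * c + 6) * 0) * 1
        * (\<delta> * sqrt ((1 - \<eta>) * (1 - 0)) / (1 + (6 * c + 6) * 0))) sequentially"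
      by (intro tendsto_intros lam0 ninv pinv) simp
  qed (use d\<eta> in simp)
  have ev9: "\<forall>\<^sub>F n in sequentially. 1 \<le> ln (real (p n))" using lnp_inf by (simp add: filterlim_at_top)
  have ev10: "\<forall>\<^sub>F n in sequentially. 2 \<le> real (p n)" using p_inf unfolding filterlim_at_top by blast
  have ev11: "\<forall>\<^sub>F n in sequentially. 2 * c \<le> real n"
    using filterlim_real_sequentially by (simp add: filterlim_at_top)
  note ev = ev1 ev2 ev3 ev4 ev5 ev6 ev7 ev8 ev9 ev10 ev11 eventually_ge_at_top[of "2::nat"]
  define q where "q = min 1 (2 - \<tau>)"
  have main: "\<exists>B. \<forall>\<^sub>F n in sequentially.
      measure (M n) {\<omega> \<in> space (M n). \<bar>(frobenius_norm (Sigma_thr \<delta> (X n \<omega>)))\<^sup>2 / (frobenius_norm (\<Sigma> n))\<^sup>2 - 1\<bar> \<le> B * lam n powr q} \<ge> 1 - \<gamma> \<and>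
      measure (M n) {\<omega> \<in> space (M n). \<bar>A_ratio (Sigma_thr \<delta> (X n \<omega>)) / A_ratio (\<Sigma> n) - 1\<bar> \<le> (4 * B + 12 * (6 * c + 6)) * lam n powr q} \<ge> 1 - \<gamma>"
    if \<gamma>: "\<gamma> > 0" for \<gamma>
  proof -
    \<comment> \<open>The Markov bounds then take up exactly half of the allowed probability; the
      terms of order \<open>1 / p\<close> eventually fit into the other half.\<close>
    define N where "N = 6 / \<gamma>"
    have N: "N > 0" "3 / N = \<gamma> / 2" using \<gamma> by (simp_all add: N_def)
    define B where "B = c\<^sup>2 * data_sample.sq_err c \<tau> C a \<delta> (1 / c\<^sub>3) N"
    have "\<forall>\<^sub>F n in sequentially. (2 + 2 ^ 23 * c ^ 8 / \<eta>\<^sup>2) / real (p n) < \<gamma> / 2"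
      using \<gamma> by (intro order_tendstoD(2)[OF pinv]) simp
    with ev have "\<forall>\<^sub>F n in sequentially.
      measure (M n) {\<omega> \<in> space (M n). \<bar>(frobenius_norm (Sigma_thr \<delta> (X n \<omega>)))\<^sup>2 / (frobenius_norm (\<Sigma> n))\<^sup>2 - 1\<bar> \<le> B * lam n powr q} \<ge> 1 - \<gamma> \<and>
      measure (M n) {\<omega> \<in> space (M n). \<bar>A_ratio (Sigma_thr \<delta> (X n \<omega>)) / A_ratio (\<Sigma> n) - 1\<bar> \<le> (4 * B + 12 * (6 * c + 6)) * lam n powr q} \<ge> 1 - \<gamma>"
    proof eventually_elim
      case (elim n)
      have n1: "n \<ge> 1" using elim(12) by simp
      have "1 * 1 \<le> real n * ln (real (p n))" using elim(9) n1 by (intro mult_mono) auto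
      hence "1 \<le> sqrt (real n * ln (real (p n)))" by simp
      also have "\<dots> = real n * lam n"
      proof -
        have "real n * lam n = sqrt ((real n)\<^sup>2 * (ln (real (p n)) / real n))" unfolding lam_def by (subst real_sqrt_mult) simp
        thus ?thesis using n1 by (simp add: power2_eq_square)
      qed
      finally have nl: "1 \<le> real n * lam n" .
      have r: "real n \<le> 1 / c\<^sub>3 * real (p n)"
        using C3_lower[OF n1] C3_const(1) by (simp add: field_simps)
      have P: "1 - \<gamma> \<le> 1 - (2 / real (p n) + 2 ^ 23 * c ^ 8 / (\<eta>\<^sup>2 * real (p n)) + 3 / N)"
        using elim(13) unfolding N(2) by (simp add: add_divide_distrib)
      note E = estimation_error_probability[OF prob[OF n1] cov_Sigma[OF n1] cov_Psi[OF n1] Psi_diag[OF n1] normal[OF n1],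
        of c \<tau> C d a \<kappa> \<eta> N \<delta> "1 / c\<^sub>3" "lam n"]
      have bounds: "1 / c \<le> lambda_min (\<Sigma> n)" "lambda_max (\<Sigma> n) \<le> c" "1 / c \<le> lambda_min (\<Psi> n)" "lambda_max (\<Psi> n) \<le> c"
        using C1_Sigma[OF n1] C1_Psi[OF n1] by (simp_all add: c_def)
      have p2: "p n \<ge> 2" using elim(10) by simp
      note h = bounds c1 p2 elim(12) elim(11) C2_tau C2_Sigma[OF n1] d(1) margin a \<eta>(1,2) N(1) \<delta>0 r lam_def[of n] nl
        elim(1-8)[THEN less_imp_le] elim(5)
      have E': "1 - (2 / real (p n) + 2 ^ 23 * c ^ 8 / (\<eta>\<^sup>2 * real (p n)) + 3 / N)
         \<le> measure (M n) {\<omega> \<in> space (M n). \<bar>(frobenius_norm (Sigma_thr \<delta> (X n \<omega>)))\<^sup>2 / (frobenius_norm (\<Sigma> n))\<^sup>2 - 1\<bar> \<le> B * lam n powr q}"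
        "1 - (2 / real (p n) + 2 ^ 23 * c ^ 8 / (\<eta>\<^sup>2 * real (p n)) + 3 / N)
         \<le> measure (M n) {\<omega> \<in> space (M n). \<bar>A_ratio (Sigma_thr \<delta> (X n \<omega>)) / A_ratio (\<Sigma> n) - 1\<bar> \<le> (4 * B + 12 * (6 * c + 6)) * lam n powr q}"
        unfolding B_def q_def
        by (rule E; (assumption | fact h))+
      show ?case using E' P by linarith
    qed
    thus ?thesis by blast
  qed
  show ?thesis
    unfolding bigO_prob_def lam_def[symmetric] q_def[symmetric]
  proof (intro conjI allI impI)
    fix \<gamma> :: real assume "\<gamma> > 0"
    from main[OF this] obtain B where "\<forall>\<^sub>F n in sequentially.
      measure (M n) {\<omega> \<in> space (M n). \<bar>(frobenius_norm (Sigma_thr \<delta> (X n \<omega>)))\<^sup>2 / (frobenius_norm (\<Sigma> n))\<^sup>2 - 1\<bar> \<le> B * lam n powr q} \<ge> 1 - \<gamma> \<and>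
      measure (M n) {\<omega> \<in> space (M n). \<bar>A_ratio (Sigma_thr \<delta> (X n \<omega>)) / A_ratio (\<Sigma> n) - 1\<bar> \<le> (4 * B + 12 * (6 * c + 6)) * lam n powr q} \<ge> 1 - \<gamma>" ..
    note B = this
    show "\<exists>K. \<forall>\<^sub>F n in sequentially. 1 - \<gamma> \<le> measure (M n) {\<omega> \<in> space (M n). \<bar>A_ratio (Sigma_thr \<delta> (X n \<omega>)) / A_ratio (\<Sigma> n) - 1\<bar> \<le> K * lam n powr q}"
      by (rule exI, rule eventually_mono[OF B]) (rule conjunct2)
    show "\<exists>K. \<forall>\<^sub>F n in sequentially. 1 - \<gamma> \<le> measure (M n) {\<omega> \<in> space (M n). \<bar>(frobenius_norm (Sigma_thr \<delta> (X n \<omega>)))\<^sup>2 / (frobenius_norm (\<Sigma> n))\<^sup>2 - 1\<bar> \<le> K * lam n powr q}"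
      by (rule exI, rule eventually_mono[OF B]) (rule conjunct1)
  qed
qed

end
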